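(* Consider the space-time HDG, EHDG and EDG methods for the Navier--Stokes equations on a moving domain (the discrete problem, spaces and forms are defined in the context). All three methods are energy-stable. That is: for each of the three methods, if the penalty parameter $\alpha>0$ is sufficiently large, and the data are homogeneous, $f=0$ and $g=0$ (with homogeneous Dirichlet condition on $\partial\mathcal{E}^D$), then for every $n\in\{0,\dots,N-1\}$ every solution $(\boldsymbol{u}_h,\boldsymbol{p}_h)\in X_h^n$ of the discrete problem on the slab $\mathcal{E}^n$, with $\boldsymbol{u}_h=(u_h,\bar u_h)$, satisfies $$\int_{\Omega^{n+1}}|u_h|^2\,dx\ \le\ \int_{\Omega^n}|u_h^-|^2\,dx ,$$ where on the left $u_h$ denotes the trace on $\Omega^{n+1}$ from within $\mathcal{E}^n$, and on the right $u_h^-$ is the trace on $\Omega^n$ of the discrete velocity from the previous slab $\mathcal{E}^{n-1}$ if $n>0$, and the discrete initial condition if $n=0$.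
   Context: **Domain and data.** $d\in\{2,3\}$, $\Omega(t)\subset\mathbb{R}^d$ is a domain depending continuously on $t\in[0,T]$, and $\mathcal{E}=\{(t,x): 0<t<T,\ x\in\Omega(t)\}\subset\mathbb{R}^{d+1}$. The boundary is partitioned without overlap as $\partial\mathcal{E}=\partial\mathcal{E}^D\cup\partial\mathcal{E}^N\cup\Omega(0)\cup\Omega(T)$ (Dirichlet part, Neumann part, bottom, top). $\nu>0$ is the viscosity, $f:\mathcal{E}\to\mathbb{R}^d$ a forcing term, $g:\partial\mathcal{E}^N\to\mathbb{R}^d$ boundary data, $u_0:\Omega(0)\to\mathbb{R}^d$ a divergence-free initial velocity. $\nabla$ and $\nabla\cdot$ are spatial operators. Unit space-time outward normals are written $(n_t,n)\in\mathbb{R}\times\mathbb{R}^d$ (so the spatial part $n$ need not have unit length), and $\partial v/\partial n=(\nabla v)n$ with $(\nabla v)_{ij}=\partial_{x_j}v_i$. **Mesh.** $0=t^0<\dots<t^N=T$, $I^n=(t^n,t^{n+1})$, $\mathcal{E}^n=\{(t,x)\in\mathcal{E}:t\in I^n\}$, $\Omega^n=\Omega(t^n)$, $\partial\mathcal{E}^n=\{(t,x)\in\partial\mathcal{E}:t\in I^n\}$. $\mathcal{T}^n$ is a triangulation of $\mathcal{E}^n$ into non-overlapping $(d+1)$-simplices $\mathcal{K}$, with meshes matching at each $\Omega^n$ between consecutive slabs. Each $\mathcal{K}\in\mathcal{T}^n$ has at most one facet with $|n_t|=1$, called $K^n$ if $n_t=-1$ and $K^{n+1}$ if $n_t=1$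 (an integral over a non-existing $K^n$ or $K^{n+1}$ is zero); $\mathcal{Q}^n_{\mathcal{K}}$ is the remaining part of $\partial\mathcal{K}$. $h_{\mathcal{K}}>0$ is the size of $\mathcal{K}$. $\mathcal{S}^n$ is the set of facets in the slab with $|n_t|\neq1$, and $\Gamma^n$ their union. **Spaces.** For an integer $k\ge1$, with $P_l(D)$ the polynomials of degree at most $l$ on $D$: $V_h^n=\{v_h\in[L^2(\mathcal{E}^n)]^d: v_h|_{\mathcal{K}}\in[P_k(\mathcal{K})]^d\ \forall\mathcal{K}\in\mathcal{T}^n\}$, $Q_h^n=\{q_h\in L^2(\mathcal{E}^n): q_h|_{\mathcal{K}}\in P_{k-1}(\mathcal{K})\ \forall\mathcal{K}\in\mathcal{T}^n\}$, $\bar V_h^n=\{\bar v_h\in[L^2(\Gamma^n)]^d:\bar v_h|_S\in[P_k(S)]^d\ \forall S\in\mathcal{S}^n,\ \bar v_h=0\text{ on }\partial\mathcal{E}^D\cap\partial\mathcal{E}^n\}$, $\bar Q_h^n=\{\bar q_h\in L^2(\Gamma^n):\bar q_h|_S\in P_k(S)\ \forall S\in\mathcal{S}^n\}$. The HDG method uses $X_h^{v,n}=V_h^n\times\bar V_h^n$, $X_h^{q,n}=Q_h^n\times\bar Q_h^n$. The EHDG method uses $X_h^{v,n}=V_h^n\times(\bar V_h^n\cap C(\Gamma^n))$, $X_h^{q,n}=Q_h^n\times\bar Q_h^n$. The EDG method uses $X_h^{v,n}=V_h^n\times(\bar V_h^n\cap C(\Gamma^n))$, $X_h^{q,n}=Q_h^n\times(\bar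 Q_h^n\cap C(\Gamma^n))$. Set $X_h^n=X_h^{v,n}\times X_h^{q,n}$ and write $\boldsymbol{v}_h=(v_h,\bar v_h)$, $\boldsymbol{q}_h=(q_h,\bar q_h)$. **Discrete problem.** For $n=0,\dots,N-1$ successively, find $(\boldsymbol{u}_h,\boldsymbol{p}_h)\in X_h^n$ such that $$t_h^n(\boldsymbol{u}_h;\boldsymbol{u}_h,\boldsymbol{v}_h)+a_h^n(\boldsymbol{u}_h,\boldsymbol{v}_h)+b_h^n(\boldsymbol{p}_h,\boldsymbol{v}_h)=L_h^n(\boldsymbol{v}_h)\ \ \forall\boldsymbol{v}_h\in X_h^{v,n},\qquad b_h^n(\boldsymbol{q}_h,\boldsymbol{u}_h)=0\ \ \forall\boldsymbol{q}_h\in X_h^{q,n},$$ where $$L_h^n(\boldsymbol{v})=\sum_{\mathcal{K}\in\mathcal{T}^n}\int_{\mathcal{K}}f\cdot v\,dx\,dt-\int_{\partial\mathcal{E}^N\cap\partial\mathcal{E}^n}g\cdot\bar v\,ds+\int_{\Omega^n}u_h^-\cdot v\,dx,$$ with $u_h^-=\lim_{\varepsilon\to0^+}u_h(t^n-\varepsilon)$ for $n>0$ (from the previous slab) and, for $n=0$, $u_h^-$ an exactly divergence-free projection of $u_0$ into $V_h^0\cap H(\mathrm{div})$ (HDG, EHDG) or into $V_h^0$ (EDG); $$a_h^n(\boldsymbol{u},\boldsymbol{v})=\sum_{\mathcal{K}}\int_{\mathcal{K}}\nu\nabla u:\nabla v\,dx\,dt+\sum_{\mathcal{K}}\int_{\mathcal{Q}^n_{\mathcal{K}}}\frac{\nu\alpha}{h_{\mathcal{K}}}(u-\bar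 u)\cdot(v-\bar v)\,ds-\sum_{\mathcal{K}}\int_{\mathcal{Q}^n_{\mathcal{K}}}\nu\Big[(u-\bar u)\cdot\frac{\partial v}{\partial n}+\frac{\partial u}{\partial n}\cdot(v-\bar v)\Big]ds,$$ with penalty parameter $\alpha>0$; $$b_h^n(\boldsymbol{p},\boldsymbol{v})=-\sum_{\mathcal{K}}\int_{\mathcal{K}}p\,\nabla\cdot v\,dx\,dt+\sum_{\mathcal{K}}\int_{\mathcal{Q}^n_{\mathcal{K}}}(v-\bar v)\cdot n\,\bar p\,ds;$$ $$\begin{aligned}t_h^n(\boldsymbol{w};\boldsymbol{u},\boldsymbol{v})=&\sum_{\mathcal{K}}\int_{\mathcal{Q}^n_{\mathcal{K}}}(n_t+w\cdot n)(u+\lambda(\bar u-u))\cdot(v-\bar v)\,ds-\sum_{\mathcal{K}}\int_{\mathcal{Q}^n_{\mathcal{K}}}\tfrac12(w\cdot n)(u\cdot v-\bar u\cdot\bar v)\,ds\\&-\sum_{\mathcal{K}}\int_{\mathcal{K}}(u\cdot\partial_tv+u\otimes w:\nabla v)\,dx\,dt+\sum_{\mathcal{K}}\int_{\mathcal{K}}\tfrac12(u\otimes w:\nabla v+v\otimes w:\nabla u)\,dx\,dt\\&+\int_{\partial\mathcal{E}^N\cap\partial\mathcal{E}^n}\max(n_t+\bar w\cdot n,0)\,\bar u\cdot\bar v\,ds-\int_{\partial\mathcal{E}^N\cap\partial\mathcal{E}^n}\tfrac12(\bar w\cdot n)\,\bar u\cdot\bar v\,ds+\sum_{\mathcal{K}}\int_{K^{n+1}}u\cdot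 v\,dx,\end{aligned}$$ where on $\mathcal{Q}^n_{\mathcal{K}}$ the upwind indicator is $\lambda=1$ if $n_t+w\cdot n<0$ and $\lambda=0$ otherwise. "$\alpha$ sufficiently large" means: there is $\alpha_0>0$, not depending on the discrete solution or on $u_0$, such that the assertion holds for all $\alpha\ge\alpha_0$. *)

theory Defs
  imports "HOL-Analysis.Analysis"
begin

type_synonym 'd spacetime = "real \<times> (real, 'd) vec"
type_synonym 'd field = "'d spacetime \<Rightarrow> (real, 'd) vec"

definition L2_on :: "'a::euclidean_space set \<Rightarrow> ('a \<Rightarrow> 'b::euclidean_space) \<Rightarrow> bool"
  where "L2_on A v \<longleftrightarrow>
    v \<in> borel_measurable (lebesgue_on A) \<and> integrable (lebesgue_on A) (\<lambda>x. (norm (v x))\<^sup>2)"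

(* Polynomial functions of total degree at most l; a is the multi-index of a monomial.
   Restricted to a set D, they form P_l(D). *)
definition poly_upto :: "nat \<Rightarrow> ('a::euclidean_space \<Rightarrow> real) set"
  where "poly_upto l = {p. \<exists>c. p =
    (\<lambda>z. \<Sum>a\<in>{a \<in> Basis \<rightarrow>\<^sub>E {..l}. (\<Sum>b\<in>Basis. a b) \<le> l}. c a * (\<Prod>b\<in>Basis. (z \<bullet> b) ^ a b))}"


section \<open>Simplices in space-time, normals and surface integrals\<close>

(* Unit outward normal (n_t, n) of the simplex K on its facet S. *)
definition outward_normal :: "('d::finite) spacetime set \<Rightarrow> 'd spacetime set \<Rightarrow> 'd spacetime"
  where "outward_normal K S = (THE \<eta>. norm \<eta> = 1 \<and> (\<forall>x\<in>S. \<forall>y\<in>K. \<eta> \<bullet> y \<le> \<eta> \<bullet> x))"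

definition flat_facets :: "('d::finite) spacetime set \<Rightarrow> 'd spacetime set set"
  where "flat_facets K = {S. S facet_of K \<and> \<bar>fst (outward_normal K S)\<bar> = 1}"

definition top_facets :: "('d::finite) spacetime set \<Rightarrow> 'd spacetime set set"
  where "top_facets K = {S. S facet_of K \<and> fst (outward_normal K S) = 1}"

definition lateral_facets :: "('d::finite) spacetime set \<Rightarrow> 'd spacetime set set"
  where "lateral_facets K = {S. S facet_of K \<and> \<bar>fst (outward_normal K S)\<bar> \<noteq> 1}"

(* An isometric parametrization by R^d of the hyperplane spanned by the facet S. The surface
   measure on S is the image of d-dimensional Lebesgue measure; it does not depend on the choice. *)
definition chart :: "('d::finite) spacetime set \<Rightarrow> real^'d \<Rightarrow> 'd spacetime"
  where "chart S = (SOME \<phi>. (\<exists>a A. linear A \<and> (\<forall>y. norm (A y) = norm y) \<and> \<phi> = (\<lambda>y. a + A y))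
    \<and> S \<subseteq> range \<phi>)"

definition surf_int :: "('d::finite) spacetime set \<Rightarrow> 'd spacetime set \<Rightarrow> ('d spacetime \<Rightarrow> real) \<Rightarrow> real"
  where "surf_int S B F = (LINT y:(chart S -` (S \<inter> B))|lebesgue. F (chart S y))"

definition surf_L2 :: "('d::finite) spacetime set \<Rightarrow> ('d spacetime \<Rightarrow> 'b::euclidean_space) \<Rightarrow> bool"
  where "surf_L2 S v \<longleftrightarrow> L2_on (chart S -` S) (\<lambda>y. v (chart S y))"

(* Integral over the part in B of Q_K; the integrand receives the outward normal of K first. *)
definition lat_int ::
    "('d::finite) spacetime set \<Rightarrow> 'd spacetime set \<Rightarrow> ('d spacetime \<Rightarrow> 'd spacetime \<Rightarrow> real) \<Rightarrow> real"
  where "lat_int K B F = (\<Sum>S\<in>lateral_facets K. surf_int S B (F (outward_normal K S)))"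

(* Trace on the closed simplex K of a function given on the open simplex. *)
definition tr :: "('d::finite) spacetime set \<Rightarrow> ('d spacetime \<Rightarrow> 'b::t2_space) \<Rightarrow> 'd spacetime \<Rightarrow> 'b"
  where "tr K v z = Lim (at z within interior K) v"

definition trace_above :: "(('d::finite) spacetime \<Rightarrow> 'b::t2_space) \<Rightarrow> real \<Rightarrow> real^'d \<Rightarrow> 'b"
  where "trace_above v t x = Lim (at_right t) (\<lambda>s. v (s, x))"

definition trace_below :: "(('d::finite) spacetime \<Rightarrow> 'b::t2_space) \<Rightarrow> real \<Rightarrow> real^'d \<Rightarrow> 'b"
  where "trace_below v t x = Lim (at_left t) (\<lambda>s. v (s, x))"


section \<open>Differential operators\<close>

definition sgrad :: "('d::finite) field \<Rightarrow> 'd spacetime \<Rightarrow> real^'d^'d"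
  where "sgrad v z = jacobian (\<lambda>y. v (fst z, y)) (at (snd z))"

definition sdiv :: "('d::finite) field \<Rightarrow> 'd spacetime \<Rightarrow> real"
  where "sdiv v z = trace (sgrad v z)"

definition dt :: "('d::finite) field \<Rightarrow> 'd field"
  where "dt v z = vector_derivative (\<lambda>s. v (s, snd z)) (at (fst z))"

(* The inner product of matrices is the Frobenius product. *)
definition tensor :: "real^'d \<Rightarrow> real^'d \<Rightarrow> real^('d::finite)^'d"
  where "tensor a b = (\<chi> i j. a $ i * b $ j)"

definition has_weak_divergence :: "(real^'d::finite) set \<Rightarrow> (real^'d \<Rightarrow> real^'d) \<Rightarrow> (real^'d \<Rightarrow> real) \<Rightarrow> bool"
  where "has_weak_divergence A w q \<longleftrightarrow>
    (\<forall>\<phi> D. (\<forall>x. GDERIV \<phi> x :> D x) \<and> continuous_on UNIV D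
        \<and> compact (closure {x. \<phi> x \<noteq> 0}) \<and> closure {x. \<phi> x \<noteq> 0} \<subseteq> A \<longrightarrow>
      (LINT x:A|lebesgue. w x \<bullet> D x) = - (LINT x:A|lebesgue. q x * \<phi> x))"

definition Hdiv :: "(real^'d::finite) set \<Rightarrow> (real^'d \<Rightarrow> real^'d) set"
  where "Hdiv A = {w. L2_on A w \<and> (\<exists>q. L2_on A q \<and> has_weak_divergence A w q)}"

definition div_free :: "(real^'d::finite) set \<Rightarrow> (real^'d \<Rightarrow> real^'d) \<Rightarrow> bool"
  where "div_free A w \<longleftrightarrow> L2_on A w \<and> has_weak_divergence A w (\<lambda>_. 0)"


section \<open>Moving domain and space-time mesh\<close>

record ('d::finite) setting =
  horizon :: real
  Omega :: "real \<Rightarrow> (real^'d) set"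
  dirichlet :: "'d spacetime set"
  neumann :: "'d spacetime set"
  slabs :: nat
  tm :: "nat \<Rightarrow> real"
  mesh :: "nat \<Rightarrow> 'd spacetime set set"
  hsize :: "'d spacetime set \<Rightarrow> real"

(* Continuity of t |-> Omega(t) is continuity for the Hausdorff distance. *)
definition moving_domain :: "real \<Rightarrow> (real \<Rightarrow> (real^'d::finite) set) \<Rightarrow> bool"
  where "moving_domain T \<Omega> \<longleftrightarrow>
    (\<forall>t\<in>{0..T}. open (\<Omega> t) \<and> connected (\<Omega> t) \<and> \<Omega> t \<noteq> {}) \<and>
    (\<forall>t\<in>{0..T}. \<forall>e>0. \<exists>\<delta>>0. \<forall>s\<in>{0..T}. \<bar>s - t\<bar> < \<delta> \<longrightarrow>
      \<Omega> s \<subseteq> (\<Union>x\<in>\<Omega> t. ball x e) \<and> \<Omega> t \<subseteq> (\<Union>x\<in>\<Omega> s. ball x e))"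

definition st_domain :: "('d::finite) setting \<Rightarrow> 'd spacetime set"
  where "st_domain D = {(t, x). 0 < t \<and> t < horizon D \<and> x \<in> Omega D t}"

definition slab :: "('d::finite) setting \<Rightarrow> nat \<Rightarrow> 'd spacetime set"
  where "slab D n = {z \<in> st_domain D. tm D n < fst z \<and> fst z < tm D (Suc n)}"

definition slab_bdry :: "('d::finite) setting \<Rightarrow> nat \<Rightarrow> 'd spacetime set"
  where "slab_bdry D n = {z \<in> frontier (st_domain D). tm D n < fst z \<and> fst z < tm D (Suc n)}"

definition boundary_partition :: "('d::finite) setting \<Rightarrow> bool"
  where "boundary_partition D \<longleftrightarrow>
    (let bottom = {0} \<times> Omega D 0; top = {horizon D} \<times> Omega D (horizon D) in
      frontier (st_domain D) = dirichlet D \<union> neumann D \<union> bottom \<union> top \<and>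
      dirichlet D \<inter> neumann D = {} \<and> (dirichlet D \<union> neumann D) \<inter> (bottom \<union> top) = {} \<and>
      neumann D \<in> sets borel)"

(* The elements are closed simplices, as in the library notion triangulation, which includes
   that any two of them meet in a common face. *)
definition slab_mesh :: "('d::finite) setting \<Rightarrow> nat \<Rightarrow> bool"
  where "slab_mesh D n \<longleftrightarrow>
    triangulation (mesh D n) \<and>
    (\<forall>K\<in>mesh D n. int (CARD('d) + 1) simplex K \<and> interior K \<subseteq> slab D n
      \<and> card (flat_facets K) \<le> 1 \<and> hsize D K > 0) \<and>
    \<Union>(mesh D n) = closure (slab D n)"

definition facets_at :: "('d::finite) setting \<Rightarrow> nat \<Rightarrow> real \<Rightarrow> 'd spacetime set set"
  where "facets_at D n t = {S. \<exists>K\<in>mesh D n. S facet_of K \<and> (\<forall>z\<in>S. fst z = t)}"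

definition st_discretization :: "('d::finite) setting \<Rightarrow> bool"
  where "st_discretization D \<longleftrightarrow>
    horizon D > 0 \<and> moving_domain (horizon D) (Omega D) \<and> boundary_partition D \<and>
    tm D 0 = 0 \<and> tm D (slabs D) = horizon D \<and> (\<forall>n<slabs D. tm D n < tm D (Suc n)) \<and>
    (\<forall>n<slabs D. slab_mesh D n) \<and>
    (\<forall>n. Suc n < slabs D \<longrightarrow>
      facets_at D n (tm D (Suc n)) = facets_at D (Suc n) (tm D (Suc n)))"

definition skel :: "('d::finite) setting \<Rightarrow> nat \<Rightarrow> 'd spacetime set set"
  where "skel D n = (\<Union>K\<in>mesh D n. lateral_facets K)"


section \<open>Discrete spaces\<close>

(* Elements of the spaces are functions representing their L2 class that are polynomial on every
   open simplex, respectively on the relative interior of every facet. *)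

definition V_h :: "nat \<Rightarrow> ('d::finite) setting \<Rightarrow> nat \<Rightarrow> 'd field set"
  where "V_h k D n = {v. L2_on (slab D n) v \<and>
    (\<forall>K\<in>mesh D n. \<forall>i. \<exists>p\<in>poly_upto k. \<forall>z\<in>interior K. v z $ i = p z)}"

definition Q_h :: "nat \<Rightarrow> ('d::finite) setting \<Rightarrow> nat \<Rightarrow> ('d spacetime \<Rightarrow> real) set"
  where "Q_h k D n = {q. L2_on (slab D n) q \<and>
    (\<forall>K\<in>mesh D n. \<exists>p\<in>poly_upto (k - 1). \<forall>z\<in>interior K. q z = p z)}"

definition Vbar_h :: "nat \<Rightarrow> ('d::finite) setting \<Rightarrow> nat \<Rightarrow> 'd field set"
  where "Vbar_h k D n = {v.
    (\<forall>S\<in>skel D n. surf_L2 S v \<and> (\<forall>i. \<exists>p\<in>poly_upto k. \<forall>z\<in>rel_interior S. v z $ i = p z)) \<and>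
    (\<forall>z\<in>dirichlet D \<inter> slab_bdry D n. v z = 0)}"

definition Qbar_h :: "nat \<Rightarrow> ('d::finite) setting \<Rightarrow> nat \<Rightarrow> ('d spacetime \<Rightarrow> real) set"
  where "Qbar_h k D n = {q.
    \<forall>S\<in>skel D n. surf_L2 S q \<and> (\<exists>p\<in>poly_upto k. \<forall>z\<in>rel_interior S. q z = p z)}"

datatype hdg_variant = HDG | EHDG | EDG

definition X_v :: "hdg_variant \<Rightarrow> nat \<Rightarrow> ('d::finite) setting \<Rightarrow> nat \<Rightarrow> ('d field \<times> 'd field) set"
  where "X_v m k D n = V_h k D n \<times>
    (case m of HDG \<Rightarrow> Vbar_h k D n
      | EHDG \<Rightarrow> Vbar_h k D n \<inter> {v. continuous_on (\<Union>(skel D n)) v}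
      | EDG \<Rightarrow> Vbar_h k D n \<inter> {v. continuous_on (\<Union>(skel D n)) v})"

definition X_q :: "hdg_variant \<Rightarrow> nat \<Rightarrow> ('d::finite) setting \<Rightarrow> nat
    \<Rightarrow> (('d spacetime \<Rightarrow> real) \<times> ('d spacetime \<Rightarrow> real)) set"
  where "X_q m k D n = Q_h k D n \<times>
    (case m of HDG \<Rightarrow> Qbar_h k D n
      | EHDG \<Rightarrow> Qbar_h k D n
      | EDG \<Rightarrow> Qbar_h k D n \<inter> {q. continuous_on (\<Union>(skel D n)) q})"


section \<open>Forms\<close>

(* Volume integrals are taken over the open simplices, where the discrete functions are smooth.
   On a boundary facet the outward normal of the space-time domain is that of the adjacent
   simplex, so an integral over a part B of the lateral boundary is the sum over all K of the
   integrals over the part of Q_K in B; facets interior to the space-time domain do not meet B. *)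

definition a_h :: "('d::finite) setting \<Rightarrow> nat \<Rightarrow> real \<Rightarrow> real \<Rightarrow> 'd field \<times> 'd field \<Rightarrow> 'd field \<times> 'd field \<Rightarrow> real"
  where "a_h D n \<nu> \<alpha> = (\<lambda>(u, ub) (v, vb).
      (\<Sum>K\<in>mesh D n. LINT z:interior K|lebesgue. \<nu> * (sgrad u z \<bullet> sgrad v z))
    + (\<Sum>K\<in>mesh D n. lat_int K UNIV (\<lambda>\<eta> z.
        \<nu> * \<alpha> / hsize D K * ((tr K u z - ub z) \<bullet> (tr K v z - vb z))))
    - (\<Sum>K\<in>mesh D n. lat_int K UNIV (\<lambda>\<eta> z.
        \<nu> * ((tr K u z - ub z) \<bullet> (tr K (sgrad v) z *v snd \<eta>)
           + (tr K (sgrad u) z *v snd \<eta>) \<bullet> (tr K v z - vb z)))))"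

definition b_h :: "('d::finite) setting \<Rightarrow> nat
    \<Rightarrow> ('d spacetime \<Rightarrow> real) \<times> ('d spacetime \<Rightarrow> real) \<Rightarrow> 'd field \<times> 'd field \<Rightarrow> real"
  where "b_h D n = (\<lambda>(p, pb) (v, vb).
    - (\<Sum>K\<in>mesh D n. LINT z:interior K|lebesgue. p z * sdiv v z)
    + (\<Sum>K\<in>mesh D n. lat_int K UNIV (\<lambda>\<eta> z. ((tr K v z - vb z) \<bullet> snd \<eta>) * pb z)))"

definition upwind :: "('d::finite) spacetime \<Rightarrow> real^'d \<Rightarrow> real"
  where "upwind \<eta> w = (if fst \<eta> + w \<bullet> snd \<eta> < 0 then 1 else 0)"

definition t_h :: "('d::finite) setting \<Rightarrow> nat
    \<Rightarrow> 'd field \<times> 'd field \<Rightarrow> 'd field \<times> 'd field \<Rightarrow> 'd field \<times> 'd field \<Rightarrow> real"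
  where "t_h D n = (\<lambda>(w, wb) (u, ub) (v, vb).
      (\<Sum>K\<in>mesh D n. lat_int K UNIV (\<lambda>\<eta> z. (fst \<eta> + tr K w z \<bullet> snd \<eta>) *
        ((tr K u z + upwind \<eta> (tr K w z) *\<^sub>R (ub z - tr K u z)) \<bullet> (tr K v z - vb z))))
    - (\<Sum>K\<in>mesh D n. lat_int K UNIV (\<lambda>\<eta> z.
        1/2 * (tr K w z \<bullet> snd \<eta>) * (tr K u z \<bullet> tr K v z - ub z \<bullet> vb z)))
    - (\<Sum>K\<in>mesh D n. LINT z:interior K|lebesgue.
        u z \<bullet> dt v z + tensor (u z) (w z) \<bullet> sgrad v z)
    + (\<Sum>K\<in>mesh D n. LINT z:interior K|lebesgue.
        1/2 * (tensor (u z) (w z) \<bullet> sgrad v z + tensor (v z) (w z) \<bullet> sgrad u z))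
    + (\<Sum>K\<in>mesh D n. lat_int K (neumann D \<inter> slab_bdry D n) (\<lambda>\<eta> z.
        max (fst \<eta> + wb z \<bullet> snd \<eta>) 0 * (ub z \<bullet> vb z)))
    - (\<Sum>K\<in>mesh D n. lat_int K (neumann D \<inter> slab_bdry D n) (\<lambda>\<eta> z.
        1/2 * (wb z \<bullet> snd \<eta>) * (ub z \<bullet> vb z)))
    + (\<Sum>K\<in>mesh D n. \<Sum>S\<in>top_facets K. surf_int S UNIV (\<lambda>z. tr K u z \<bullet> tr K v z)))"

definition L_h :: "('d::finite) setting \<Rightarrow> nat \<Rightarrow> 'd field \<Rightarrow> 'd field \<Rightarrow> (real^'d \<Rightarrow> real^'d)
    \<Rightarrow> 'd field \<times> 'd field \<Rightarrow> real"
  where "L_h D n f g um = (\<lambda>(v, vb).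
      (\<Sum>K\<in>mesh D n. LINT z:interior K|lebesgue. f z \<bullet> v z)
    - (\<Sum>K\<in>mesh D n. lat_int K (neumann D \<inter> slab_bdry D n) (\<lambda>\<eta> z. g z \<bullet> vb z))
    + (LINT x:Omega D (tm D n)|lebesgue. um x \<bullet> trace_above v (tm D n) x))"


section \<open>Discrete problem\<close>

(* um is the incoming velocity u_h^- at the bottom of the slab. *)
definition slab_solution :: "hdg_variant \<Rightarrow> nat \<Rightarrow> ('d::finite) setting \<Rightarrow> real \<Rightarrow> real
    \<Rightarrow> 'd field \<Rightarrow> 'd field \<Rightarrow> nat \<Rightarrow> (real^'d \<Rightarrow> real^'d)
    \<Rightarrow> 'd field \<times> 'd field \<Rightarrow> ('d spacetime \<Rightarrow> real) \<times> ('d spacetime \<Rightarrow> real) \<Rightarrow> bool"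
  where "slab_solution m k D \<nu> \<alpha> f g n um u p \<longleftrightarrow>
    u \<in> X_v m k D n \<and> p \<in> X_q m k D n \<and>
    (\<forall>v\<in>X_v m k D n. t_h D n u u v + a_h D n \<nu> \<alpha> u v + b_h D n p v = L_h D n f g um v) \<and>
    (\<forall>q\<in>X_q m k D n. b_h D n q u = 0)"

(* Exactly divergence-free traces on Omega(0) of functions in the velocity space of the first
   slab, lying moreover in H(div) for HDG and EHDG. *)
definition init_space :: "hdg_variant \<Rightarrow> nat \<Rightarrow> ('d::finite) setting \<Rightarrow> (real^'d \<Rightarrow> real^'d) set"
  where "init_space m k D = {w.
    (\<exists>v\<in>V_h k D 0. \<forall>x\<in>Omega D 0. w x = trace_above v 0 x) \<and>
    (\<forall>S\<in>facets_at D 0 0. \<forall>x\<in>Omega D 0. (0, x) \<in> rel_interior S \<longrightarrow> trace (jacobian w (at x)) = 0) \<and>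
    (m \<noteq> EDG \<longrightarrow> w \<in> Hdiv (Omega D 0))}"

definition init_projection :: "hdg_variant \<Rightarrow> nat \<Rightarrow> ('d::finite) setting
    \<Rightarrow> ((real^'d \<Rightarrow> real^'d) \<Rightarrow> (real^'d \<Rightarrow> real^'d)) \<Rightarrow> bool"
  where "init_projection m k D proj \<longleftrightarrow>
    (\<forall>u0. div_free (Omega D 0) u0 \<longrightarrow> proj u0 \<in> init_space m k D) \<and>
    (\<forall>w\<in>init_space m k D. AE x in lebesgue_on (Omega D 0). proj w x = w x)"

(* U n is the velocity (u_h, ubar_h) computed on slab n. *)
definition u_minus :: "('d::finite) setting \<Rightarrow> (real^'d \<Rightarrow> real^'d) \<Rightarrow> (nat \<Rightarrow> 'd field \<times> 'd field)
    \<Rightarrow> nat \<Rightarrow> real^'d \<Rightarrow> real^'d"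
  where "u_minus D uinit U n = (if n = 0 then uinit else trace_below (fst (U (n - 1))) (tm D n))"

end

theory Submission
  imports Defs
begin

text \<open>The proof is the classical energy argument: use the solution as its own test function. The pressure
  terms vanish by the second discrete equation, the viscous form is nonnegative if the penalty is large enough, and the
  convective form controls half of the energy at both ends of the slab (\<open>t_h_lower_bound\<close>). By Young's inequality the
  right-hand side is at most half of the incoming energy plus half of the energy of the trace at the bottom, so the latter
  cancels (\<open>slab_energy\<close>).

  For the convective form, the volume terms with \<open>u \<otimes> u : \<nabla>u\<close> cancel by skew-symmetrization, and
  \<open>- u \<bullet> \<partial>\<^sub>t u = - \<partial>\<^sub>t \<bar>u\<bar>\<^sup>2 / 2\<close> is moved to the facets by the divergence theorem in the time direction
  (\<open>time_divergence\<close>). On a lateral facet the result combines with the upwind flux to a nonnegative jump term minus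
  \<open>n\<^sub>t \<bar>b\<bar>\<^sup>2 / 2\<close>, where \<open>b\<close> is the facet velocity. As \<open>b\<close> has one value on each facet and the normals of two adjacent elements
  are opposite, these last terms cancel (\<open>normal_sum_cancels\<close>) except on the boundary of the space-time domain, where \<open>b\<close>
  vanishes on the Dirichlet part and the boundary terms of the form make up for them on the Neumann part.

  For the viscous form, the consistency terms are absorbed by the penalty and the volume term, by Young's inequality and a
  discrete trace inequality (\<open>gradient_inverse_estimate\<close>). The latter holds with some constant on each
  element because the gradients of polynomial fields of bounded degree form a finite-dimensional space; the mesh is finite, so
  one penalty threshold serves all elements.

  The geometry rests on two facts about a facet with space-time normal \<open>(n\<^sub>t, n)\<close>: its projection to space has \<open>\<bar>n\<^sub>t\<bar>\<close> times
  its area (\<open>projection\<close>), and the domain at either end of a slab is covered, up to a null set, by projections of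
  horizontal facets at that time (\<open>end_trace_L2\<close>).\<close>

section \<open>Facets of solid polytopes\<close>

text \<open>An element of the mesh, seen as a polytope with interior points. Working at this generality keeps
  the geometry free of vertices and barycentric coordinates.\<close>

locale solid_polytope =
  fixes K :: "('d::finite) spacetime set"
  assumes polytope: "polytope K" and solid: "interior K \<noteq> {}"
begin

lemma compact: "compact K" and convex: "convex K" and closed: "closed K"
  using polytope polytope_imp_compact polytope_imp_convex compact_imp_closed by blast+

lemma closure_interior: "closure (interior K) = K"
  using convex_closure_interior[OF convex solid] closed by simp

lemma aff_dim_full: "aff_dim K = DIM('d spacetime)"
  using solid aff_dim_nonempty_interior by blast

end

locale polytope_facet = solid_polytope K for K :: "('d::finite) spacetime set" +
  fixes S :: "'d spacetime set"
  assumes facet: "S facet_of K"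
begin

abbreviation nu where "nu \<equiv> outward_normal K S"

text \<open>The hyperplane of the facet is \<open>{x. nu \<bullet> x = offset}\<close>.\<close>

definition offset :: real where "offset = nu \<bullet> (SOME x. x \<in> S)"

lemma S_face: "S face_of K" and S_ne: "S \<noteq> {}" and S_sub: "S \<subseteq> K"
  and S_aff_dim: "aff_dim S = DIM('d spacetime) - 1"
  using facet aff_dim_full unfolding facet_of_def by (auto dest: face_of_imp_subset)

lemma S_compact: "compact S" and S_convex: "convex S" and S_closed: "closed S"
  using S_face compact convex face_of_imp_compact face_of_imp_convex compact_imp_closed by blast+

text \<open>Some supporting hyperplane cuts out the facet. Since the facet has codimension one, that
  hyperplane is its affine hull, so a competing normal is orthogonal to the same directions and can differ only in sign;
  the sign is fixed because the polytope has points off the hyperplane.\<close>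

lemma normal_exists:
  "\<exists>b. norm nu = 1 \<and> affine hull S = {x. nu \<bullet> x = b} \<and> K \<subseteq> {x. nu \<bullet> x \<le> b} \<and> S = K \<inter> {x. nu \<bullet> x = b}"
proof -
  have poly: "polyhedron K" using polytope by (rule polytope_imp_polyhedron)
  obtain a b where a: "a \<noteq> 0" and K: "K \<subseteq> {x. a \<bullet> x \<le> b}" and S: "S = K \<inter> {x. a \<bullet> x = b}"
    using facet_of_polyhedron[OF poly facet] .
  define e where "e = a /\<^sub>R norm a"
  define c where "c = b / norm a"
  have e1: "norm e = 1" using a by (simp add: e_def)
  have e0: "e \<noteq> 0" using e1 by auto
  have ax: "a \<bullet> x = norm a * (e \<bullet> x)" for x using a by (simp add: e_def)
  have eK: "K \<subseteq> {x. e \<bullet> x \<le> c}" using K a by (auto simp: ax c_def field_simps)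
  have eS: "S = K \<inter> {x. e \<bullet> x = c}" using S a by (auto simp: ax c_def field_simps)
  have aff: "affine hull S = {x. e \<bullet> x = c}"
  proof (rule affine_dim_equal)
    show "affine hull S \<subseteq> {x. e \<bullet> x = c}"
      by (rule hull_minimal) (use eS affine_hyperplane in auto)
    show "aff_dim (affine hull S) = aff_dim {x. e \<bullet> x = c}"
      using S_aff_dim aff_dim_hyperplane[OF e0, of c] by (simp only: aff_dim_affine_hull)
  qed (use S_ne affine_hyperplane in auto)
  have "nu = e"
    unfolding outward_normal_def
  proof (rule the_equality)
    show "norm e = 1 \<and> (\<forall>x\<in>S. \<forall>y\<in>K. e \<bullet> y \<le> e \<bullet> x)"
      using e1 eK eS by auto
  next
    fix h assume h: "norm h = 1 \<and> (\<forall>x\<in>S. \<forall>y\<in>K. h \<bullet> y \<le> h \<bullet> x)"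
    obtain z where z: "z \<in> S" using S_ne by blast
    have "S \<subseteq> {x. h \<bullet> x = h \<bullet> z}"
      using h z S_sub by (auto intro!: antisym)
    then have hull: "affine hull S \<subseteq> {x. h \<bullet> x = h \<bullet> z}"
      by (rule hull_minimal) (rule affine_hyperplane)
    \<comment> \<open>the component of the competing normal along the facet\<close>
    define w where "w = h - (h \<bullet> e) *\<^sub>R e"
    have ee: "e \<bullet> e = 1" using e1 by (simp add: norm_eq_1)
    have ew: "e \<bullet> w = 0" by (simp add: w_def inner_diff_right ee inner_commute)
    have "e \<bullet> z = c" using z eS by blast
    then have "z + w \<in> affine hull S"
      by (simp add: aff inner_add_right ew)
    then have hw: "h \<bullet> w = 0" using hull by (auto simp: inner_add_right)
    have "w \<bullet> w = h \<bullet> w - (h \<bullet> e) * (e \<bullet> w)" by (simp add: w_def inner_diff_left)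
    then have "w = 0" using hw ew by simp
    then have he: "h = (h \<bullet> e) *\<^sub>R e" by (simp add: w_def)
    then have "\<bar>h \<bullet> e\<bar> = 1" using h e1 by (metis mult.right_neutral norm_scaleR)
    moreover have "h \<bullet> e \<noteq> - 1"
    proof
      assume "h \<bullet> e = - 1"
      then have hm: "h = - e" using he by simp
      have "K \<subseteq> {x. e \<bullet> x = c}"
      proof
        fix y assume y: "y \<in> K"
        then have "- (e \<bullet> y) \<le> - c" using h z hm \<open>e \<bullet> z = c\<close> by auto
        then show "y \<in> {x. e \<bullet> x = c}" using eK y by auto
      qed
      then have "aff_dim K \<le> aff_dim {x. e \<bullet> x = c}" by (rule aff_dim_subset)
      also have "\<dots> = DIM('d spacetime) - 1" using aff_dim_hyperplane[OF e0, of c] by blast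
      finally show False using aff_dim_full by simp
    qed
    ultimately have "h \<bullet> e = 1" by linarith
    then show "h = e" using he by simp
  qed
  then show ?thesis using e1 aff eK eS by blast
qed

lemma norm_nu: "norm nu = 1"
  and affine_hull_S: "affine hull S = {x. nu \<bullet> x = offset}"
  and K_le: "x \<in> K \<Longrightarrow> nu \<bullet> x \<le> offset"
  and S_eq: "S = K \<inter> {x. nu \<bullet> x = offset}"
proof -
  obtain b where b: "norm nu = 1" "affine hull S = {x. nu \<bullet> x = b}" "K \<subseteq> {x. nu \<bullet> x \<le> b}"
      "S = K \<inter> {x. nu \<bullet> x = b}"
    using normal_exists by blast
  have "(SOME x. x \<in> S) \<in> S" using S_ne by (simp add: some_in_eq)
  then have "offset = b" using b(4) by (auto simp: offset_def)
  then show "norm nu = 1" "affine hull S = {x. nu \<bullet> x = offset}"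
    "x \<in> K \<Longrightarrow> nu \<bullet> x \<le> offset" "S = K \<inter> {x. nu \<bullet> x = offset}"
    using b by auto
qed

lemma nu_nu: "nu \<bullet> nu = 1"
  using norm_nu by (simp add: norm_eq_1)

lemma S_offset: "x \<in> S \<Longrightarrow> nu \<bullet> x = offset"
  using S_eq by blast

lemma interior_lt:
  assumes "x \<in> interior K" shows "nu \<bullet> x < offset"
proof -
  obtain e where e: "e > 0" "cball x e \<subseteq> K"
    using assms mem_interior_cball by blast
  then have "x + e *\<^sub>R nu \<in> K" using norm_nu by (auto simp: dist_norm)
  then have "nu \<bullet> (x + e *\<^sub>R nu) \<le> offset" by (rule K_le)
  then show ?thesis using e by (simp add: inner_add_right nu_nu)
qed

lemma outside_element:
  assumes "z \<in> S" "s > 0" shows "z + s *\<^sub>R nu \<notin> K"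
  using K_le[of "z + s *\<^sub>R nu"] S_offset[OF assms(1)] assms(2)
  by (auto simp: inner_add_right nu_nu)

lemma tangent:
  assumes z: "z \<in> rel_interior S" and w: "nu \<bullet> w = 0"
  shows "\<exists>e>0. \<forall>s. \<bar>s\<bar> \<le> e \<longrightarrow> z + s *\<^sub>R w \<in> S"
proof -
  obtain r where r: "r > 0" "ball z r \<inter> affine hull S \<subseteq> S" and zS: "z \<in> S"
    using z by (auto simp: mem_rel_interior_ball)
  define e where "e = r / (norm w + 1) / 2"
  have nw: "norm w + 1 > 0" using norm_ge_zero[of w] by linarith
  have e0: "e > 0" using r nw by (simp add: e_def)
  have "z + s *\<^sub>R w \<in> S" if s: "\<bar>s\<bar> \<le> e" for s
  proof -
    have "norm (s *\<^sub>R w) \<le> e * norm w" using s by (simp add: mult_right_mono)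
    also have "\<dots> \<le> e * (norm w + 1)" using e0 by simp
    also have "\<dots> = r / 2" using nw unfolding e_def by (simp del: divide_divide_eq_left add: field_simps)
    also have "\<dots> < r" using r by simp
    finally have "z + s *\<^sub>R w \<in> ball z r" by (simp add: dist_norm)
    moreover have "z + s *\<^sub>R w \<in> affine hull S"
      using S_offset[OF zS] w by (simp add: affine_hull_S inner_add_right)
    ultimately show ?thesis using r by blast
  qed
  then show ?thesis using e0 by blast
qed

text \<open>Write \<open>c - z\<close>, with \<open>c\<close> an interior point of the polytope, as a tangential vector minus a
  positive multiple of the normal. A small step against the normal is then a convex combination of \<open>c\<close> and of a
  point of the facet near \<open>z\<close>.\<close>

lemma inward:
  assumes z: "z \<in> rel_interior S"
  shows "\<exists>e>0. \<forall>s. 0 < s \<and> s \<le> e \<longrightarrow> z - s *\<^sub>R nu \<in> interior K"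
proof -
  have zS: "z \<in> S" using z rel_interior_subset by blast
  obtain c where c: "c \<in> interior K" using solid by blast
  define m where "m = - (nu \<bullet> (c - z))"
  define w where "w = (c - z) + m *\<^sub>R nu"
  have m: "m > 0" using interior_lt[OF c] S_offset[OF zS] by (simp add: m_def inner_diff_right)
  have nw: "nu \<bullet> w = 0" by (simp add: w_def m_def inner_add_right inner_diff_right nu_nu)
  obtain e where e: "e > 0" "\<And>s. \<bar>s\<bar> \<le> e \<Longrightarrow> z + s *\<^sub>R w \<in> S"
    using tangent[OF z nw] by blast
  define e' where "e' = min (1/2) (e / 2)"
  have e': "e' > 0" "e' \<le> 1/2" "e' \<le> e/2" using e by (auto simp: e'_def)
  have "z - s *\<^sub>R nu \<in> interior K" if s: "0 < s" "s \<le> m * e'" for s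
  proof -
    define q where "q = s / m"
    have q: "0 < q" "q \<le> e'" using s m by (auto simp: q_def field_simps)
    have q1: "q < 1" "q \<le> 1/2" using q e' by linarith+
    have "\<bar>- (q / (1 - q))\<bar> \<le> e"
    proof -
      have "q / (1 - q) \<le> q / (1/2)" using q q1 by (intro divide_left_mono) auto
      then show ?thesis using q q1 e' by simp
    qed
    then have y: "z + (- (q / (1 - q))) *\<^sub>R w \<in> S" by (rule e)
    then have "z + (- (q / (1 - q))) *\<^sub>R w \<in> K" using S_sub by blast
    then have "(z + (- (q / (1 - q))) *\<^sub>R w) - q *\<^sub>R ((z + (- (q / (1 - q))) *\<^sub>R w) - c) \<in> interior K"
      using mem_interior_convex_shrink[OF convex c] q q1 by auto
    moreover have "(z + (- (q / (1 - q))) *\<^sub>R w) - q *\<^sub>R ((z + (- (q / (1 - q))) *\<^sub>R w) - c)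
        = z - (q * m) *\<^sub>R nu"
    proof -
      define p where "p = q / (1 - q)"
      have p: "p * (1 - q) = q" using q1 by (simp add: p_def)
      have "(z + (- p) *\<^sub>R w) - q *\<^sub>R ((z + (- p) *\<^sub>R w) - c)
          = z + q *\<^sub>R (c - z) - (p * (1 - q)) *\<^sub>R w"
        by (simp add: algebra_simps)
      also have "\<dots> = z - (q * m) *\<^sub>R nu" unfolding p w_def by (simp add: algebra_simps)
      finally show ?thesis unfolding p_def .
    qed
    moreover have "q * m = s" using m by (simp add: q_def)
    ultimately show ?thesis by metis
  qed
  moreover have "m * e' > 0" using m e' by simp
  ultimately show ?thesis by blast
qed

lemma abs_fst_nu_le: "\<bar>fst nu\<bar> \<le> 1" and norm_snd_nu_le: "norm (snd nu) \<le> 1"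
  using norm_nu norm_fst_le[of "fst nu" "snd nu"] norm_snd_le[of "snd nu" "fst nu"] by auto

lemma snd_nu_zero: "\<bar>fst nu\<bar> = 1 \<longleftrightarrow> snd nu = 0"
proof -
  have "(fst nu)\<^sup>2 + (norm (snd nu))\<^sup>2 = 1"
    using nu_nu by (simp add: inner_prod_def power2_eq_square dot_square_norm)
  then have "(fst nu)\<^sup>2 = 1 \<longleftrightarrow> (norm (snd nu))\<^sup>2 = 0" by linarith
  then show ?thesis by (simp add: abs_square_eq_1)
qed

end

section \<open>Lebesgue measure in rotated coordinates\<close>

lemma nn_integral_lborel_shift:
  fixes h :: "'a::euclidean_space \<Rightarrow> ennreal"
  assumes [measurable]: "h \<in> borel_measurable borel"
  shows "(\<integral>\<^sup>+y. h (c + y) \<partial>lborel) = (\<integral>\<^sup>+y. h y \<partial>lborel)"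
proof -
  have "(\<integral>\<^sup>+y. h y \<partial>lborel) = (\<integral>\<^sup>+y. h y \<partial>distr lborel borel ((+) c))"
    by (simp add: lborel_distr_plus)
  also have "\<dots> = (\<integral>\<^sup>+y. h (c + y) \<partial>lborel)"
    by (subst nn_integral_distr) auto
  finally show ?thesis by simp
qed

lemma nn_integral_lborel_reflect:
  fixes h :: "'a::euclidean_space \<Rightarrow> ennreal"
  assumes [measurable]: "h \<in> borel_measurable borel"
  shows "(\<integral>\<^sup>+y. h (c - y) \<partial>lborel) = (\<integral>\<^sup>+y. h y \<partial>lborel)"
proof -
  have "(lborel :: 'a measure) = density (distr lborel borel (\<lambda>x. c + (-1) *\<^sub>R x)) (\<lambda>_. ennreal (\<bar>-1\<bar> ^ DIM('a)))"
    by (rule lborel_affine) simp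
  then have "(lborel :: 'a measure) = density (distr lborel borel (\<lambda>x. c - x)) (\<lambda>_. 1)" by simp
  also have "\<dots> = distr lborel borel (\<lambda>x. c - x)" by (rule density_1)
  finally have eq: "(lborel :: 'a measure) = distr lborel borel (\<lambda>x. c - x)" .
  have "(\<integral>\<^sup>+y. h y \<partial>lborel) = (\<integral>\<^sup>+y. h y \<partial>distr lborel borel (\<lambda>x. c - x))"
    using eq by simp
  also have "\<dots> = (\<integral>\<^sup>+y. h (c - y) \<partial>lborel)"
    by (subst nn_integral_distr) auto
  finally show ?thesis by simp
qed

lemma borel_measurable_linear:
  fixes f :: "'a::euclidean_space \<Rightarrow> 'b::euclidean_space"
  shows "linear f \<Longrightarrow> f \<in> borel_measurable borel"
  by (simp add: borel_measurable_continuous_onI linear_continuous_on linear_conv_bounded_linear)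

text \<open>The classical uniqueness argument for translation-invariant measures: with E and F Borel, the
  integral of \<open>(x, y) \<mapsto> 1\<^bsub>E\<^esub>(f x) 1\<^bsub>F\<^esub>(f x + y)\<close>, computed in both orders, gives
  \<open>|f\<^sup>-\<^sup>1 E| |F| = |E| |f\<^sup>-\<^sup>1 F|\<close>. Taking for F the unit ball, which \<open>f\<close> preserves, proves the claim.\<close>

lemma lborel_distr_isometry:
  fixes f :: "'a::euclidean_space \<Rightarrow> 'a"
  assumes lin: "linear f" and iso: "\<And>x. norm (f x) = norm x"
  shows "distr lborel borel f = lborel"
proof (rule measure_eqI)
  have fm[measurable]: "f \<in> borel_measurable borel" using lin by (rule borel_measurable_linear)
  have "inj f"
    using lin iso by (metis linear_injective_0 norm_eq_zero)
  then obtain g where g: "linear g" "\<And>x. f (g x) = x"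
    using linear_injective_isomorphism[OF lin] by metis
  have main: "emeasure lborel (f -` E) * emeasure lborel F = emeasure lborel (f -` F) * emeasure lborel E"
    if [measurable]: "E \<in> sets borel" "F \<in> sets borel" for E F :: "'a set"
  proof -
    have mE: "f -` E \<in> sets borel" and mF: "f -` F \<in> sets borel"
      using measurable_sets[OF fm, of E] measurable_sets[OF fm, of F] by simp_all
    have "(\<integral>\<^sup>+x. \<integral>\<^sup>+y. indicator E (f x) * indicator F (f x + y) \<partial>lborel \<partial>lborel)
        = (\<integral>\<^sup>+x. indicator (f -` E) x * emeasure lborel F \<partial>lborel)"
    proof (rule nn_integral_cong)
      fix x
      have "(\<integral>\<^sup>+y. indicator E (f x) * indicator F (f x + y) \<partial>lborel)
          = indicator E (f x) * (\<integral>\<^sup>+y. indicator F (f x + y) \<partial>lborel)"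
        by (rule nn_integral_cmult) measurable
      also have "(\<integral>\<^sup>+y. indicator F (f x + y) \<partial>lborel) = emeasure lborel F"
        using nn_integral_lborel_shift[of "indicator F" "f x"] by simp
      finally show "(\<integral>\<^sup>+y. indicator E (f x) * indicator F (f x + y) \<partial>lborel)
          = indicator (f -` E) x * emeasure lborel F" by (simp add: indicator_def)
    qed
    also have "\<dots> = emeasure lborel (f -` E) * emeasure lborel F"
      using mE by (subst nn_integral_multc) auto
    finally have 1: "(\<integral>\<^sup>+x. \<integral>\<^sup>+y. indicator E (f x) * indicator F (f x + y) \<partial>lborel \<partial>lborel)
        = emeasure lborel (f -` E) * emeasure lborel F" .
    have "(\<integral>\<^sup>+x. \<integral>\<^sup>+y. indicator E (f x) * indicator F (f x + y) \<partial>lborel \<partial>lborel)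
        = (\<integral>\<^sup>+y. \<integral>\<^sup>+x. indicator E (f x) * indicator F (f x + y) \<partial>lborel \<partial>lborel)"
      by (rule lborel_pair.Fubini') (simp add: split_def)
    also have "\<dots> = (\<integral>\<^sup>+y. \<integral>\<^sup>+x. indicator E (f x - y) * indicator F (f x) \<partial>lborel \<partial>lborel)"
    proof (rule nn_integral_cong)
      fix y
      have "(\<integral>\<^sup>+x. indicator E (f x) * indicator F (f x + y) \<partial>lborel)
        = (\<integral>\<^sup>+x. indicator E (f (- g y + x)) * indicator F (f (- g y + x) + y) \<partial>lborel)"
        by (rule nn_integral_lborel_shift[symmetric]) simp
      also have "\<dots> = (\<integral>\<^sup>+x. indicator E (f x - y) * indicator F (f x) \<partial>lborel)"
        by (simp add: linear_diff[OF lin] g)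
      finally show "(\<integral>\<^sup>+x. indicator E (f x) * indicator F (f x + y) \<partial>lborel)
        = (\<integral>\<^sup>+x. indicator E (f x - y) * indicator F (f x) \<partial>lborel)" .
    qed
    also have "\<dots> = (\<integral>\<^sup>+x. \<integral>\<^sup>+y. indicator E (f x - y) * indicator F (f x) \<partial>lborel \<partial>lborel)"
      by (rule lborel_pair.Fubini') (simp add: split_def)
    also have "\<dots> = (\<integral>\<^sup>+x. indicator (f -` F) x * emeasure lborel E \<partial>lborel)"
    proof (rule nn_integral_cong)
      fix x
      have "(\<integral>\<^sup>+y. indicator E (f x - y) * indicator F (f x) \<partial>lborel)
          = (\<integral>\<^sup>+y. indicator E (f x - y) \<partial>lborel) * indicator F (f x)"
        by (rule nn_integral_multc) measurable
      also have "(\<integral>\<^sup>+y. indicator E (f x - y) \<partial>lborel) = emeasure lborel E"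
        using nn_integral_lborel_reflect[of "indicator E" "f x"] by simp
      finally show "(\<integral>\<^sup>+y. indicator E (f x - y) * indicator F (f x) \<partial>lborel)
          = indicator (f -` F) x * emeasure lborel E" by (simp add: indicator_def)
    qed
    also have "\<dots> = emeasure lborel (f -` F) * emeasure lborel E"
      using mF by (subst nn_integral_multc) auto
    finally show ?thesis using 1 by simp
  qed
  fix E :: "'a set" assume "E \<in> sets (distr lborel borel f)"
  then have E: "E \<in> sets borel" by simp
  have "f -` ball 0 1 = ball 0 1" by (auto simp: iso)
  then have eq: "emeasure lborel (f -` E) * emeasure lborel (ball (0::'a) 1)
      = emeasure lborel (ball (0::'a) 1) * emeasure lborel E"
    using main[OF E, of "ball 0 1"] by simp
  have "emeasure lborel (ball (0::'a) 1) \<noteq> 0" "emeasure lborel (ball (0::'a) 1) \<noteq> top"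
    using open_not_negligible[of "ball (0::'a) 1"] emeasure_lborel_ball_finite[of "0::'a" 1]
    by (auto simp: negligible_iff_emeasure0)
  then have "emeasure lborel (f -` E) = emeasure lborel E"
    using eq by (metis mult.commute ennreal_mult_cancel_left)
  then show "emeasure (distr lborel borel f) E = emeasure lborel E"
    using E by (simp add: emeasure_distr)
qed simp

section \<open>Charts of facets\<close>

context polytope_facet
begin

text \<open>The direction space of the facet has dimension \<open>d\<close>, so it is isometric to \<open>\<real>\<^sup>d\<close>.\<close>

lemma chart_exists:
  "\<exists>a A. linear A \<and> (\<forall>y. norm (A y) = norm y) \<and> chart S = (\<lambda>y. a + A y) \<and> S \<subseteq> range (chart S)"
proof -
  define T where "T = {x. nu \<bullet> x = 0}"
  have T: "subspace T" unfolding T_def by (rule subspace_hyperplane)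
  have "nu \<noteq> 0" using norm_nu by auto
  then have dT: "dim T = DIM(real^'d)"
    unfolding T_def by (simp add: dim_hyperplane)
  obtain f where f: "linear f" "f ` (UNIV :: (real^'d) set) = T" "\<And>x. norm (f x) = norm x"
    by (rule isometries_subspaces[of "UNIV :: (real^'d) set" T]) (use T dT in auto)
  obtain z where z: "z \<in> S" using S_ne by blast
  have "S \<subseteq> range (\<lambda>y. z + f y)"
  proof
    fix x assume x: "x \<in> S"
    have "x - z \<in> T" using S_offset[OF x] S_offset[OF z] by (simp add: T_def inner_diff_right)
    then obtain y where "x - z = f y" using f(2) by blast
    then have "x = z + f y" by (simp add: algebra_simps)
    then show "x \<in> range (\<lambda>y. z + f y)" by blast
  qed
  then have "\<exists>\<phi>. (\<exists>a A. linear A \<and> (\<forall>y::real^'d. norm (A y) = norm y) \<and> \<phi> = (\<lambda>y. a + A y)) \<and> S \<subseteq> range \<phi>"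
    using f by (intro exI[of _ "\<lambda>y. z + f y"]) blast
  then have "(\<exists>a A. linear A \<and> (\<forall>y. norm (A y) = norm y) \<and> chart S = (\<lambda>y. a + A y)) \<and> S \<subseteq> range (chart S)"
    unfolding chart_def by (rule someI_ex)
  then show ?thesis by blast
qed

definition base where "base = chart S 0"
definition frame where "frame y = chart S y - base"

lemma chart_eq: "chart S y = base + frame y"
  by (simp add: frame_def)

lemma linear_frame: "linear frame" and norm_frame: "norm (frame y) = norm y"
  and S_range: "S \<subseteq> range (chart S)"
proof -
  obtain a A where A: "linear A" "\<forall>y. norm (A y) = norm y" "chart S = (\<lambda>y. a + A y)" "S \<subseteq> range (chart S)"
    using chart_exists by blast
  have "frame = A" using A(3) linear_0[OF A(1)] by (auto simp: frame_def base_def)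
  then show "linear frame" "norm (frame y) = norm y" "S \<subseteq> range (chart S)" using A by auto
qed

lemma inj_frame: "inj frame"
  using linear_frame norm_frame by (metis linear_injective_0 norm_eq_zero)

text \<open>The range is an affine set containing the facet, of the same dimension as the affine hull of the facet.\<close>

lemma range_chart: "range (chart S) = {x. nu \<bullet> x = offset}"
proof -
  have r: "range (chart S) = (+) base ` range frame" by (auto simp: chart_eq)
  have aff: "affine (range (chart S))"
    unfolding r by (subst affine_translation[symmetric])
      (simp add: linear_frame linear_subspace_image subspace_imp_affine)
  have "aff_dim (range (chart S)) = aff_dim (range frame)" unfolding r by (rule aff_dim_translation_eq)
  also have "\<dots> = DIM(real^'d)"
    using aff_dim_injective_linear_image[OF linear_frame inj_frame, of UNIV] by simp
  finally have d: "aff_dim (range (chart S)) = DIM(real^'d)" .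
  have "affine hull S = range (chart S)"
  proof (rule affine_dim_equal)
    show "affine hull S \<subseteq> range (chart S)" using S_range aff by (rule hull_minimal)
    show "aff_dim (affine hull S) = aff_dim (range (chart S))" using S_aff_dim d by simp
  qed (use aff S_ne in auto)
  then show ?thesis using affine_hull_S by simp
qed

lemma nu_chart: "nu \<bullet> chart S y = offset"
  using range_chart by auto

lemma nu_base: "nu \<bullet> base = offset"
  using nu_chart by (simp add: base_def)

lemma nu_frame: "nu \<bullet> frame y = 0"
  using nu_chart[of y] nu_base by (simp add: chart_eq inner_add_right)

lemma frame_surj: "nu \<bullet> w = 0 \<Longrightarrow> \<exists>y. frame y = w"
proof -
  assume "nu \<bullet> w = 0"
  then have "base + w \<in> range (chart S)" using nu_base by (simp add: range_chart inner_add_right)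
  then show ?thesis by (auto simp: chart_eq)
qed

lemma continuous_chart: "continuous_on X (chart S)"
  using linear_continuous_on[of frame] linear_frame
  by (auto simp: chart_eq linear_conv_bounded_linear intro!: continuous_intros)

lemma chart_measurable[measurable]: "chart S \<in> borel_measurable borel"
  by (rule borel_measurable_continuous_onI[OF continuous_chart])

lemma snd_chart_measurable[measurable]: "(\<lambda>y. snd (chart S y)) \<in> borel_measurable borel"
  by (intro borel_measurable_continuous_onI continuous_intros continuous_chart)

lemma dist_chart: "dist (chart S x) (chart S y) = dist x y"
  using norm_frame[of "x - y"] by (simp add: chart_eq dist_norm linear_diff[OF linear_frame])

definition chart_dom where "chart_dom = chart S -` S"

lemma compact_chart_dom: "compact chart_dom"
proof -
  have "bounded chart_dom"
  proof -
    obtain B where B: "\<And>x. x \<in> S \<Longrightarrow> norm x \<le> B"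
      using compact_imp_bounded[OF S_compact] unfolding bounded_iff by blast
    have "norm y \<le> B + norm base" if "y \<in> chart_dom" for y
    proof -
      have "norm y = norm (chart S y - base)" by (simp add: frame_def[symmetric] norm_frame)
      also have "\<dots> \<le> norm (chart S y) + norm base" by (rule norm_triangle_ineq4)
      finally show ?thesis using B[of "chart S y"] that by (simp add: chart_dom_def)
    qed
    then show ?thesis by (auto simp: bounded_iff)
  qed
  moreover have "closed chart_dom"
    unfolding chart_dom_def by (rule closed_vimage[OF S_closed continuous_chart])
  ultimately show ?thesis by (simp add: compact_eq_bounded_closed)
qed

lemma convex_chart_dom: "convex chart_dom"
proof -
  have "chart_dom = frame -` ((+) (- base) ` S)"
    by (force simp: chart_dom_def chart_eq image_iff algebra_simps intro: bexI)
  then show ?thesis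
    using convex_linear_vimage[OF linear_frame] S_convex by simp
qed

lemma interior_chart_dom: "y \<in> interior chart_dom \<Longrightarrow> chart S y \<in> rel_interior S"
proof -
  assume "y \<in> interior chart_dom"
  then obtain e where e: "e > 0" "ball y e \<subseteq> chart_dom" by (auto simp: mem_interior)
  have yd: "chart S y \<in> S" using e centre_in_ball[of y e] chart_dom_def by blast
  have "ball (chart S y) e \<inter> affine hull S \<subseteq> S"
  proof
    fix x assume x: "x \<in> ball (chart S y) e \<inter> affine hull S"
    then obtain y' where "x = chart S y'" using affine_hull_S range_chart by blast
    then show "x \<in> S" using x e by (auto simp: dist_chart chart_dom_def)
  qed
  then show ?thesis
    using e(1) by (auto simp: mem_rel_interior_ball chart_dom_def[symmetric] yd)
qed

text \<open>The parameter domain is convex, so its boundary is a null set. Values of discrete functions on the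
  edges of a facet therefore never matter in surface integrals.\<close>

lemma AE_rel_interior: "AE y in lebesgue. y \<in> chart_dom \<longrightarrow> chart S y \<in> rel_interior S"
proof (rule AE_I')
  show "frontier chart_dom \<in> null_sets lebesgue"
    using negligible_convex_frontier[OF convex_chart_dom] negligible_iff_null_sets by blast
  show "{y \<in> space lebesgue. \<not> (y \<in> chart_dom \<longrightarrow> chart S y \<in> rel_interior S)} \<subseteq> frontier chart_dom"
    using interior_chart_dom compact_chart_dom by (auto simp: frontier_def closure_closed compact_imp_closed)
qed

text \<open>The hyperplane of a facet with \<open>n\<^sub>t \<noteq> 0\<close> is the graph of a function on space.\<close>

definition height :: "real^'d \<Rightarrow> real"
  where "height x = (offset - snd nu \<bullet> x) / fst nu"

lemma height_chart: "fst nu \<noteq> 0 \<Longrightarrow> height (snd (chart S y)) = fst (chart S y)"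
  using nu_chart[of y] by (simp add: height_def inner_prod_def field_simps)

text \<open>The projection of the facet to space scales areas by the factor \<open>\<bar>n\<^sub>t\<bar>\<close>. To see this without
  determinants, integrate \<open>g\<close> over the layer of unit height in time above the hyperplane, once along
  vertical lines and once in the rotated coordinates \<open>s \<nu> + frame y\<close>, in which the layer has thickness \<open>\<bar>n\<^sub>t\<bar>\<close>.\<close>

lemma nn_integral_projection:
  fixes g :: "real^'d \<Rightarrow> ennreal"
  assumes nz: "fst nu \<noteq> 0" and [measurable]: "g \<in> borel_measurable borel"
  shows "(\<integral>\<^sup>+x. g x \<partial>lborel) = ennreal \<bar>fst nu\<bar> * (\<integral>\<^sup>+y. g (snd (chart S y)) \<partial>lborel)"
proof -
  define c where "c = fst nu"
  have c: "c \<noteq> 0" using nz by (simp add: c_def)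
  define H where "H = (\<lambda>z. g (snd z) * indicator {0..1} (fst z - height (snd z)))"
  define B where "B = (\<lambda>w. fst w *\<^sub>R nu + frame (snd w))"
  have hm[measurable]: "height \<in> borel_measurable borel"
    unfolding height_def by measurable
  have Hm[measurable]: "H \<in> borel_measurable borel"
    unfolding H_def borel_prod[symmetric] by measurable
  have linB: "linear B"
    unfolding B_def by (auto intro!: linearI simp: linear_add[OF linear_frame] linear_scale[OF linear_frame] algebra_simps)
  have isoB: "norm (B w) = norm w" for w
  proof -
    have "(norm (B w))\<^sup>2 = (fst w)\<^sup>2 + (norm (frame (snd w)))\<^sup>2"
      unfolding B_def power2_norm_eq_inner
      by (simp add: inner_add_left inner_add_right nu_frame inner_commute[of "frame _" nu] nu_nu power2_eq_square)
    also have "\<dots> = (fst w)\<^sup>2 + (norm (snd w))\<^sup>2" by (simp only: norm_frame)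
    also have "\<dots> = (norm w)\<^sup>2" by (simp add: norm_prod_def)
    finally show ?thesis by simp
  qed
  have Bm[measurable]: "B \<in> borel_measurable borel" using linB by (rule borel_measurable_linear)
  \<comment> \<open>integrating along vertical lines\<close>
  have "(\<integral>\<^sup>+z. H z \<partial>lborel) = (\<integral>\<^sup>+x. \<integral>\<^sup>+t. H (t, x) \<partial>lborel \<partial>lborel)"
    unfolding lborel_prod[symmetric] by (rule lborel_pair.nn_integral_snd[symmetric]) (simp add: lborel_prod)
  also have "\<dots> = (\<integral>\<^sup>+x. g x \<partial>lborel)"
  proof (rule nn_integral_cong)
    fix x
    have "(\<integral>\<^sup>+t. H (t, x) \<partial>lborel) = (\<integral>\<^sup>+t. g x * indicator {0..1} (- height x + t) \<partial>lborel)"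
      by (simp add: H_def)
    also have "\<dots> = g x * (\<integral>\<^sup>+t. indicator {0..1} (- height x + t) \<partial>lborel)"
      by (rule nn_integral_cmult) measurable
    also have "(\<integral>\<^sup>+t. indicator {0..1} (- height x + t) \<partial>lborel) = (\<integral>\<^sup>+t. indicator {0..1::real} t \<partial>lborel)"
      by (rule nn_integral_lborel_shift) simp
    finally show "(\<integral>\<^sup>+t. H (t, x) \<partial>lborel) = g x" by simp
  qed
  finally have 1: "(\<integral>\<^sup>+z. H z \<partial>lborel) = (\<integral>\<^sup>+x. g x \<partial>lborel)" .
  \<comment> \<open>integrating in the rotated coordinates\<close>
  \<comment> \<open>the tangential part of the time direction: moving by \<open>s\<close> along the normal and by \<open>(s / c) v\<close> in the chart is a vertical displacement\<close>
  have "c *\<^sub>R nu \<bullet> nu = c" by (simp add: nu_nu)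
  then have "nu \<bullet> ((1, 0) - c *\<^sub>R nu) = 0"
    by (simp add: inner_diff_right inner_prod_def[of _ "(1,0)"] c_def nu_nu)
  then obtain v where v: "frame v = (1, 0) - c *\<^sub>R nu" using frame_surj by blast
  have H: "H (base + B (s, (s / c) *\<^sub>R v + y)) = g (snd (chart S y)) * indicator {0..1} (s / c)" for s y
  proof -
    have "B (s, (s / c) *\<^sub>R v + y) = (s / c) *\<^sub>R (1, 0) + frame y"
      using c by (simp add: B_def linear_add[OF linear_frame] linear_scale[OF linear_frame] v algebra_simps)
    then have "base + B (s, (s / c) *\<^sub>R v + y) = (s / c, 0) + chart S y" by (simp add: chart_eq)
    then show ?thesis using height_chart[OF nz] by (simp add: H_def)
  qed
  have "(\<integral>\<^sup>+z. H z \<partial>lborel) = (\<integral>\<^sup>+z. H (base + z) \<partial>lborel)"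
    by (rule nn_integral_lborel_shift[symmetric]) simp
  also have "\<dots> = (\<integral>\<^sup>+z. H (base + z) \<partial>distr lborel borel B)"
    using lborel_distr_isometry[OF linB isoB] by simp
  also have "\<dots> = (\<integral>\<^sup>+w. H (base + B w) \<partial>lborel)"
    by (subst nn_integral_distr) auto
  also have "\<dots> = (\<integral>\<^sup>+s. \<integral>\<^sup>+y. H (base + B (s, y)) \<partial>lborel \<partial>lborel)"
    unfolding lborel_prod[symmetric]
    by (rule lborel.nn_integral_fst[symmetric]) (simp add: lborel_prod)
  also have "\<dots> = (\<integral>\<^sup>+s. (\<integral>\<^sup>+y. g (snd (chart S y)) \<partial>lborel) * indicator {0..1} (s / c) \<partial>lborel)"
  proof (rule nn_integral_cong)
    fix s :: real
    have "(\<lambda>y :: real^'d. (s, y)) \<in> borel_measurable borel"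
      by (intro borel_measurable_continuous_onI continuous_intros)
    from measurable_compose[OF this Bm]
    have [measurable]: "(\<lambda>y. B (s, y)) \<in> borel_measurable borel" .
    have "(\<integral>\<^sup>+y. H (base + B (s, y)) \<partial>lborel) = (\<integral>\<^sup>+y. H (base + B (s, (s / c) *\<^sub>R v + y)) \<partial>lborel)"
      by (rule nn_integral_lborel_shift[symmetric]) measurable
    also have "\<dots> = (\<integral>\<^sup>+y. g (snd (chart S y)) \<partial>lborel) * indicator {0..1} (s / c)"
      unfolding H by (rule nn_integral_multc) measurable
    finally show "(\<integral>\<^sup>+y. H (base + B (s, y)) \<partial>lborel)
      = (\<integral>\<^sup>+y. g (snd (chart S y)) \<partial>lborel) * indicator {0..1} (s / c)" .
  qed
  also have "\<dots> = (\<integral>\<^sup>+y. g (snd (chart S y)) \<partial>lborel) * (\<integral>\<^sup>+s. indicator {0..1} (s / c) \<partial>lborel)"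
    by (rule nn_integral_cmult) measurable
  also have "(\<integral>\<^sup>+s. indicator {0..1} (s / c) \<partial>lborel) = (\<integral>\<^sup>+s. indicator {min 0 c..max 0 c} s \<partial>lborel)"
  proof (rule nn_integral_cong)
    fix s :: real
    have "0 \<le> s / c \<and> s / c \<le> 1 \<longleftrightarrow> min 0 c \<le> s \<and> s \<le> max 0 c"
    proof (cases "c > 0")
      case True then show ?thesis by (simp add: zero_le_divide_iff pos_divide_le_eq)
    next
      case False
      then have "c < 0" using c by simp
      then show ?thesis by (auto simp: zero_le_divide_iff neg_divide_le_eq)
    qed
    then show "indicator {0..1} (s / c) = (indicator {min 0 c..max 0 c} s :: ennreal)"
      by (simp add: indicator_def)
  qed
  also have "\<dots> = ennreal \<bar>c\<bar>" by (auto simp: min_def max_def)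
  finally show ?thesis using 1 by (simp add: c_def mult.commute)
qed

end

section \<open>Surface integrals\<close>

lemma set_integrable_continuous_compact:
  fixes f :: "'a::euclidean_space \<Rightarrow> 'b::euclidean_space"
  assumes "compact K" "continuous_on K f" "X \<in> sets borel" "X \<subseteq> K"
  shows "set_integrable lebesgue X f"
proof -
  have "set_integrable lborel K f"
    unfolding set_integrable_def by (rule borel_integrable_compact) fact+
  then have "set_integrable lborel X f"
    using set_integrable_subset[of lborel K f X] assms by simp
  then have "integrable lborel (\<lambda>x. indicator X x *\<^sub>R f x)" by (simp add: set_integrable_def)
  then have "integrable (completion lborel) (\<lambda>x. indicator X x *\<^sub>R f x)"
    using integrable_completion borel_measurable_integrable by blast
  then show ?thesis by (simp add: set_integrable_def)
qed

text \<open>Discrete functions on a facet are polynomials on its relative interior only, with arbitrary values on its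
  relative boundary.\<close>

definition facet_continuous :: "'a::euclidean_space set \<Rightarrow> ('a \<Rightarrow> 'b::topological_space) \<Rightarrow> bool"
  where "facet_continuous S F \<longleftrightarrow> (\<exists>G. continuous_on S G \<and> (\<forall>z\<in>rel_interior S. F z = G z))"

lemma facet_continuous_compose:
  assumes "facet_continuous S F" "continuous_on UNIV h"
  shows "facet_continuous S (\<lambda>z. h (F z))"
proof -
  obtain G where G: "continuous_on S G" "\<forall>z\<in>rel_interior S. F z = G z"
    using assms(1) by (auto simp: facet_continuous_def)
  have "continuous_on S (\<lambda>z. h (G z))"
    using G(1) assms(2) by (metis continuous_on_compose2 subset_UNIV)
  then show ?thesis using G(2) unfolding facet_continuous_def by (intro exI[of _ "\<lambda>z. h (G z)"]) simp
qed

lemma facet_continuous_Pair: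
  assumes "facet_continuous S F" "facet_continuous S H"
  shows "facet_continuous S (\<lambda>z. (F z, H z))"
proof -
  obtain G G' where "continuous_on S G" "\<forall>z\<in>rel_interior S. F z = G z"
    "continuous_on S G'" "\<forall>z\<in>rel_interior S. H z = G' z"
    using assms by (auto simp: facet_continuous_def)
  then show ?thesis
    unfolding facet_continuous_def by (intro exI[of _ "\<lambda>z. (G z, G' z)"]) (auto intro: continuous_intros)
qed

lemma facet_continuous_compose2:
  assumes "facet_continuous S F" "facet_continuous S H" "continuous_on UNIV (\<lambda>p. h (fst p) (snd p))"
  shows "facet_continuous S (\<lambda>z. h (F z) (H z))"
  using facet_continuous_compose[OF facet_continuous_Pair[OF assms(1,2)] assms(3)] by simp

lemma facet_continuousI: "continuous_on S F \<Longrightarrow> facet_continuous S F"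
  by (auto simp: facet_continuous_def)

named_theorems facet_cont

lemma facet_continuous_const[facet_cont]: "facet_continuous S (\<lambda>_. c)"
  by (simp add: facet_continuousI)

lemma facet_continuous_add[facet_cont]:
  fixes F H :: "_ \<Rightarrow> _ :: real_normed_vector"
  shows "facet_continuous S F \<Longrightarrow> facet_continuous S H \<Longrightarrow> facet_continuous S (\<lambda>z. F z + H z)"
  by (rule facet_continuous_compose2) (auto intro!: continuous_intros)

lemma facet_continuous_diff[facet_cont]:
  fixes F H :: "_ \<Rightarrow> _ :: real_normed_vector"
  shows "facet_continuous S F \<Longrightarrow> facet_continuous S H \<Longrightarrow> facet_continuous S (\<lambda>z. F z - H z)"
  by (rule facet_continuous_compose2) (auto intro!: continuous_intros)

lemma facet_continuous_mult[facet_cont]: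
  fixes F H :: "_ \<Rightarrow> real"
  shows "facet_continuous S F \<Longrightarrow> facet_continuous S H \<Longrightarrow> facet_continuous S (\<lambda>z. F z * H z)"
  by (rule facet_continuous_compose2) (auto intro!: continuous_intros)

lemma facet_continuous_inner[facet_cont]:
  fixes F H :: "_ \<Rightarrow> _ :: real_inner"
  shows "facet_continuous S F \<Longrightarrow> facet_continuous S H \<Longrightarrow> facet_continuous S (\<lambda>z. F z \<bullet> H z)"
  by (rule facet_continuous_compose2) (auto intro!: continuous_intros)

lemma facet_continuous_min[facet_cont]:
  fixes F H :: "_ \<Rightarrow> real"
  shows "facet_continuous S F \<Longrightarrow> facet_continuous S H \<Longrightarrow> facet_continuous S (\<lambda>z. min (F z) (H z))"
  by (rule facet_continuous_compose2) (auto intro!: continuous_intros)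

lemma facet_continuous_max[facet_cont]:
  fixes F H :: "_ \<Rightarrow> real"
  shows "facet_continuous S F \<Longrightarrow> facet_continuous S H \<Longrightarrow> facet_continuous S (\<lambda>z. max (F z) (H z))"
  by (rule facet_continuous_compose2) (auto intro!: continuous_intros)

context polytope_facet
begin

lemma chart_vimage_borel: "B \<in> sets borel \<Longrightarrow> chart S -` (S \<inter> B) \<in> sets borel"
  using measurable_sets[OF chart_measurable, of "S \<inter> B"] S_closed by simp

text \<open>Only the values in the relative interior of the facet count, and since Lebesgue measure is complete,
  measurability carries over as well.\<close>

lemma surf_int_cong:
  assumes "\<And>z. z \<in> rel_interior S \<Longrightarrow> z \<in> B \<Longrightarrow> F z = G z"
    and B: "B \<in> sets borel"
    and G: "set_integrable lebesgue (chart S -` (S \<inter> B)) (\<lambda>y. G (chart S y))"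
  shows "set_integrable lebesgue (chart S -` (S \<inter> B)) (\<lambda>y. F (chart S y))"
    and "surf_int S B F = surf_int S B G"
proof -
  let ?X = "chart S -` (S \<inter> B)"
  have ae: "AE y in lebesgue. indicator ?X y *\<^sub>R G (chart S y) = indicator ?X y *\<^sub>R F (chart S y)"
    using AE_rel_interior by eventually_elim (auto simp: chart_dom_def indicator_def assms(1))
  have m: "(\<lambda>y. indicator ?X y *\<^sub>R F (chart S y)) \<in> borel_measurable lebesgue"
    using G ae unfolding set_integrable_def by (rule borel_measurable_AE[OF borel_measurable_integrable])
  show "set_integrable lebesgue ?X (\<lambda>y. F (chart S y))"
    using G m ae unfolding set_integrable_def by (rule integrable_cong_AE_imp) 
  show "surf_int S B F = surf_int S B G"
    unfolding surf_int_def set_lebesgue_integral_def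
    using G m ae unfolding set_integrable_def by (intro integral_cong_AE) auto
qed

lemma surf_integrable:
  fixes F :: "'d spacetime \<Rightarrow> real"
  assumes F: "facet_continuous S F" and B: "B \<in> sets borel"
  shows "set_integrable lebesgue (chart S -` (S \<inter> B)) (\<lambda>y. F (chart S y))"
proof -
  obtain G where G: "continuous_on S G" "\<And>z. z \<in> rel_interior S \<Longrightarrow> F z = G z"
    using F by (auto simp: facet_continuous_def)
  have "continuous_on chart_dom (\<lambda>y. G (chart S y))"
    using continuous_on_compose2[OF G(1) continuous_chart, of chart_dom] by (auto simp: chart_dom_def)
  then have "set_integrable lebesgue (chart S -` (S \<inter> B)) (\<lambda>y. G (chart S y))"
    by (rule set_integrable_continuous_compact[OF compact_chart_dom])
      (use chart_vimage_borel[OF B] in \<open>auto simp: chart_dom_def\<close>)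
  then show ?thesis using surf_int_cong(1)[OF _ B] G(2) by blast
qed

lemma surf_int_diff:
  assumes "facet_continuous S F" "facet_continuous S G" "B \<in> sets borel"
  shows "surf_int S B (\<lambda>z. F z - G z) = surf_int S B F - surf_int S B G"
  unfolding surf_int_def using surf_integrable assms by (intro set_integral_diff) auto

lemma surf_int_add:
  assumes "facet_continuous S F" "facet_continuous S G" "B \<in> sets borel"
  shows "surf_int S B (\<lambda>z. F z + G z) = surf_int S B F + surf_int S B G"
  unfolding surf_int_def using surf_integrable assms by (intro set_integral_add) auto

lemma surf_int_cmult: "surf_int S B (\<lambda>z. c * F z) = c * surf_int S B F"
  unfolding surf_int_def by simp

lemma surf_int_mono:
  assumes "facet_continuous S F" "facet_continuous S G" "B \<in> sets borel"
    and "\<And>z. z \<in> rel_interior S \<Longrightarrow> z \<in> B \<Longrightarrow> F z \<le> G z"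
  shows "surf_int S B F \<le> surf_int S B G"
  unfolding surf_int_def
proof (rule set_integral_mono_AE)
  show "AE y\<in>chart S -` (S \<inter> B) in lebesgue. F (chart S y) \<le> G (chart S y)"
    using AE_rel_interior by eventually_elim (auto simp: chart_dom_def assms(4))
qed (use surf_integrable assms in auto)

lemma surf_int_split:
  assumes F: "facet_continuous S F" and B: "B \<in> sets borel"
  shows "surf_int S UNIV F = surf_int S B F + surf_int S (- B) F"
proof -
  have "chart S -` (S \<inter> UNIV) = chart S -` (S \<inter> B) \<union> chart S -` (S \<inter> - B)" by auto
  moreover have "(LINT y:chart S -` (S \<inter> B) \<union> chart S -` (S \<inter> - B)|lebesgue. F (chart S y))
      = (LINT y:chart S -` (S \<inter> B)|lebesgue. F (chart S y))
      + (LINT y:chart S -` (S \<inter> - B)|lebesgue. F (chart S y))"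
    by (rule set_integral_Un) (use B surf_integrable[OF F] in auto)
  ultimately show ?thesis unfolding surf_int_def by metis
qed

lemma surf_int_eq_0:
  assumes "B \<in> sets borel" "\<And>z. z \<in> rel_interior S \<Longrightarrow> z \<in> B \<Longrightarrow> F z = 0"
  shows "surf_int S B F = 0"
  using surf_int_cong(2)[of B F "\<lambda>_. 0"] assms by (simp add: surf_int_def set_integrable_def)

lemma projection_measure:
  assumes "fst nu \<noteq> 0"
  shows "lborel = density (distr lborel borel (\<lambda>y. snd (chart S y))) (\<lambda>_. ennreal \<bar>fst nu\<bar>)"
proof (rule measure_eqI)
  fix X :: "(real^'d) set" assume "X \<in> sets lborel"
  then have X: "X \<in> sets borel" by simp
  have "emeasure lborel X = \<bar>fst nu\<bar> * (\<integral>\<^sup>+y. indicator X (snd (chart S y)) \<partial>lborel)"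
    using nn_integral_projection[OF assms, of "indicator X"] X by simp
  also have "(\<integral>\<^sup>+y. indicator X (snd (chart S y)) \<partial>lborel)
      = (\<integral>\<^sup>+x. indicator X x \<partial>distr lborel borel (\<lambda>y. snd (chart S y)))"
    using X by (subst nn_integral_distr) auto
  also have "\<bar>fst nu\<bar> * \<dots> = emeasure (density (distr lborel borel (\<lambda>y. snd (chart S y))) (\<lambda>_. ennreal \<bar>fst nu\<bar>)) X"
    using X by (subst emeasure_density_const) auto
  finally show "emeasure lborel X
      = emeasure (density (distr lborel borel (\<lambda>y. snd (chart S y))) (\<lambda>_. ennreal \<bar>fst nu\<bar>)) X" .
qed simp

text \<open>A facet that is not vertical projects injectively.\<close>

lemma snd_chart_in: "fst nu \<noteq> 0 \<Longrightarrow> snd (chart S y) \<in> snd ` S \<longleftrightarrow> y \<in> chart_dom"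
proof
  assume nz: "fst nu \<noteq> 0" and "snd (chart S y) \<in> snd ` S"
  then obtain z where z: "z \<in> S" "snd z = snd (chart S y)" by auto
  then obtain y' where y': "z = chart S y'" using S_range by blast
  then have "fst z = fst (chart S y)"
    using height_chart[OF nz, of y] height_chart[OF nz, of y'] z by simp
  then have "z = chart S y" using z(2) by (simp add: prod_eq_iff)
  then show "y \<in> chart_dom" using z(1) by (simp add: chart_dom_def)
qed (auto simp: chart_dom_def)

lemma continuous_height: "continuous_on X height"
  unfolding height_def divide_inverse by (intro continuous_intros)

lemma compact_snd_S: "compact (snd ` S)"
  using S_compact by (intro compact_continuous_image continuous_intros)

lemma height_S: "fst nu \<noteq> 0 \<Longrightarrow> x \<in> snd ` S \<Longrightarrow> (height x, x) \<in> S"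
proof -
  assume nz: "fst nu \<noteq> 0" and "x \<in> snd ` S"
  then obtain z where z: "z \<in> S" "x = snd z" by auto
  then obtain y where "z = chart S y" using S_range by blast
  then have "(height x, x) = z" using height_chart[OF nz, of y] z by (simp add: prod_eq_iff)
  then show ?thesis using z by simp
qed

lemma projection:
  fixes G :: "'d spacetime \<Rightarrow> real"
  assumes nz: "fst nu \<noteq> 0" and G: "continuous_on UNIV G"
  shows "\<bar>fst nu\<bar> * surf_int S UNIV G = (LINT x:snd ` S|lebesgue. G (height x, x))"
proof -
  have Gm[measurable]: "G \<in> borel_measurable borel" using G by (rule borel_measurable_continuous_onI)
  have "continuous_on UNIV (\<lambda>x. G (height x, x))"
    by (rule continuous_on_compose2[OF G]) (auto intro!: continuous_intros continuous_height)
  then have [measurable]: "(\<lambda>x. G (height x, x)) \<in> borel_measurable borel"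
    by (rule borel_measurable_continuous_onI)
  have [measurable]: "snd ` S \<in> sets borel" "chart_dom \<in> sets borel"
    using compact_snd_S compact_chart_dom by (auto intro: borel_compact)
  let ?f = "\<lambda>x. indicator (snd ` S) x * G (height x, x)"
  have "(LINT x:snd ` S|lebesgue. G (height x, x)) = (LINT x|lborel. ?f x)"
    unfolding set_lebesgue_integral_def by (subst integral_completion) auto
  also have "\<dots> = (LINT x|density (distr lborel borel (\<lambda>y. snd (chart S y))) (\<lambda>_. ennreal \<bar>fst nu\<bar>). ?f x)"
    using projection_measure[OF nz] by simp
  also have "\<dots> = (LINT x|distr lborel borel (\<lambda>y. snd (chart S y)). \<bar>fst nu\<bar> * ?f x)"
    by (subst integral_density) auto
  also have "\<dots> = (LINT y|lborel. \<bar>fst nu\<bar> * ?f (snd (chart S y)))"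
    by (subst integral_distr) auto
  also have "\<dots> = \<bar>fst nu\<bar> * (LINT y|lborel. indicator chart_dom y * G (chart S y))"
    using snd_chart_in[OF nz] height_chart[OF nz] by (simp add: indicator_def of_bool_def)
  also have "(LINT y|lborel. indicator chart_dom y * G (chart S y)) = surf_int S UNIV G"
    unfolding surf_int_def set_lebesgue_integral_def chart_dom_def[symmetric] Int_UNIV_right
    by (subst integral_completion) auto
  finally show ?thesis by simp
qed

end

section \<open>The divergence theorem in the time direction\<close>

lemma not_frontier_imp_interior:
  "closed S \<Longrightarrow> x \<in> S \<Longrightarrow> x \<notin> frontier S \<Longrightarrow> x \<in> interior S"
  by (simp add: frontier_def closure_closed)

context polytope_facet
begin

text \<open>For convex sets, projecting commutes with taking relative interiors.\<close>

lemma rel_interior_over_interior: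
  assumes nz: "fst nu \<noteq> 0" and x: "x \<in> interior (snd ` S)"
  shows "(height x, x) \<in> rel_interior S"
proof -
  have "snd ` rel_interior S = rel_interior (snd ` S)"
    by (rule rel_interior_convex_linear_image) (auto simp: linear_snd S_convex)
  then obtain z where z: "z \<in> rel_interior S" "snd z = x"
    using x interior_subset_rel_interior by (metis imageE subsetD)
  then have "z \<in> S" using rel_interior_subset by blast
  then obtain y where "z = chart S y" using S_range by blast
  then have "z = (height x, x)" using z height_chart[OF nz, of y] by (simp add: prod_eq_iff)
  then show ?thesis using z by simp
qed

end

context solid_polytope
begin

lemma facetI: "S facet_of K \<Longrightarrow> polytope_facet K S"
  by unfold_locales

lemma finite_facets: "finite {S. S facet_of K}"
  using polytope by (rule finite_polytope_facets)

abbreviation hgt where "hgt S \<equiv> polytope_facet.height K S"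

lemma interior_fibre:
  assumes "x \<in> interior (snd ` K)"
  shows "\<exists>t. (t, x) \<in> interior K"
proof -
  have "snd ` rel_interior K = rel_interior (snd ` K)"
    by (rule rel_interior_convex_linear_image) (auto simp: linear_snd convex)
  then have "x \<in> snd ` interior K"
    using assms interior_subset_rel_interior interior_rel_interior_gen[of K] solid
    by (metis empty_iff rel_interior_nonempty_interior subsetD)
  then show ?thesis by force
qed

text \<open>Off a null set of \<open>x\<close>, the fibre of \<open>K\<close> over \<open>x\<close> leaves \<open>K\<close> upwards (\<open>\<sigma> = 1\<close>) or downwards
  (\<open>\<sigma> = -1\<close>) through exactly one facet. A facet whose normal points forwards in time (\<open>\<sigma> n\<^sub>t > 0\<close>) can only be met at the
  exit point, and two facets meeting there in their relative interiors coincide.\<close>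

lemma sum_over_exit_facets:
  fixes p :: "'d spacetime \<Rightarrow> real"
  assumes \<sigma>: "\<bar>\<sigma>\<bar> = 1" and e: "(e, x) \<in> K" and max: "\<And>t. (t, x) \<in> K \<Longrightarrow> \<sigma> * t \<le> \<sigma> * e"
    and t0: "(t0, x) \<in> interior K"
    and good: "\<And>S. S facet_of K \<Longrightarrow> fst (outward_normal K S) \<noteq> 0 \<Longrightarrow> x \<notin> frontier (snd ` S)"
  shows "(\<Sum>S | S facet_of K \<and> \<sigma> * fst (outward_normal K S) > 0. indicator (snd ` S) x * p (hgt S x, x)) = p (e, x)"
proof -
  have \<sigma>': "\<sigma> = 1 \<or> \<sigma> = - 1" using \<sigma> by linarith
  have s2: "\<sigma> * \<sigma> = 1" using \<sigma> by (metis abs_mult_self_eq mult_1)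
  have "(e, x) \<notin> interior K"
  proof
    assume "(e, x) \<in> interior K"
    then obtain r where r: "r > 0" "cball (e, x) r \<subseteq> K" using mem_interior_cball by blast
    have "(e + \<sigma> * r, x) \<in> cball (e, x) r"
      using r \<sigma> by (simp add: dist_norm norm_Pair abs_mult)
    then have "\<sigma> * (e + \<sigma> * r) \<le> \<sigma> * e" using r max by blast
    then have "(\<sigma> * \<sigma>) * r \<le> 0" by (simp add: algebra_simps)
    then show False using r s2 by simp
  qed
  then have "(e, x) \<in> K - rel_interior K"
    using e interior_rel_interior_gen[of K] solid rel_interior_nonempty_interior by blast
  then obtain S where S: "S facet_of K" "(e, x) \<in> S"
    using rel_boundary_of_polyhedron[OF polytope_imp_polyhedron[OF polytope]] by blast
  interpret S: polytope_facet K S by (rule facetI[OF S(1)])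
  have "(t0, x) \<in> K" using t0 interior_subset by blast
  then have le: "\<sigma> * t0 \<le> \<sigma> * e" by (rule max)
  have "S.nu \<bullet> (t0, x) < S.nu \<bullet> (e, x)" using S.interior_lt[OF t0] S.S_offset[OF S(2)] by simp
  then have "0 < fst S.nu * (e - t0)" by (simp add: inner_prod_def algebra_simps)
  then have Spos: "\<sigma> * fst S.nu > 0"
    using le \<sigma>' by (auto simp: zero_less_mult_iff)
  have eq: "S' = S \<and> hgt S' x = e" if S': "S' facet_of K" "\<sigma> * fst (outward_normal K S') > 0" "x \<in> snd ` S'" for S'
  proof -
    interpret S': polytope_facet K S' by (rule facetI[OF S'(1)])
    have nz: "fst S'.nu \<noteq> 0" using S'(2) by auto
    have h: "(hgt S' x, x) \<in> S'" using S'.height_S[OF nz S'(3)] .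
    have "\<sigma> * hgt S' x \<le> \<sigma> * e" using h S'.S_sub max by blast
    moreover have "S'.nu \<bullet> (e, x) \<le> S'.nu \<bullet> (hgt S' x, x)"
      using S'.K_le[OF e] S'.S_offset[OF h] by simp
    then have "0 \<le> fst S'.nu * (hgt S' x - e)" by (simp add: inner_prod_def algebra_simps)
    ultimately have he: "hgt S' x = e"
      using \<sigma>' S'(2) by (auto simp: zero_le_mult_iff)
    have xi: "x \<in> interior (snd ` S')"
      using not_frontier_imp_interior S'.compact_snd_S compact_imp_closed S'(3) good[OF S'(1) nz] by blast
    have "(e, x) \<in> rel_interior S'" using S'.rel_interior_over_interior[OF nz xi] he by simp
    moreover have "S' \<subseteq> S"
      using subset_of_face_of[OF S.S_face S'.S_sub] calculation S(2) by blast
    then have "S' face_of S" using S'.S_face S.S_sub face_of_subset by blast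
    then have "S' = S"
      using face_of_aff_dim_lt[OF S.S_convex] S.S_aff_dim S'.S_aff_dim by fastforce
    ultimately show ?thesis using he by simp
  qed
  have xS: "x \<in> snd ` S" using S(2) by force
  have hS: "hgt S x = e" using eq[OF S(1) Spos xS] by simp
  have fin: "finite {S. S facet_of K \<and> \<sigma> * fst (outward_normal K S) > 0}"
    using finite_facets by simp
  have "(\<Sum>S | S facet_of K \<and> \<sigma> * fst (outward_normal K S) > 0. indicator (snd ` S) x * p (hgt S x, x))
      = (\<Sum>S' | S' facet_of K \<and> \<sigma> * fst (outward_normal K S') > 0. if S' = S then p (e, x) else 0)"
  proof (rule sum.cong[OF refl])
    fix S' assume S': "S' \<in> {S. S facet_of K \<and> \<sigma> * fst (outward_normal K S) > 0}"
    show "indicator (snd ` S') x * p (hgt S' x, x) = (if S' = S then p (e, x) else 0)"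
    proof (cases "x \<in> snd ` S'")
      case True
      then have "S' = S" using eq S' by blast
      then show ?thesis using True hS by simp
    next
      case False
      then have "S' \<noteq> S" using xS by blast
      then show ?thesis using False by simp
    qed
  qed
  also have "\<dots> = p (e, x)"
    using fin S(1) Spos by (simp add: sum.delta)
  finally show ?thesis .
qed

lemma fibre_interval:
  assumes t0: "(t0, x) \<in> interior K"
  obtains l r where "l \<le> r" "\<And>t. (t, x) \<in> K \<longleftrightarrow> t \<in> {l..r}"
proof -
  define I where "I = (\<lambda>t. (t, x)) -` K"
  have "closed I"
    unfolding I_def by (rule closed_vimage[OF closed]) (auto intro!: continuous_intros)
  moreover have "bounded I"
  proof -
    have "I \<subseteq> fst ` K" by (force simp: I_def)
    moreover have "bounded (fst ` K)"
      using compact by (intro compact_imp_bounded compact_continuous_image continuous_intros)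
    ultimately show ?thesis using bounded_subset by blast
  qed
  ultimately have cI: "compact I" by (simp add: compact_eq_bounded_closed)
  have "convex I"
  proof (rule convexI)
    fix s t u v :: real
    assume st: "s \<in> I" "t \<in> I" and uv: "0 \<le> u" "0 \<le> v" "u + v = 1"
    have "u *\<^sub>R (s, x) + v *\<^sub>R (t, x) \<in> K"
      using convexD[OF convex] st uv by (auto simp: I_def)
    moreover have "u *\<^sub>R (s, x) + v *\<^sub>R (t, x) = (u *\<^sub>R s + v *\<^sub>R t, x)"
      using uv by (simp add: scaleR_add_left[symmetric])
    ultimately show "u *\<^sub>R s + v *\<^sub>R t \<in> I" by (simp add: I_def)
  qed
  then have "connected I" by (rule convex_connected)
  then obtain l r where lr: "I = {l..r}"
    using connected_compact_interval_1[of I] cI by auto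
  have "t0 \<in> I" using t0 interior_subset by (auto simp: I_def)
  then have "l \<le> r" using lr by simp
  moreover have "(t, x) \<in> K \<longleftrightarrow> t \<in> {l..r}" for t using lr by (auto simp: I_def)
  ultimately show ?thesis using that by blast
qed

text \<open>The sum of the values of \<open>p\<close> at the points where the fibre over \<open>x\<close> leaves the polytope, upwards or
  downwards; by the previous lemma it has one term for almost every \<open>x\<close> in the projection.\<close>

definition exits :: "('d spacetime \<Rightarrow> real) \<Rightarrow> real \<Rightarrow> real^'d \<Rightarrow> real"
  where "exits p \<sigma> x = (\<Sum>S | S facet_of K \<and> \<sigma> * fst (outward_normal K S) > 0.
    indicator (snd ` S) x * p (hgt S x, x))"

text \<open>The fundamental theorem of calculus on the fibre over \<open>x\<close>.\<close>

lemma fibre_integral: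
  fixes p q :: "'d spacetime \<Rightarrow> real"
  assumes deriv: "\<And>t x. ((\<lambda>s. p (s, x)) has_real_derivative q (t, x)) (at t)"
    and q: "continuous_on UNIV q"
    and front: "x \<notin> frontier (snd ` K)"
    and good: "\<And>S. S facet_of K \<Longrightarrow> fst (outward_normal K S) \<noteq> 0 \<Longrightarrow> x \<notin> frontier (snd ` S)"
  shows "(LINT t|lborel. indicator K (t, x) * q (t, x)) = exits p 1 x - exits p (- 1) x"
proof (cases "x \<in> snd ` K")
  case False
  have "indicator K (t, x) = (0::real)" for t using False by (force simp: indicator_def)
  moreover have "exits p \<sigma> x = 0" for \<sigma>
  proof -
    have "x \<notin> snd ` S" if "S facet_of K" for S
      using False facet_of_imp_subset[OF that] by blast
    then show ?thesis by (auto simp: exits_def intro!: sum.neutral)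
  qed
  ultimately show ?thesis by simp
next
  case True
  have "closed (snd ` K)"
    using compact by (intro compact_imp_closed compact_continuous_image continuous_intros)
  then have "x \<in> interior (snd ` K)" using True front not_frontier_imp_interior by blast
  then obtain t0 where t0: "(t0, x) \<in> interior K" using interior_fibre by blast
  obtain l r where lr: "l \<le> r" "\<And>t. (t, x) \<in> K \<longleftrightarrow> t \<in> {l..r}"
    using fibre_interval[OF t0] by blast
  have "exits p 1 x = p (r, x)"
    unfolding exits_def by (rule sum_over_exit_facets[OF _ _ _ t0 good]) (use lr in auto)
  moreover have "exits p (- 1) x = p (l, x)"
    unfolding exits_def by (rule sum_over_exit_facets[OF _ _ _ t0 good]) (use lr in auto)
  moreover have "(LINT t|lborel. indicator K (t, x) * q (t, x)) = (LINT t|lborel. indicator {l..r} t *\<^sub>R q (t, x))"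
    using lr by (simp add: indicator_def)
  moreover have "\<dots> = p (r, x) - p (l, x)"
  proof (rule integral_FTC_atLeastAtMost[OF lr(1)])
    show "((\<lambda>s. p (s, x)) has_vector_derivative q (t, x)) (at t within {l..r})" for t
      using deriv has_field_derivative_at_within has_real_derivative_iff_has_vector_derivative by blast
    show "continuous_on {l..r} (\<lambda>t. q (t, x))"
      by (rule continuous_on_compose2[OF q]) (auto intro!: continuous_intros)
  qed
  ultimately show ?thesis by simp
qed

lemma AE_off_projected_frontiers:
  "AE x in lborel. x \<notin> frontier (snd ` K) \<and>
    (\<forall>S. S facet_of K \<longrightarrow> fst (outward_normal K S) \<noteq> 0 \<longrightarrow> x \<notin> frontier (snd ` S))"
proof -
  have null: "AE x in lborel. x \<notin> frontier C" if "convex C" for C :: "(real^'d) set"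
  proof -
    have "frontier C \<in> null_sets lebesgue"
      using negligible_convex_frontier[OF that] negligible_iff_null_sets by blast
    then have "AE x in lebesgue. x \<notin> frontier C" by (rule AE_not_in)
    then show ?thesis by (simp add: AE_completion_iff)
  qed
  have "convex (snd ` S)" if "S facet_of K" for S
    using polytope_facet.S_convex[OF facetI[OF that]] by (rule convex_linear_image[OF linear_snd])
  then have "\<forall>S\<in>{S. S facet_of K}. AE x in lborel. x \<notin> frontier (snd ` S)"
    using null by blast
  then have "AE x in lborel. \<forall>S\<in>{S. S facet_of K}. x \<notin> frontier (snd ` S)"
    by (subst AE_finite_all[OF finite_facets])
  moreover have "AE x in lborel. x \<notin> frontier (snd ` K)"
    by (intro null convex_linear_image linear_snd convex)
  ultimately show ?thesis by eventually_elim auto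
qed

lemma exits_integral:
  fixes p :: "'d spacetime \<Rightarrow> real"
  assumes \<sigma>: "\<bar>\<sigma>\<bar> = 1" and p: "continuous_on UNIV p"
  shows "integrable lborel (exits p \<sigma>)"
    and "\<sigma> * (LINT x|lborel. exits p \<sigma> x)
      = (\<Sum>S | S facet_of K \<and> \<sigma> * fst (outward_normal K S) > 0. fst (outward_normal K S) * surf_int S UNIV p)"
proof -
  let ?F = "{S. S facet_of K \<and> \<sigma> * fst (outward_normal K S) > 0}"
  have *: "integrable lborel (\<lambda>x. indicator (snd ` S) x * p (hgt S x, x)) \<and>
      (\<sigma> * (LINT x|lborel. indicator (snd ` S) x * p (hgt S x, x)) = fst (outward_normal K S) * surf_int S UNIV p)"
    if S: "S \<in> ?F" for S
  proof -
    interpret S: polytope_facet K S using S facetI by blast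
    have nz: "fst S.nu \<noteq> 0" using S by auto
    have c: "continuous_on X (\<lambda>x. p (hgt S x, x))" for X
      by (rule continuous_on_compose2[OF p]) (auto intro!: continuous_intros S.continuous_height)
    have i: "integrable lborel (\<lambda>x. indicator (snd ` S) x * p (hgt S x, x))"
      using borel_integrable_compact[OF S.compact_snd_S c] by (simp add: mult.commute)
    have "(LINT x|lborel. indicator (snd ` S) x * p (hgt S x, x)) = (LINT x:snd ` S|lebesgue. p (hgt S x, x))"
      unfolding set_lebesgue_integral_def using i by (subst integral_completion) auto
    also have "\<dots> = \<bar>fst S.nu\<bar> * surf_int S UNIV p" using S.projection[OF nz p] by simp
    finally have "\<sigma> * (LINT x|lborel. indicator (snd ` S) x * p (hgt S x, x))
       = (\<sigma> * \<bar>fst S.nu\<bar>) * surf_int S UNIV p" by simp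
    also have "\<sigma> * \<bar>fst S.nu\<bar> = fst S.nu"
      using S \<sigma> by (auto simp: abs_if zero_less_mult_iff split: if_splits)
    finally show ?thesis using i by simp
  qed
  then show "integrable lborel (exits p \<sigma>)" unfolding exits_def by (intro Bochner_Integration.integrable_sum) blast
  have "(LINT x|lborel. exits p \<sigma> x) = (\<Sum>S\<in>?F. LINT x|lborel. indicator (snd ` S) x * p (hgt S x, x))"
    unfolding exits_def by (rule Bochner_Integration.integral_sum) (use * in blast)
  then show "\<sigma> * (LINT x|lborel. exits p \<sigma> x) = (\<Sum>S\<in>?F. fst (outward_normal K S) * surf_int S UNIV p)"
    using * by (simp add: sum_distrib_left)
qed

lemma integral_interior:
  fixes q :: "'d spacetime \<Rightarrow> real"
  assumes q: "continuous_on UNIV q"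
  shows "(LINT z:interior K|lebesgue. q z) = (LINT z|lborel. indicator K z * q z)"
proof -
  have [measurable]: "q \<in> borel_measurable borel" "K \<in> sets borel" "interior K \<in> sets borel"
    using q closed by (auto intro: borel_measurable_continuous_onI)
  have "frontier K \<in> null_sets lebesgue"
    using negligible_convex_frontier[OF convex] negligible_iff_null_sets by blast
  then have "AE z in lebesgue. z \<notin> frontier K" by (rule AE_not_in)
  then have "AE z in lborel. z \<notin> frontier K" by (simp add: AE_completion_iff)
  then have "AE z in lborel. indicator (interior K) z * q z = indicator K z * q z"
    by eventually_elim (use interior_subset in \<open>auto simp: frontier_def closure_closed[OF closed] indicator_def\<close>)
  then have "(LINT z|lborel. indicator (interior K) z * q z) = (LINT z|lborel. indicator K z * q z)"
    by (intro integral_cong_AE) auto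
  moreover have "(LINT z:interior K|lebesgue. q z) = (LINT z|lborel. indicator (interior K) z * q z)"
    unfolding set_lebesgue_integral_def by (subst integral_completion) auto
  ultimately show ?thesis by simp
qed

text \<open>Integrate first in time, then in space. Each facet is met by the fibres over its projection, which has
  \<open>\<bar>n\<^sub>t\<bar>\<close> times its area; vertical facets have \<open>n\<^sub>t = 0\<close>, and they project to a null set.\<close>

theorem time_divergence:
  fixes p q :: "'d spacetime \<Rightarrow> real"
  assumes deriv: "\<And>t x. ((\<lambda>s. p (s, x)) has_real_derivative q (t, x)) (at t)"
    and p: "continuous_on UNIV p" and q: "continuous_on UNIV q"
  shows "(LINT z:interior K|lebesgue. q z) = (\<Sum>S | S facet_of K. fst (outward_normal K S) * surf_int S UNIV p)"
proof -
  let ?n = "\<lambda>S. fst (outward_normal K S)"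
  have int: "integrable lborel (\<lambda>z. indicator K z * q z)"
    using borel_integrable_compact[OF compact continuous_on_subset[OF q]] by (simp add: mult.commute)
  have "(LINT z:interior K|lebesgue. q z) = (LINT z|lborel. indicator K z * q z)"
    by (rule integral_interior[OF q])
  also have "\<dots> = (LINT x|lborel. LINT t|lborel. indicator K (t, x) * q (t, x))"
    using lborel_pair.integral_snd[of "\<lambda>t x. indicator K (t, x) * q (t, x)"] int
    by (simp add: lborel_prod split_def)
  also have "\<dots> = (LINT x|lborel. exits p 1 x - exits p (- 1) x)"
  proof (rule integral_cong_AE)
    show "AE x in lborel. (LINT t|lborel. indicator K (t, x) * q (t, x)) = exits p 1 x - exits p (- 1) x"
      using AE_off_projected_frontiers by eventually_elim (rule fibre_integral[OF deriv q], auto)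
    have "(\<lambda>(x, t). indicator K (t, x) * q (t, x)) \<in> borel_measurable (lborel \<Otimes>\<^sub>M lborel)"
    proof -
      have [measurable]: "q \<in> borel_measurable (borel \<Otimes>\<^sub>M borel)" "K \<in> sets (borel \<Otimes>\<^sub>M borel)"
        using q closed unfolding borel_prod by (auto intro: borel_measurable_continuous_onI)
      show ?thesis by measurable
    qed
    then show "(\<lambda>x. LINT t|lborel. indicator K (t, x) * q (t, x)) \<in> borel_measurable lborel"
      using lborel.borel_measurable_lebesgue_integral by fastforce
    show "(\<lambda>x. exits p 1 x - exits p (- 1) x) \<in> borel_measurable lborel"
      using exits_integral(1)[OF _ p] by (intro borel_measurable_diff borel_measurable_integrable) auto
  qed
  also have "\<dots> = (LINT x|lborel. exits p 1 x) - (LINT x|lborel. exits p (- 1) x)"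
    by (rule Bochner_Integration.integral_diff) (auto intro: exits_integral(1)[OF _ p])
  also have "\<dots> = (\<Sum>S | S facet_of K \<and> ?n S > 0. ?n S * surf_int S UNIV p)
      + (\<Sum>S | S facet_of K \<and> ?n S < 0. ?n S * surf_int S UNIV p)"
    using exits_integral(2)[OF _ p, of 1] exits_integral(2)[OF _ p, of "- 1"] by simp
  also have "\<dots> = (\<Sum>S\<in>{S. S facet_of K \<and> ?n S > 0} \<union> {S. S facet_of K \<and> ?n S < 0}. ?n S * surf_int S UNIV p)"
    using finite_facets by (intro sum.union_disjoint[symmetric]) auto
  also have "\<dots> = (\<Sum>S | S facet_of K. ?n S * surf_int S UNIV p)"
    using finite_facets by (intro sum.mono_neutral_left) auto
  finally show ?thesis .
qed

end

lemma set_integral_sum: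
  fixes f :: "'i \<Rightarrow> 'a \<Rightarrow> real"
  assumes "\<And>i. i \<in> I \<Longrightarrow> set_integrable M A (f i)"
  shows "set_integrable M A (\<lambda>x. \<Sum>i\<in>I. f i x)"
    and "(LINT x:A|M. \<Sum>i\<in>I. f i x) = (\<Sum>i\<in>I. LINT x:A|M. f i x)"
  using assms unfolding set_integrable_def set_lebesgue_integral_def
  by (simp_all add: scaleR_sum_right Bochner_Integration.integral_sum Bochner_Integration.integrable_sum
      del: real_scaleR_def)

section \<open>Inverse estimate for finite-dimensional function spaces\<close>

context
  fixes K :: "'a::euclidean_space set"
  assumes K: "compact K" and reg: "closure (interior K) = K"
begin

definition ip :: "('a \<Rightarrow> real) \<Rightarrow> ('a \<Rightarrow> real) \<Rightarrow> real"
  where "ip f g = (LINT z:interior K|lebesgue. f z * g z)"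

lemma integrable_interior:
  fixes f :: "'a \<Rightarrow> real"
  shows "continuous_on UNIV f \<Longrightarrow> set_integrable lebesgue (interior K) f"
  by (rule set_integrable_continuous_compact[OF K])
    (auto intro: continuous_on_subset simp: interior_subset)

text \<open>The zero set of \<open>r\<close> is closed and contains almost every interior point of \<open>K\<close>, hence all of \<open>K\<close>.\<close>

lemma L2_zero_imp_zero:
  fixes r :: "'a \<Rightarrow> real"
  assumes r: "continuous_on UNIV r" and 0: "ip r r = 0" and z: "z \<in> K"
  shows "r z = 0"
proof -
  let ?C = "{z. r z = 0}"
  have C: "closed ?C" using r by (intro closed_Collect_eq) auto
  have "set_integrable lebesgue (interior K) (\<lambda>z. r z * r z)"
    by (intro integrable_interior continuous_intros r)
  then have int: "integrable lebesgue (\<lambda>z. indicator (interior K) z *\<^sub>R (r z * r z))"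
    by (simp add: set_integrable_def)
  have "AE z in lebesgue. indicator (interior K) z *\<^sub>R (r z * r z) = 0"
    using integral_nonneg_eq_0_iff_AE[OF int] 0 by (simp add: ip_def set_lebesgue_integral_def)
  then have "AE z\<in>interior K in lebesgue. z \<in> ?C"
    by eventually_elim (auto simp: indicator_def)
  then have "interior K \<subseteq> ?C"
    using mem_closed_if_AE_lebesgue_open[OF open_interior C] by blast
  then have "closure (interior K) \<subseteq> ?C" using C by (rule closure_minimal)
  then show ?thesis using z reg by blast
qed

lemma ip_sum_left:
  assumes "finite E" "\<And>e. e \<in> E \<Longrightarrow> continuous_on UNIV e" "continuous_on UNIV g"
  shows "ip (\<lambda>z. \<Sum>e\<in>E. a e * e z) g = (\<Sum>e\<in>E. a e * ip e g)"
proof -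
  have "(\<Sum>e\<in>E. a e * e z) * g z = (\<Sum>e\<in>E. a e * (e z * g z))" for z
    by (simp add: sum_distrib_right mult.assoc)
  then have "ip (\<lambda>z. \<Sum>e\<in>E. a e * e z) g = (LINT z:interior K|lebesgue. \<Sum>e\<in>E. a e * (e z * g z))"
    unfolding ip_def by simp
  also have "\<dots> = (\<Sum>e\<in>E. LINT z:interior K|lebesgue. a e * (e z * g z))"
  proof (rule set_integral_sum(2))
    fix e assume "e \<in> E"
    then show "set_integrable lebesgue (interior K) (\<lambda>z. a e * (e z * g z))"
      by (intro integrable_interior continuous_on_mult continuous_on_const assms)
  qed
  also have "\<dots> = (\<Sum>e\<in>E. a e * ip e g)"
    unfolding ip_def by (intro sum.cong refl set_integral_mult_right)
  finally show ?thesis .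
qed

lemma ip_commute: "ip f g = ip g f"
  by (simp add: ip_def mult.commute)

text \<open>The functions \<open>m i\<close>, which may be linearly dependent on \<open>K\<close>, have all their linear combinations in
  the span of the orthonormal set \<open>E\<close>.\<close>

definition orthonormal_span :: "('a \<Rightarrow> real) set \<Rightarrow> 'i set \<Rightarrow> ('i \<Rightarrow> 'a \<Rightarrow> real) \<Rightarrow> bool"
  where "orthonormal_span E I m \<longleftrightarrow> finite E \<and> (\<forall>e\<in>E. continuous_on UNIV e) \<and> (\<forall>e\<in>E. \<forall>e'\<in>E. ip e e' = (if e = e' then 1 else 0)) \<and>
    (\<forall>c. \<exists>a. \<forall>z\<in>K. (\<Sum>i\<in>I. c i * m i z) = (\<Sum>e\<in>E. a e * e z))"

lemma orthonormal_spanD: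
  assumes "orthonormal_span E I m"
  shows "finite E" and "\<And>e. e \<in> E \<Longrightarrow> continuous_on UNIV e"
    and "\<And>e e'. e \<in> E \<Longrightarrow> e' \<in> E \<Longrightarrow> ip e e' = (if e = e' then 1 else 0)"
    and "\<And>c. \<exists>a. \<forall>z\<in>K. (\<Sum>i\<in>I. c i * m i z) = (\<Sum>e\<in>E. a e * e z)"
  using assms unfolding orthonormal_span_def by simp_all

text \<open>When a new function has no component orthogonal to the previous ones, it agrees on \<open>K\<close> with an element
  of their span, so nothing has to be added.\<close>

lemma Gram_Schmidt:
  fixes m :: "'i \<Rightarrow> 'a \<Rightarrow> real"
  assumes "finite I" "\<And>i. i \<in> I \<Longrightarrow> continuous_on UNIV (m i)"
  shows "\<exists>E. orthonormal_span E I m"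
  using assms
proof (induction I rule: finite_induct)
  case empty
  show ?case by (intro exI[of _ "{}"]) (simp add: orthonormal_span_def)
next
  case (insert j I)
  then obtain E where oE: "orthonormal_span E I m" by auto
  note E = orthonormal_spanD(1-3)[OF oE] and span = orthonormal_spanD(4)[OF oE]
  define b where "b = (\<lambda>e. ip e (m j))"
  define r where "r = (\<lambda>z. m j z - (\<Sum>e\<in>E. b e * e z))"
  have mj: "continuous_on UNIV (m j)" using insert.prems by simp
  have r: "continuous_on UNIV r" unfolding r_def by (intro continuous_intros mj E(2)) auto
  have orth: "ip e r = 0" if e: "e \<in> E" for e
  proof -
    have "ip e r = (LINT z:interior K|lebesgue. e z * m j z - e z * (\<Sum>e\<in>E. b e * e z))"
      by (simp add: ip_def r_def algebra_simps)
    also have "\<dots> = ip e (m j) - ip e (\<lambda>z. \<Sum>e\<in>E. b e * e z)"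
      unfolding ip_def by (intro set_integral_diff integrable_interior continuous_intros mj E(2)[OF e] E(2)) auto
    also have "ip e (\<lambda>z. \<Sum>e\<in>E. b e * e z) = (\<Sum>e'\<in>E. b e' * ip e' e)"
      by (subst ip_commute) (rule ip_sum_left[OF E(1,2) E(2)[OF e]])
    also have "\<dots> = (\<Sum>e'\<in>E. if e' = e then b e' else 0)"
      by (rule sum.cong) (use E(3)[OF _ e] in auto)
    also have "\<dots> = b e" using E(1) e by (simp add: sum.delta)
    finally show ?thesis by (simp add: b_def)
  qed
  have ins: "(\<Sum>i\<in>insert j I. c i * m i z) = c j * r z + (\<Sum>e\<in>E. (c j * b e + a e) * e z)"
    if "(\<Sum>i\<in>I. c i * m i z) = (\<Sum>e\<in>E. a e * e z)" for c a z
  proof -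
    have "m j z = r z + (\<Sum>e\<in>E. b e * e z)" by (simp add: r_def)
    then have "c j * m j z = c j * r z + (\<Sum>e\<in>E. c j * b e * e z)"
      by (simp add: algebra_simps sum_distrib_left)
    then show ?thesis
      using insert.hyps that by (simp add: algebra_simps sum.distrib)
  qed
  show ?case
  proof (cases "ip r r = 0")
    case True
    have "\<exists>a. \<forall>z\<in>K. (\<Sum>i\<in>insert j I. c i * m i z) = (\<Sum>e\<in>E. a e * e z)" for c
    proof -
      obtain a where "\<forall>z\<in>K. (\<Sum>i\<in>I. c i * m i z) = (\<Sum>e\<in>E. a e * e z)" using span by blast
      then have "\<forall>z\<in>K. (\<Sum>i\<in>insert j I. c i * m i z) = (\<Sum>e\<in>E. (c j * b e + a e) * e z)"
        using ins L2_zero_imp_zero[OF r True] by simp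
      then show ?thesis by (intro exI[of _ "\<lambda>e. c j * b e + a e"])
    qed
    then show ?thesis using E by (intro exI[of _ E]) (simp add: orthonormal_span_def)
  next
    case False
    have "ip r r \<ge> 0"
      unfolding ip_def set_lebesgue_integral_def by (intro integral_nonneg_AE AE_I2) simp
    with False have pos: "ip r r > 0" by simp
    define s where "s = sqrt (ip r r)"
    define f where "f = (\<lambda>z. r z / s)"
    have s: "s > 0" "s * s = ip r r" using pos by (auto simp: s_def)
    have f: "continuous_on UNIV f" unfolding f_def using s by (intro continuous_intros r) auto
    have ff: "ip f f = 1"
    proof -
      have "ip f f = (LINT z:interior K|lebesgue. (1 / (s * s)) * (r z * r z))" by (simp add: ip_def f_def)
      also have "\<dots> = (1 / (s * s)) * ip r r"
        unfolding ip_def by (rule set_integral_mult_right)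
      finally show ?thesis using s pos by simp
    qed
    have ef: "ip e f = 0" if "e \<in> E" for e
    proof -
      have "ip e f = (LINT z:interior K|lebesgue. (1 / s) * (e z * r z))" by (simp add: ip_def f_def)
      also have "\<dots> = (1 / s) * ip e r"
        unfolding ip_def by (rule set_integral_mult_right)
      finally show ?thesis using orth[OF that] by simp
    qed
    have fE: "f \<notin> E" using ef ff by force
    have "\<exists>a. \<forall>z\<in>K. (\<Sum>i\<in>insert j I. c i * m i z) = (\<Sum>e\<in>insert f E. a e * e z)" for c
    proof -
      obtain a where a: "\<forall>z\<in>K. (\<Sum>i\<in>I. c i * m i z) = (\<Sum>e\<in>E. a e * e z)" using span by blast
      define a' where "a' = (\<lambda>e. if e = f then c j * s else c j * b e + a e)"
      have "(\<Sum>e\<in>insert f E. a' e * e z) = c j * r z + (\<Sum>e\<in>E. (c j * b e + a e) * e z)" for z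
      proof -
        have "(\<Sum>e\<in>E. a' e * e z) = (\<Sum>e\<in>E. (c j * b e + a e) * e z)"
          by (rule sum.cong) (use fE in \<open>auto simp: a'_def\<close>)
        then show ?thesis using E(1) fE s by (simp add: a'_def f_def)
      qed
      then have "\<forall>z\<in>K. (\<Sum>i\<in>insert j I. c i * m i z) = (\<Sum>e\<in>insert f E. a' e * e z)"
        using ins a by simp
      then show ?thesis by (intro exI[of _ a'])
    qed
    moreover have "ip e e' = (if e = e' then 1 else 0)" if "e \<in> insert f E" "e' \<in> insert f E" for e e'
      using that E(3) ff ef fE ip_commute by auto
    ultimately show ?thesis using E f by (intro exI[of _ "insert f E"]) (simp add: orthonormal_span_def)
  qed
qed

text \<open>In an orthonormal basis the \<open>L\<^sup>2\<close> norm is the Euclidean norm of the coefficients, so the Cauchy-Schwarz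
  inequality bounds point values; the constant is a bound of \<open>\<Sum> e\<^sup>2\<close> on the compact set.\<close>

lemma inverse_estimate:
  fixes m :: "'i \<Rightarrow> 'a \<Rightarrow> real"
  assumes I: "finite I" "\<And>i. i \<in> I \<Longrightarrow> continuous_on UNIV (m i)"
  shows "\<exists>C\<ge>0. \<forall>c. \<forall>z\<in>K. (\<Sum>i\<in>I. c i * m i z)\<^sup>2
    \<le> C * (LINT z:interior K|lebesgue. (\<Sum>i\<in>I. c i * m i z)\<^sup>2)"
proof -
  obtain E where oE: "orthonormal_span E I m" using Gram_Schmidt[of I m] I by auto
  note E = orthonormal_spanD(1-3)[OF oE] and span = orthonormal_spanD(4)[OF oE]
  have "continuous_on K (\<lambda>z. \<Sum>e\<in>E. (e z)\<^sup>2)"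
    using E(2) by (intro continuous_intros) (auto intro: continuous_on_subset)
  then have "bounded ((\<lambda>z. \<Sum>e\<in>E. (e z)\<^sup>2) ` K)"
    using K by (intro compact_imp_bounded compact_continuous_image)
  then obtain C where C: "C > 0" "\<And>z. z \<in> K \<Longrightarrow> norm (\<Sum>e\<in>E. (e z)\<^sup>2) \<le> C"
    unfolding bounded_pos by auto
  have "(\<Sum>i\<in>I. c i * m i z)\<^sup>2 \<le> C * (LINT z:interior K|lebesgue. (\<Sum>i\<in>I. c i * m i z)\<^sup>2)"
    if z: "z \<in> K" for c z
  proof -
    obtain a where a: "\<And>z. z \<in> K \<Longrightarrow> (\<Sum>i\<in>I. c i * m i z) = (\<Sum>e\<in>E. a e * e z)" using span by blast
    define f where "f = (\<lambda>z. \<Sum>e\<in>E. a e * e z)"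
    have f: "continuous_on UNIV f" unfolding f_def by (intro continuous_intros E(2)) auto
    have "(LINT z:interior K|lebesgue. (\<Sum>i\<in>I. c i * m i z)\<^sup>2) = ip f f"
      unfolding ip_def
      by (rule set_lebesgue_integral_cong) (use a interior_subset[of K] in \<open>auto simp: f_def power2_eq_square\<close>)
    also have "\<dots> = (\<Sum>e\<in>E. a e * ip e f)"
      using ip_sum_left[OF E(1,2) f, of a] unfolding f_def[symmetric] .
    also have "\<dots> = (\<Sum>e\<in>E. (a e)\<^sup>2)"
    proof (rule sum.cong[OF refl])
      fix e assume e: "e \<in> E"
      have "ip e f = (\<Sum>e'\<in>E. a e' * ip e' e)"
        unfolding f_def by (subst ip_commute) (rule ip_sum_left[OF E(1,2) E(2)[OF e]])
      also have "\<dots> = (\<Sum>e'\<in>E. if e' = e then a e' else 0)"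
        by (rule sum.cong) (use E(3)[OF _ e] in auto)
      also have "\<dots> = a e" using E(1) e by (simp add: sum.delta)
      finally show "a e * ip e f = (a e)\<^sup>2" by (simp add: power2_eq_square)
    qed
    finally have int: "(LINT z:interior K|lebesgue. (\<Sum>i\<in>I. c i * m i z)\<^sup>2) = (\<Sum>e\<in>E. (a e)\<^sup>2)" .
    have "(\<Sum>i\<in>I. c i * m i z)\<^sup>2 = (\<Sum>e\<in>E. a e * e z)\<^sup>2" using a[OF z] by simp
    also have "\<dots> \<le> (\<Sum>e\<in>E. (a e)\<^sup>2) * (\<Sum>e\<in>E. (e z)\<^sup>2)" by (rule Cauchy_Schwarz_ineq_sum)
    also have "\<dots> \<le> (\<Sum>e\<in>E. (a e)\<^sup>2) * C"
      using C(2)[OF z] by (intro mult_left_mono sum_nonneg) auto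
    finally show ?thesis unfolding int by (simp add: mult.commute)
  qed
  then show ?thesis using C(1) by (intro exI[of _ C]) auto
qed

end

section \<open>Polynomials and their derivatives\<close>

definition monomial :: "('a::euclidean_space \<Rightarrow> nat) \<Rightarrow> 'a \<Rightarrow> real"
  where "monomial a z = (\<Prod>b\<in>Basis. (z \<bullet> b) ^ a b)"

definition monomial_deriv :: "('a::euclidean_space \<Rightarrow> nat) \<Rightarrow> 'a \<Rightarrow> 'a \<Rightarrow> real"
  where "monomial_deriv a w z =
    (\<Sum>b\<in>Basis. (real (a b) * (w \<bullet> b) * (z \<bullet> b) ^ (a b - 1)) * (\<Prod>b'\<in>Basis - {b}. (z \<bullet> b') ^ a b'))"

definition exponents :: "nat \<Rightarrow> ('a::euclidean_space \<Rightarrow> nat) set"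
  where "exponents l = {a \<in> Basis \<rightarrow>\<^sub>E {..l}. (\<Sum>b\<in>Basis. a b) \<le> l}"

lemma finite_exponents: "finite (exponents l)"
  unfolding exponents_def by (rule finite_subset[OF _ finite_PiE[of Basis "\<lambda>_. {..l}"]]) auto

lemma continuous_monomial: "continuous_on X (monomial a)"
  unfolding monomial_def by (intro continuous_intros)

lemma continuous_monomial_deriv: "continuous_on X (monomial_deriv a w)"
  unfolding monomial_deriv_def by (intro continuous_intros)

lemma monomial_has_derivative: "(monomial a has_derivative (\<lambda>w. monomial_deriv a w z)) (at z)"
  unfolding monomial_def monomial_deriv_def
  by (rule has_derivative_prod) (auto intro!: derivative_eq_intros simp: mult_ac)

lemma poly_upto_iff: "p \<in> poly_upto l \<longleftrightarrow> (\<exists>c. p = (\<lambda>z. \<Sum>a\<in>exponents l. c a * monomial a z))"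
  by (simp add: poly_upto_def exponents_def monomial_def)

lemma combination_has_derivative:
  "((\<lambda>z. \<Sum>a\<in>A. c a * monomial a z) has_derivative (\<lambda>w. \<Sum>a\<in>A. c a * monomial_deriv a w z)) (at z)"
  by (auto intro!: derivative_eq_intros monomial_has_derivative)

lemma continuous_poly_upto: "p \<in> poly_upto l \<Longrightarrow> continuous_on X p"
  by (auto simp: poly_upto_iff intro!: continuous_intros continuous_monomial)

definition poly_field :: "nat \<Rightarrow> ('d::finite) field \<Rightarrow> bool"
  where "poly_field k P \<longleftrightarrow> (\<forall>i. (\<lambda>z. P z $ i) \<in> poly_upto k)"

lemma continuous_poly_field:
  assumes "poly_field k P" shows "continuous_on X P"
proof -
  have "continuous_on X (\<lambda>z. \<chi> i. P z $ i)"
    using assms continuous_poly_upto by (intro continuous_on_vec_lambda) (auto simp: poly_field_def)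
  then show ?thesis by simp
qed

lemma poly_field_derivative:
  fixes P :: "('d::finite) field"
  assumes "poly_field k P"
  obtains c where "\<And>z. (P has_derivative (\<lambda>w. \<chi> i. \<Sum>a\<in>exponents k. c i a * monomial_deriv a w z)) (at z)"
proof -
  have "\<forall>i. \<exists>c. (\<lambda>z. P z $ i) = (\<lambda>z. \<Sum>a\<in>exponents k. c a * monomial a z)"
    using assms by (simp add: poly_field_def poly_upto_iff)
  then obtain c where c: "\<And>i. (\<lambda>z. P z $ i) = (\<lambda>z. \<Sum>a\<in>exponents k. c i a * monomial a z)"
    by metis
  have "(P has_derivative (\<lambda>w. \<chi> i. \<Sum>a\<in>exponents k. c i a * monomial_deriv a w z)) (at z)" for z
  proof -
    have "((\<lambda>z. P z $ i) has_derivative (\<lambda>w. \<Sum>a\<in>exponents k. c i a * monomial_deriv a w z)) (at z)" for i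
      unfolding c by (rule combination_has_derivative)
    then show ?thesis
      by (subst has_derivative_componentwise_within) (auto simp: Basis_vec_def inner_axis)
  qed
  then show ?thesis using that by blast
qed

lemma slice_derivatives:
  fixes P :: "('d::finite) field"
  assumes "(P has_derivative D) (at z)"
  shows "((\<lambda>y. P (fst z, y)) has_derivative (\<lambda>w. D (0, w))) (at (snd z))"
    and "((\<lambda>s. P (s, snd z)) has_vector_derivative D (1, 0)) (at (fst z))"
proof -
  have D: "(P has_derivative D) (at (fst z, snd z))" using assms by simp
  have "((\<lambda>y. (fst z, y)) has_derivative (\<lambda>w. (0, w))) (at (snd z))"
    by (auto intro!: derivative_eq_intros)
  from has_derivative_compose[OF this D]
  show "((\<lambda>y. P (fst z, y)) has_derivative (\<lambda>w. D (0, w))) (at (snd z))" .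
  have "((\<lambda>s. (s, snd z)) has_derivative (\<lambda>s. (s, 0))) (at (fst z))"
    by (auto intro!: derivative_eq_intros)
  from has_derivative_compose[OF this D]
  have "((\<lambda>s. P (s, snd z)) has_derivative (\<lambda>s. D (s, 0))) (at (fst z))" .
  moreover have "(\<lambda>s. D (s, 0)) = (\<lambda>s. s *\<^sub>R D (1, 0))"
  proof
    fix s :: real
    have "s *\<^sub>R (1, 0) = (s, 0 :: real^'d)" by simp
    then show "D (s, 0) = s *\<^sub>R D (1, 0)"
      using linear_scale[OF has_derivative_linear[OF assms], of s "(1, 0)"] by metis
  qed
  ultimately show "((\<lambda>s. P (s, snd z)) has_vector_derivative D (1, 0)) (at (fst z))"
    unfolding has_vector_derivative_def by simp
qed

lemma sgrad_eq:
  assumes "(P has_derivative D) (at z)"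
  shows "sgrad P z = matrix (\<lambda>w. D (0, w))"
  unfolding sgrad_def jacobian_def
  by (subst frechet_derivative_at[OF slice_derivatives(1)[OF assms], symmetric]) (rule refl)

lemma dt_eq:
  assumes "(P has_derivative D) (at z)"
  shows "dt P z = D (1, 0)"
  unfolding dt_def by (rule vector_derivative_at[OF slice_derivatives(2)[OF assms]])

lemma poly_field_sgrad_dt:
  fixes P :: "('d::finite) field"
  assumes P: "poly_field k P"
  shows "continuous_on X (sgrad P)" and "continuous_on X (dt P)"
    and "((\<lambda>s. P (s, x)) has_vector_derivative dt P (t, x)) (at t)"
proof -
  obtain c where c: "\<And>z. (P has_derivative (\<lambda>w. \<chi> i. \<Sum>a\<in>exponents k. c i a * monomial_deriv a w z)) (at z)"
    using poly_field_derivative[OF P] by blast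
  have s: "sgrad P = (\<lambda>z. \<chi> i j. \<Sum>a\<in>exponents k. c i a * monomial_deriv a (0, axis j 1) z)"
    using sgrad_eq[OF c] by (auto simp: matrix_def)
  show "continuous_on X (sgrad P)"
    unfolding s by (intro continuous_on_vec_lambda continuous_intros continuous_monomial_deriv)
  have d: "dt P = (\<lambda>z. \<chi> i. \<Sum>a\<in>exponents k. c i a * monomial_deriv a (1, 0) z)"
    using dt_eq[OF c] by auto
  show "continuous_on X (dt P)"
    unfolding d by (intro continuous_on_vec_lambda continuous_intros continuous_monomial_deriv)
  show "((\<lambda>s. P (s, x)) has_vector_derivative dt P (t, x)) (at t)"
    using slice_derivatives(2)[OF c[of "(t, x)"]] dt_eq[OF c] by simp
qed

lemma norm_matrix_sq: "(norm (A :: real^'m::finite^'n::finite))\<^sup>2 = (\<Sum>i\<in>UNIV. \<Sum>j\<in>UNIV. (A $ i $ j)\<^sup>2)"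
  unfolding power2_norm_eq_inner by (simp add: inner_vec_def power2_eq_square)

text \<open>The discrete trace inequality behind the penalty term. Each entry of the gradient is a combination of
  the derivatives of finitely many fixed monomials, so the inverse estimate applies to it, with a constant that
  depends on \<open>K\<close> and \<open>k\<close> only.\<close>

lemma (in solid_polytope) gradient_inverse_estimate:
  "\<exists>C\<ge>0. \<forall>P. poly_field k P \<longrightarrow> (\<forall>z\<in>K. (norm (sgrad P z))\<^sup>2
    \<le> C * (LINT z:interior K|lebesgue. (norm (sgrad P z))\<^sup>2))"
proof -
  define G where "G j c z = (\<Sum>a\<in>exponents k. c a * monomial_deriv a (0, axis j 1) z)"
    for j :: 'd and c and z :: "'d spacetime"
  have "\<forall>j. \<exists>C\<ge>0. \<forall>c. \<forall>z\<in>K. (G j c z)\<^sup>2 \<le> C * (LINT z:interior K|lebesgue. (G j c z)\<^sup>2)"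
    unfolding G_def
    by (intro allI inverse_estimate compact closure_interior finite_exponents continuous_monomial_deriv)
  from choice[OF this] obtain C where CC: "\<forall>j. C j \<ge> 0 \<and> (\<forall>c. \<forall>z\<in>K. (G j c z)\<^sup>2
    \<le> C j * (LINT z:interior K|lebesgue. (G j c z)\<^sup>2))" ..
  have C0: "C j \<ge> 0" for j using CC by (rule allE) (erule conjunct1)
  have C: "\<And>j c z. z \<in> K \<Longrightarrow> (G j c z)\<^sup>2 \<le> C j * (LINT z:interior K|lebesgue. (G j c z)\<^sup>2)"
    using CC[THEN spec, THEN conjunct2, THEN spec, THEN bspec] .
  have "(norm (sgrad P z))\<^sup>2 \<le> (\<Sum>j\<in>UNIV. C j) * (LINT z:interior K|lebesgue. (norm (sgrad P z))\<^sup>2)"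
    if P: "poly_field k P" and z: "z \<in> K" for P :: "'d field" and z
  proof -
    obtain c where c: "\<And>z. (P has_derivative (\<lambda>w. \<chi> i. \<Sum>a\<in>exponents k. c i a * monomial_deriv a w z)) (at z)"
      using poly_field_derivative[OF P] by blast
    define g where "g i j z = (\<Sum>a\<in>exponents k. c i a * monomial_deriv a (0, axis j 1) z)" for i j z
    have s: "sgrad P z $ i $ j = g i j z" for z i j
      using sgrad_eq[OF c, of z] by (simp add: matrix_def g_def)
    have gc: "continuous_on UNIV (g i j)" for i j
      unfolding g_def by (intro continuous_intros continuous_monomial_deriv)
    have int: "set_integrable lebesgue (interior K) (\<lambda>z. (g i j z)\<^sup>2)" for i j
      by (rule integrable_interior[OF compact closure_interior]) (intro continuous_intros gc)
    have nn: "0 \<le> (LINT z:interior K|lebesgue. (g i j z)\<^sup>2)" for i j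
      unfolding set_lebesgue_integral_def by (intro integral_nonneg_AE AE_I2) simp
    have "(norm (sgrad P z))\<^sup>2 = (\<Sum>i\<in>UNIV. \<Sum>j\<in>UNIV. (g i j z)\<^sup>2)" by (simp add: norm_matrix_sq s)
    also have "\<dots> \<le> (\<Sum>i\<in>UNIV. \<Sum>j\<in>UNIV. (\<Sum>j\<in>UNIV. C j) * (LINT z:interior K|lebesgue. (g i j z)\<^sup>2))"
    proof (intro sum_mono)
      fix i j
      have "(g i j z)\<^sup>2 \<le> C j * (LINT z:interior K|lebesgue. (g i j z)\<^sup>2)"
        unfolding g_def by (rule C[OF z, unfolded G_def])
      also have "\<dots> \<le> (\<Sum>j\<in>UNIV. C j) * (LINT z:interior K|lebesgue. (g i j z)\<^sup>2)"
        using C0 nn by (intro mult_right_mono member_le_sum) auto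
      finally show "(g i j z)\<^sup>2 \<le> (\<Sum>j\<in>UNIV. C j) * (LINT z:interior K|lebesgue. (g i j z)\<^sup>2)" .
    qed
    also have "\<dots> = (\<Sum>j\<in>UNIV. C j) * (\<Sum>i\<in>UNIV. \<Sum>j\<in>UNIV. LINT z:interior K|lebesgue. (g i j z)\<^sup>2)"
      by (simp add: sum_distrib_left)
    also have "(\<Sum>i\<in>UNIV. \<Sum>j\<in>UNIV. LINT z:interior K|lebesgue. (g i j z)\<^sup>2)
        = (LINT z:interior K|lebesgue. (\<Sum>i\<in>UNIV. \<Sum>j\<in>UNIV. (g i j z)\<^sup>2))"
      using int by (simp add: set_integral_sum)
    also have "\<dots> = (LINT z:interior K|lebesgue. (norm (sgrad P z))\<^sup>2)" by (simp add: norm_matrix_sq s)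
    finally show ?thesis .
  qed
  moreover have "(\<Sum>j\<in>UNIV. C j) \<ge> 0" using C0 by (simp add: sum_nonneg)
  ultimately show ?thesis by blast
qed

section \<open>Traces and derivatives of piecewise polynomial fields\<close>

context solid_polytope
begin

text \<open>Each point of a solid polytope is a limit of other interior points, so the limit that defines the
  trace is unique.\<close>

lemma tr_eq:
  fixes v P :: "'d spacetime \<Rightarrow> 'b::t2_space"
  assumes eq: "\<And>z. z \<in> interior K \<Longrightarrow> v z = P z" and P: "continuous_on UNIV P" and z: "z \<in> K"
  shows "tr K v z = P z"
proof -
  have "z islimpt interior K"
  proof (cases "z \<in> interior K")
    case True
    then show ?thesis using interior_limit_point[of z "interior K"] by simp
  next
    case False
    then show ?thesis using z closure_interior by (auto simp: closure_def)
  qed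
  then have nt: "\<not> trivial_limit (at z within interior K)" by (simp add: trivial_limit_within)
  have "(P \<longlongrightarrow> P z) (at z within interior K)"
    using P by (meson UNIV_I continuous_on_def subset_UNIV tendsto_within_subset)
  moreover have "\<forall>\<^sub>F z in at z within interior K. P z = v z"
    using eq by (auto simp: eventually_at_filter)
  ultimately have "(v \<longlongrightarrow> P z) (at z within interior K)"
    using tendsto_cong by force
  then show ?thesis unfolding tr_def by (rule tendsto_Lim[OF nt])
qed

lemma derivatives_local:
  fixes u P :: "'d field"
  assumes eq: "\<And>z. z \<in> interior K \<Longrightarrow> u z = P z" and P: "poly_field k P" and z: "z \<in> interior K"
  shows "sgrad u z = sgrad P z" and "dt u z = dt P z"
proof -
  obtain D where D: "(P has_derivative D) (at z)"
    using poly_field_derivative[OF P] by blast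
  have "(u has_derivative D) (at z)"
    by (rule has_derivative_transform_within_open[OF D open_interior z]) (simp add: eq)
  then show "sgrad u z = sgrad P z" "dt u z = dt P z"
    using D by (simp_all add: sgrad_eq dt_eq)
qed

end

section \<open>Geometry of a space-time slab\<close>

locale space_time_slab =
  fixes D :: "('d::finite) setting" and n :: nat
  assumes disc: "st_discretization D" and n: "n < slabs D"
begin

lemma mesh: "slab_mesh D n"
  using disc n unfolding st_discretization_def by blast

lemma finite_mesh: "finite (mesh D n)"
  using mesh unfolding slab_mesh_def triangulation_def by blast

lemma mesh_Union: "\<Union> (mesh D n) = closure (slab D n)"
  using mesh unfolding slab_mesh_def by blast

lemma mesh_Int_face: "K \<in> mesh D n \<Longrightarrow> K' \<in> mesh D n \<Longrightarrow> K \<inter> K' face_of K"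
  using mesh unfolding slab_mesh_def triangulation_def by blast

lemma mesh_element:
  assumes "K \<in> mesh D n"
  shows mesh_solid: "solid_polytope K" and mesh_interior: "interior K \<subseteq> slab D n"
    and mesh_hsize: "hsize D K > 0"
proof -
  have K: "int (CARD('d) + 1) simplex K" "interior K \<subseteq> slab D n" "hsize D K > 0"
    using mesh assms unfolding slab_mesh_def by blast+
  then show "interior K \<subseteq> slab D n" "hsize D K > 0" by blast+
  have p: "polytope K" using K(1) by (rule simplex_imp_polytope)
  have d: "aff_dim K = int (DIM('d spacetime))" using aff_dim_simplex[OF K(1)] by simp
  then have "affine hull K = UNIV" by (simp only: aff_dim_eq_full)
  then have "rel_interior K = interior K" by (rule rel_interior_interior)
  moreover have "K \<noteq> {}" using d by auto
  ultimately have "interior K \<noteq> {}"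
    using rel_interior_eq_empty polytope_imp_convex[OF p] by blast
  then show "solid_polytope K" using p by unfold_locales
qed

lemma mesh_facet: "K \<in> mesh D n \<Longrightarrow> S facet_of K \<Longrightarrow> polytope_facet K S"
  using mesh_solid solid_polytope.facetI by blast

text \<open>Both normals are orthogonal to the facet. If they were equal, both elements would contain the points
  just below the facet, so their intersection, which is a face of both, would be all of both.\<close>

lemma opposite_normals:
  assumes K: "K \<in> mesh D n" "K' \<in> mesh D n" "K \<noteq> K'" and S: "S facet_of K" "S facet_of K'"
  shows "outward_normal K' S = - outward_normal K S"
proof -
  interpret A: polytope_facet K S using mesh_facet K S by blast
  interpret B: polytope_facet K' S using mesh_facet K S by blast
  obtain z where z: "z \<in> rel_interior S"
    using A.S_ne A.S_convex rel_interior_eq_empty by blast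
  then have zS: "z \<in> S" using rel_interior_subset by blast
  define c where "c = B.nu \<bullet> A.nu"
  define w where "w = B.nu - c *\<^sub>R A.nu"
  have aw: "A.nu \<bullet> w = 0" by (simp add: w_def c_def inner_diff_right A.nu_nu inner_commute)
  then have "z + w \<in> affine hull S"
    using A.affine_hull_S A.S_offset[OF zS] by (simp add: inner_add_right)
  then have "B.nu \<bullet> w = 0"
    using B.affine_hull_S B.S_offset[OF zS] by (simp add: inner_add_right)
  then have "w \<bullet> w = 0" using aw by (simp add: w_def inner_diff_left)
  then have eq: "B.nu = c *\<^sub>R A.nu" by (simp add: w_def)
  have "\<bar>c\<bar> = 1" using arg_cong[OF eq, of norm] A.norm_nu B.norm_nu by simp
  moreover have "c \<noteq> 1"
  proof
    assume "c = 1"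
    then have nn: "B.nu = A.nu" using eq by simp
    obtain e where e: "e > 0" "\<And>s. 0 < s \<and> s \<le> e \<Longrightarrow> z - s *\<^sub>R A.nu \<in> interior K" using A.inward[OF z] by blast
    obtain e' where e': "e' > 0" "\<And>s. 0 < s \<and> s \<le> e' \<Longrightarrow> z - s *\<^sub>R B.nu \<in> interior K'" using B.inward[OF z] by blast
    define y where "y = z - min e e' *\<^sub>R A.nu"
    have y: "y \<in> interior K" "y \<in> interior K'"
      using e(2)[of "min e e'"] e'(2)[of "min e e'"] e(1) e'(1) nn by (simp_all add: y_def)
    then have "y \<in> K \<inter> K'" using interior_subset by blast
    then have "K \<inter> K' = K" "K' \<inter> K = K'"
      using face_of_disjoint_interior[OF mesh_Int_face[OF K(1,2)]] face_of_disjoint_interior[OF mesh_Int_face[OF K(2,1)]] y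
      by blast+
    then show False using K(3) by blast
  qed
  ultimately have "c = - 1" by linarith
  then show ?thesis using eq by simp
qed

text \<open>The intersection of the two elements is a face of the first that contains a relative interior point of
  the facet, hence the facet. It is a proper face, so by dimension it is the facet.\<close>

lemma facet_of_neighbour:
  assumes K: "K \<in> mesh D n" "K' \<in> mesh D n" "K \<noteq> K'" and S: "S facet_of K"
    and z: "z \<in> rel_interior S" "z \<in> K'"
  shows "S facet_of K'"
proof -
  interpret A: polytope_facet K S using mesh_facet K S by blast
  interpret B: solid_polytope K' using mesh_solid K by blast
  have "z \<in> K" using z(1) rel_interior_subset A.S_sub by blast
  then have sub: "S \<subseteq> K \<inter> K'"
    using subset_of_face_of[OF mesh_Int_face[OF K(1,2)] A.S_sub] z by blast
  have f1: "K \<inter> K' face_of K" and f2: "K \<inter> K' face_of K'"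
    using mesh_Int_face[OF K(1,2)] mesh_Int_face[OF K(2,1)] by (simp_all only: Int_commute[of K' K])
  have ne: "K \<inter> K' \<noteq> K"
  proof
    assume *: "K \<inter> K' = K"
    then have "K face_of K'" using f2 by simp
    then show False
      using face_of_aff_dim_lt[OF B.convex] K(3) A.aff_dim_full B.aff_dim_full by fastforce
  qed
  then have "aff_dim (K \<inter> K') < aff_dim K" using face_of_aff_dim_lt[OF A.convex f1] by blast
  then have d: "aff_dim (K \<inter> K') \<le> aff_dim S" using A.facet by (simp add: facet_of_def)
  have "S face_of (K \<inter> K')" using A.S_face sub by (rule face_of_subset) simp
  then have "S = K \<inter> K'"
    using face_of_aff_dim_lt[of "K \<inter> K'" S] d face_of_imp_convex[OF f1] by fastforce
  then show ?thesis
    using f2 A.S_ne A.facet A.aff_dim_full B.aff_dim_full by (simp add: facet_of_def)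
qed

lemma mesh_times:
  assumes "K \<in> mesh D n" "z \<in> K"
  shows "tm D n \<le> fst z" "fst z \<le> tm D (Suc n)"
proof -
  have "closure (slab D n) \<subseteq> {z. tm D n \<le> fst z \<and> fst z \<le> tm D (Suc n)}"
  proof (rule closure_minimal)
    show "closed {z :: 'd spacetime. tm D n \<le> fst z \<and> fst z \<le> tm D (Suc n)}"
      by (intro closed_Collect_conj closed_Collect_le continuous_intros)
  qed (auto simp: slab_def)
  then show "tm D n \<le> fst z" "fst z \<le> tm D (Suc n)" using assms mesh_Union by blast+
qed

text \<open>From a relative interior point of a lateral facet one can move within the facet both forwards and
  backwards in time.\<close>

lemma lateral_times:
  assumes K: "K \<in> mesh D n" and S: "S \<in> lateral_facets K" and z: "z \<in> rel_interior S"
  shows "tm D n < fst z" "fst z < tm D (Suc n)"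
proof -
  have SK: "S facet_of K" using S by (simp add: lateral_facets_def)
  interpret polytope_facet K S using mesh_facet K SK by blast
  \<comment> \<open>a tangential direction that increases time\<close>
  define w where "w = (1, 0) - fst nu *\<^sub>R nu"
  have "nu \<bullet> w = 0"
    by (simp add: w_def inner_diff_right inner_prod_def[of _ "(1,0)"] nu_nu)
  then obtain e where e: "e > 0" "\<And>s. \<bar>s\<bar> \<le> e \<Longrightarrow> z + s *\<^sub>R w \<in> S" using tangent[OF z] by blast
  have "\<bar>fst nu\<bar> < 1" using S abs_fst_nu_le by (simp add: lateral_facets_def order.not_eq_order_implies_strict)
  then have "fst nu * fst nu < 1" using abs_square_less_1[of "fst nu"] by (simp add: power2_eq_square)
  then have w: "fst w > 0" by (simp add: w_def)
  have "z + e *\<^sub>R w \<in> K" "z + (- e) *\<^sub>R w \<in> K" using e(2)[of e] e(2)[of "- e"] e(1) S_sub by auto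
  then have "fst z + e * fst w \<le> tm D (Suc n)" "tm D n \<le> fst z - e * fst w"
    using mesh_times[OF K] by fastforce+
  then show "tm D n < fst z" "fst z < tm D (Suc n)" using mult_pos_pos[OF e(1) w] by linarith+
qed

text \<open>A lateral facet of a single element lies on the lateral boundary: the points just outside the element
  are in no other element, hence not in the slab, whose points are all covered.\<close>

lemma unshared_facet_boundary:
  assumes K: "K \<in> mesh D n" and S: "S \<in> lateral_facets K" and z: "z \<in> rel_interior S"
    and unshared: "\<And>K'. K' \<in> mesh D n \<Longrightarrow> S facet_of K' \<Longrightarrow> K' = K"
  shows "z \<in> slab_bdry D n"
proof -
  have SK: "S facet_of K" using S by (simp add: lateral_facets_def)
  interpret polytope_facet K S using mesh_facet K SK by blast
  have zS: "z \<in> S" using z rel_interior_subset by blast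
  note t = lateral_times[OF K S z]
  \<comment> \<open>a neighbourhood of \<open>z\<close> that meets no other element and stays between the two time levels\<close>
  define U where "U = - \<Union> (mesh D n - {K}) \<inter> {y. tm D n < fst y \<and> fst y < tm D (Suc n)}"
  have "z \<notin> K'" if K': "K' \<in> mesh D n - {K}" for K'
    using facet_of_neighbour[OF K _ _ SK z] unshared[of K'] K' by blast
  then have zU: "z \<in> U" using t by (auto simp: U_def)
  have "\<forall>T\<in>mesh D n - {K}. closed T"
    by (auto intro: solid_polytope.closed mesh_solid)
  then have "closed (\<Union> (mesh D n - {K}))"
    using finite_mesh by (intro closed_Union) auto
  then have "open (- \<Union> (mesh D n - {K}))" by (rule open_Compl)
  moreover have "open {y :: 'd spacetime. tm D n < fst y \<and> fst y < tm D (Suc n)}"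
    by (intro open_Collect_conj open_Collect_less continuous_intros)
  ultimately have "open U" unfolding U_def by (rule open_Int)
  have out: "y \<notin> st_domain D" if "y \<in> U" "y \<notin> K" for y
  proof
    assume "y \<in> st_domain D"
    then have "y \<in> slab D n" using that by (auto simp: slab_def U_def)
    then have "y \<in> \<Union> (mesh D n)" using mesh_Union closure_subset by blast
    then show False using that by (auto simp: U_def)
  qed
  have "z \<notin> interior (st_domain D)"
  proof
    assume "z \<in> interior (st_domain D)"
    then have "z \<in> U \<inter> interior (st_domain D)" using zU by blast
    moreover have "open (U \<inter> interior (st_domain D))" using \<open>open U\<close> by blast
    ultimately obtain e where e: "e > 0" "cball z e \<subseteq> U \<inter> interior (st_domain D)"
      using open_contains_cball by blast
    have "z + e *\<^sub>R nu \<in> cball z e" using e(1) norm_nu by (simp add: dist_norm)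
    then have "z + e *\<^sub>R nu \<in> U" "z + e *\<^sub>R nu \<in> st_domain D" using e(2) interior_subset by blast+
    then show False using out outside_element[OF zS e(1)] by blast
  qed
  moreover have "z \<in> closure (st_domain D)"
  proof -
    have "z \<in> closure (slab D n)" using zS S_sub K mesh_Union by blast
    then show ?thesis using closure_mono[of "slab D n" "st_domain D"] by (auto simp: slab_def)
  qed
  ultimately show ?thesis using t by (simp add: slab_bdry_def frontier_def)
qed

text \<open>A facet that belongs to two elements is counted twice, with opposite normals, and no facet belongs to
  three elements, since three unit vectors cannot be pairwise opposite.\<close>

lemma normal_sum_cancels:
  fixes I :: "'d spacetime set \<Rightarrow> real"
  assumes unshared: "\<And>K S. K \<in> mesh D n \<Longrightarrow> S \<in> lateral_facets K
    \<Longrightarrow> (\<And>K'. K' \<in> mesh D n \<Longrightarrow> S facet_of K' \<Longrightarrow> K' = K) \<Longrightarrow> I S = 0"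
  shows "(\<Sum>K\<in>mesh D n. \<Sum>S\<in>lateral_facets K. fst (outward_normal K S) * I S) = 0"
proof -
  have fin: "finite (lateral_facets K)" if "K \<in> mesh D n" for K
    using solid_polytope.finite_facets[OF mesh_solid[OF that]] by (simp add: lateral_facets_def)
  then have fs: "finite (skel D n)" using finite_mesh by (simp add: skel_def)
  have "(\<Sum>K\<in>mesh D n. \<Sum>S\<in>lateral_facets K. fst (outward_normal K S) * I S)
    = (\<Sum>K\<in>mesh D n. \<Sum>S | S \<in> skel D n \<and> S \<in> lateral_facets K. fst (outward_normal K S) * I S)"
    by (intro sum.cong refl) (auto simp: skel_def)
  also have "\<dots> = (\<Sum>S\<in>skel D n. \<Sum>K | K \<in> mesh D n \<and> S \<in> lateral_facets K. fst (outward_normal K S) * I S)"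
    by (rule sum.swap_restrict[OF finite_mesh fs])
  also have "\<dots> = 0"
  proof (rule sum.neutral, rule ballI)
    fix S assume "S \<in> skel D n"
    then obtain K where K: "K \<in> mesh D n" "S \<in> lateral_facets K" by (auto simp: skel_def)
    have SK: "S facet_of K" using K(2) by (simp add: lateral_facets_def)
    show "(\<Sum>K | K \<in> mesh D n \<and> S \<in> lateral_facets K. fst (outward_normal K S) * I S) = 0"
    proof (cases "\<exists>K'\<in>mesh D n. K' \<noteq> K \<and> S facet_of K'")
      case False
      then have "I S = 0" using unshared[OF K] by blast
      then show ?thesis by simp
    next
      case True
      then obtain K' where K': "K' \<in> mesh D n" "K' \<noteq> K" "S facet_of K'" by blast
      have opp: "outward_normal K' S = - outward_normal K S"
        using opposite_normals[OF K(1) K'(1) _ SK K'(3)] K'(2) by blast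
      interpret polytope_facet K S using mesh_facet K SK by blast
      have "{K \<in> mesh D n. S \<in> lateral_facets K} = {K, K'}"
      proof
        show "{K, K'} \<subseteq> {K \<in> mesh D n. S \<in> lateral_facets K}"
          using K K' opp by (auto simp: lateral_facets_def)
        show "{K \<in> mesh D n. S \<in> lateral_facets K} \<subseteq> {K, K'}"
        proof (rule ccontr)
          assume "\<not> ?thesis"
          then obtain L where L: "L \<in> mesh D n" "S facet_of L" "L \<noteq> K" "L \<noteq> K'"
            by (auto simp: lateral_facets_def)
          have "outward_normal L S = - outward_normal K S"
            using opposite_normals[OF K(1) L(1) _ SK L(2)] L by blast
          moreover have "outward_normal L S = - outward_normal K' S"
            using opposite_normals[OF K'(1) L(1) _ K'(3) L(2)] L by blast
          ultimately have "nu = - nu" using opp by simp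
          then have "nu + nu = nu + - nu" by metis
          then have "2 *\<^sub>R nu = 0" by (simp add: scaleR_2)
          then show False using norm_nu by auto
        qed
      qed
      then show ?thesis using K'(2) opp by simp
    qed
  qed
  finally show ?thesis .
qed

lemma tm_bounds: "0 \<le> tm D n" "tm D (Suc n) \<le> horizon D" "tm D n < tm D (Suc n)"
proof -
  have step: "\<And>j. j < slabs D \<Longrightarrow> tm D j < tm D (Suc j)" and t0: "tm D 0 = 0"
    and tN: "tm D (slabs D) = horizon D"
    using disc unfolding st_discretization_def by blast+
  show "tm D n < tm D (Suc n)" using step n by blast
  have "tm D 0 \<le> tm D j" if "j \<le> slabs D" for j
    using that
  proof (induction j)
    case (Suc j)
    then show ?case using step[of j] by simp
  qed simp
  then show "0 \<le> tm D n" using n t0 by simp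
  have "tm D (Suc n) \<le> tm D j" if "Suc n \<le> j" "j \<le> slabs D" for j
    using that
  proof (induction j rule: dec_induct)
    case (step j)
    then show ?case using \<open>\<And>j. j < slabs D \<Longrightarrow> tm D j < tm D (Suc j)\<close>[of j] by simp
  qed simp
  then show "tm D (Suc n) \<le> horizon D" using n tN by (metis Suc_leI order_refl)
qed

lemma slab_bdry_cases: "z \<in> slab_bdry D n \<Longrightarrow> z \<in> dirichlet D \<or> z \<in> neumann D"
proof -
  assume z: "z \<in> slab_bdry D n"
  have "frontier (st_domain D) = dirichlet D \<union> neumann D \<union> {0} \<times> Omega D 0 \<union> {horizon D} \<times> Omega D (horizon D)"
    using disc unfolding st_discretization_def boundary_partition_def by (simp add: Let_def)
  then show ?thesis using z tm_bounds by (auto simp: slab_bdry_def)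
qed

text \<open>The Neumann boundary integrals are taken over this set. It may meet facets shared by two elements, if the domain has
  a crack along them.\<close>

definition neumann_part :: "'d spacetime set"
  where "neumann_part = neumann D \<inter> slab_bdry D n"

lemma neumann_part_borel: "neumann_part \<in> sets borel"
proof -
  have N: "neumann D \<in> sets borel"
    using disc unfolding st_discretization_def boundary_partition_def by (simp add: Let_def)
  have t: "open {z :: 'd spacetime. tm D n < fst z \<and> fst z < tm D (Suc n)}"
    by (intro open_Collect_conj open_Collect_less continuous_intros)
  have eq: "slab_bdry D n = frontier (st_domain D) \<inter> {z. tm D n < fst z \<and> fst z < tm D (Suc n)}"
    by (auto simp: slab_bdry_def)
  show ?thesis
    unfolding neumann_part_def eq by (intro sets.Int N borel_open[OF t] borel_closed frontier_closed)
qed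

text \<open>By Hausdorff continuity of the moving domain, each point at an end of the slab is a limit of points
  inside the slab, and the elements cover the closure of the slab.\<close>

lemma Omega_covered:
  assumes t: "t = tm D n \<or> t = tm D (Suc n)" and x: "x \<in> Omega D t"
  shows "(t, x) \<in> \<Union> (mesh D n)"
proof -
  have md: "moving_domain (horizon D) (Omega D)"
    using disc unfolding st_discretization_def by blast
  have tT: "t \<in> {0..horizon D}" using t tm_bounds by auto
  have "\<exists>y\<in>slab D n. dist y (t, x) < e" if e: "e > 0" for e
  proof -
    from conjunct2[OF md[unfolded moving_domain_def], rule_format, OF tT half_gt_zero[OF e]]
    obtain d where d: "d > 0" "\<forall>s\<in>{0..horizon D}. \<bar>s - t\<bar> < d \<longrightarrow>
        Omega D s \<subseteq> (\<Union>x\<in>Omega D t. ball x (e / 2)) \<and> Omega D t \<subseteq> (\<Union>x\<in>Omega D s. ball x (e / 2))"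
      by (elim exE conjE)
    define r where "r = min (min d (e / 2)) (tm D (Suc n) - tm D n) / 2"
    have r: "r > 0" "r < d" "r < e / 2" "r < tm D (Suc n) - tm D n"
      using d(1) e tm_bounds by (auto simp: r_def min_def)
    obtain s where s: "\<bar>s - t\<bar> = r" "tm D n < s" "s < tm D (Suc n)"
    proof (cases "t = tm D n")
      case True
      then show ?thesis using that[of "t + r"] r by auto
    next
      case False
      then show ?thesis using that[of "t - r"] r t by auto
    qed
    have "s \<in> {0..horizon D}" using s tm_bounds by auto
    then have "Omega D t \<subseteq> (\<Union>x\<in>Omega D s. ball x (e / 2))" using d(2) s(1) r(2) by simp
    then obtain y where y: "y \<in> Omega D s" "dist y x < e / 2" using x by (auto simp: subset_iff)
    have "(s, y) \<in> slab D n" using s y tm_bounds by (auto simp: slab_def st_domain_def)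
    moreover have "dist (s, y) (t, x) < e"
    proof -
      have "dist (s, y) (t, x) \<le> dist s t + dist y x"
        unfolding dist_prod_def by (simp add: sqrt_sum_squares_le_sum)
      then show ?thesis using s(1) r(3) y(2) by (simp add: dist_real_def)
    qed
    ultimately show ?thesis by blast
  qed
  then have "(t, x) \<in> closure (slab D n)" by (simp add: closure_approachable)
  then show ?thesis using mesh_Union by simp
qed

end

section \<open>Traces at the bottom and the top of a slab\<close>

text \<open>A function that almost everywhere agrees with continuous functions on finitely many compact pieces covering
  \<open>Om\<close> is square-integrable on \<open>Om\<close>. The pieces may overlap or stick out of \<open>Om\<close>, whence an inequality.\<close>

lemma piecewise_L2:
  fixes G :: "'a::euclidean_space \<Rightarrow> 'b::euclidean_space" and g :: "'i \<Rightarrow> 'a \<Rightarrow> 'b"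
  assumes Om: "Om \<in> sets lebesgue" and J: "finite J"
    and C: "\<And>j. j \<in> J \<Longrightarrow> compact (C j)" and g: "\<And>j. j \<in> J \<Longrightarrow> continuous_on UNIV (g j)"
    and cover: "AE x in lebesgue. x \<in> Om \<longrightarrow> (\<exists>j\<in>J. x \<in> C j)"
    and eq: "AE x in lebesgue. \<forall>j\<in>J. x \<in> C j \<longrightarrow> G x = g j x"
  shows "(\<lambda>x. indicator Om x *\<^sub>R G x) \<in> borel_measurable lebesgue"
    and "set_integrable lebesgue Om (\<lambda>x. (norm (G x))\<^sup>2)"
    and "(LINT x:Om|lebesgue. (norm (G x))\<^sup>2) \<le> (\<Sum>j\<in>J. LINT x:C j|lebesgue. (norm (g j x))\<^sup>2)"
proof -
  have "AE x in lebesgue. (x \<in> Om \<longrightarrow> (\<exists>j\<in>J. x \<in> C j)) \<and> (\<forall>j\<in>J. x \<in> C j \<longrightarrow> G x = g j x)"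
    using cover eq by eventually_elim blast
  then obtain N where N: "{x \<in> space lebesgue. \<not> ((x \<in> Om \<longrightarrow> (\<exists>j\<in>J. x \<in> C j)) \<and> (\<forall>j\<in>J. x \<in> C j \<longrightarrow> G x = g j x))} \<subseteq> N"
      "N \<in> sets lebesgue" "emeasure lebesgue N = 0"
    by (rule AE_E)
  have good: "\<exists>j\<in>J. x \<in> C j" if "x \<in> Om" "x \<notin> N" for x using N(1) that by auto
  have good2: "G x = g j x" if "j \<in> J" "x \<in> C j" "x \<notin> N" for x j using N(1) that by auto
  define F where "F = (\<lambda>x. if x \<in> N then 0 else indicator Om x *\<^sub>R G x)"
  have gm: "g j \<in> borel_measurable lebesgue" if "j \<in> J" for j
    using measurable_completion[of "g j" lborel borel] borel_measurable_continuous_onI[OF g[OF that]] by simp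
  have Cl: "C j \<in> sets lebesgue" if "j \<in> J" for j
    using C[OF that] by (simp add: borel_compact)
  have Fm: "F \<in> borel_measurable lebesgue"
  proof (rule measurable_piecewise_restrict)
    let ?P = "insert N (insert (- Om - N) ((\<lambda>j. Om \<inter> C j - N) ` J))"
    show "countable ?P" using J by (simp add: countable_finite)
    show "space lebesgue \<subseteq> \<Union> ?P" using good by auto
    fix X assume X: "X \<in> ?P"
    have "Om \<inter> C j - N \<in> sets lebesgue" if "j \<in> J" for j
      using Om N(2) Cl[OF that] by blast
    moreover have "- Om - N \<in> sets lebesgue"
      using sets.compl_sets[OF Om] N(2) by (auto simp: Compl_eq_Diff_UNIV)
    ultimately show "X \<inter> space lebesgue \<in> sets lebesgue" using X N(2) by auto
    have "\<exists>h\<in>borel_measurable lebesgue. \<forall>x\<in>X. F x = h x"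
    proof (cases "X = N \<or> X = - Om - N")
      case True
      then have "\<forall>x\<in>X. F x = 0" by (auto simp: F_def)
      then show ?thesis by (intro bexI[of _ "\<lambda>_. 0"]) auto
    next
      case False
      then obtain j where j: "j \<in> J" "X = Om \<inter> C j - N" using X by auto
      then have "\<forall>x\<in>X. F x = g j x" using good2[OF j(1)] by (auto simp: F_def)
      then show ?thesis using gm[OF j(1)] by blast
    qed
    then obtain h where h: "h \<in> borel_measurable lebesgue" "\<forall>x\<in>X. F x = h x" by blast
    have "h \<in> borel_measurable (restrict_space lebesgue X)" using h(1) by (rule measurable_restrict_space1)
    moreover have "F x = h x" if "x \<in> space (restrict_space lebesgue X)" for x
      using that h(2) by (simp add: space_restrict_space)
    ultimately show "F \<in> borel_measurable (restrict_space lebesgue X)"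
      using measurable_cong[of "restrict_space lebesgue X" F h] by blast
  qed
  have "N \<in> null_sets lebesgue" using N by (simp add: null_sets_def)
  then have aeN: "AE x in lebesgue. x \<notin> N" by (rule AE_not_in)
  have aeF: "AE x in lebesgue. F x = indicator Om x *\<^sub>R G x"
    using aeN by eventually_elim (simp add: F_def)
  show m: "(\<lambda>x. indicator Om x *\<^sub>R G x) \<in> borel_measurable lebesgue"
    by (rule borel_measurable_AE[OF Fm aeF])
  have i: "set_integrable lebesgue (C j) (\<lambda>x. (norm (g j x))\<^sup>2)" if "j \<in> J" for j
  proof (rule set_integrable_continuous_compact[OF C[OF that]])
    show "continuous_on (C j) (\<lambda>x. (norm (g j x))\<^sup>2)"
      by (intro continuous_intros continuous_on_subset[OF g[OF that]]) auto
  qed (use C[OF that] in \<open>auto intro: borel_compact\<close>)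
  have bound: "AE x in lebesgue. indicator Om x *\<^sub>R (norm (G x))\<^sup>2 \<le> (\<Sum>j\<in>J. indicator (C j) x *\<^sub>R (norm (g j x))\<^sup>2)"
    using aeN
  proof eventually_elim
    case (elim x)
    show ?case
    proof (cases "x \<in> Om")
      case True
      then obtain j where j: "j \<in> J" "x \<in> C j" using good elim by blast
      then have "indicator Om x *\<^sub>R (norm (G x))\<^sup>2 = indicator (C j) x *\<^sub>R (norm (g j x))\<^sup>2"
        using True good2 elim by simp
      also have "\<dots> \<le> (\<Sum>j\<in>J. indicator (C j) x *\<^sub>R (norm (g j x))\<^sup>2)"
        by (rule member_le_sum[OF j(1)]) (use J in auto)
      finally show ?thesis .
    qed (simp add: sum_nonneg)
  qed
  have ir: "integrable lebesgue (\<lambda>x. \<Sum>j\<in>J. indicator (C j) x *\<^sub>R (norm (g j x))\<^sup>2)"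
    using i unfolding set_integrable_def by (rule Bochner_Integration.integrable_sum)
  have "(\<lambda>x. (norm (indicator Om x *\<^sub>R G x))\<^sup>2) \<in> borel_measurable lebesgue"
    using measurable_compose[OF m borel_measurable_norm] by (rule borel_measurable_power)
  moreover have "(\<lambda>x. (norm (indicator Om x *\<^sub>R G x))\<^sup>2) = (\<lambda>x. indicator Om x *\<^sub>R (norm (G x))\<^sup>2)"
    by (auto simp: indicator_def)
  ultimately have m2: "(\<lambda>x. indicator Om x *\<^sub>R (norm (G x))\<^sup>2) \<in> borel_measurable lebesgue" by simp
  have il: "integrable lebesgue (\<lambda>x. indicator Om x *\<^sub>R (norm (G x))\<^sup>2)"
  proof (rule Bochner_Integration.integrable_bound[OF ir m2])
    show "AE x in lebesgue. norm (indicator Om x *\<^sub>R (norm (G x))\<^sup>2)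
        \<le> norm (\<Sum>j\<in>J. indicator (C j) x *\<^sub>R (norm (g j x))\<^sup>2)"
      using bound by eventually_elim (simp add: order_trans[OF _ abs_ge_self])
  qed
  then show "set_integrable lebesgue Om (\<lambda>x. (norm (G x))\<^sup>2)" by (simp add: set_integrable_def)
  have "(LINT x:Om|lebesgue. (norm (G x))\<^sup>2) \<le> (LINT x|lebesgue. (\<Sum>j\<in>J. indicator (C j) x *\<^sub>R (norm (g j x))\<^sup>2))"
    unfolding set_lebesgue_integral_def by (rule integral_mono_AE[OF il ir bound])
  also have "\<dots> = (\<Sum>j\<in>J. LINT x:C j|lebesgue. (norm (g j x))\<^sup>2)"
    using i unfolding set_integrable_def set_lebesgue_integral_def by (rule Bochner_Integration.integral_sum)
  finally show "(LINT x:Om|lebesgue. (norm (G x))\<^sup>2) \<le> (\<Sum>j\<in>J. LINT x:C j|lebesgue. (norm (g j x))\<^sup>2)" .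
qed

context space_time_slab
begin

lemma V_h_fields:
  assumes "v \<in> V_h k D n"
  obtains P where "\<And>K. K \<in> mesh D n \<Longrightarrow> poly_field k (P K)"
    and "\<And>K z. K \<in> mesh D n \<Longrightarrow> z \<in> interior K \<Longrightarrow> v z = P K z"
proof -
  have "\<exists>Q. poly_field k Q \<and> (\<forall>z\<in>interior K. v z = Q z)" if K: "K \<in> mesh D n" for K
  proof -
    have "\<forall>i. \<exists>p. p \<in> poly_upto k \<and> (\<forall>z\<in>interior K. v z $ i = p z)"
      using assms K unfolding V_h_def by blast
    from choice[OF this] obtain p where "\<forall>i. p i \<in> poly_upto k \<and> (\<forall>z\<in>interior K. v z $ i = p i z)" ..
    then show ?thesis
      by (intro exI[of _ "\<lambda>z. \<chi> i. p i z"]) (simp add: poly_field_def vec_eq_iff)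
  qed
  then have "\<forall>K\<in>mesh D n. \<exists>Q. poly_field k Q \<and> (\<forall>z\<in>interior K. v z = Q z)" by blast
  from bchoice[OF this] obtain P where "\<forall>K\<in>mesh D n. poly_field k (P K) \<and> (\<forall>z\<in>interior K. v z = P K z)" ..
  then show ?thesis using that by blast
qed

text \<open>Both ends of the slab are treated together: \<open>\<tau> = 1\<close> is the top of the slab and \<open>\<tau> = -1\<close> the bottom.\<close>

definition level :: "real \<Rightarrow> real"
  where "level \<tau> = (if \<tau> > 0 then tm D (Suc n) else tm D n)"

definition end_trace :: "real \<Rightarrow> 'd field \<Rightarrow> real^'d \<Rightarrow> real^'d"
  where "end_trace \<tau> v x = (if \<tau> > 0 then trace_below v (level \<tau>) x else trace_above v (level \<tau>) x)"

text \<open>A facet with \<open>n\<^sub>t = \<tau>\<close> may also lie strictly inside the slab, so the time level is prescribed.\<close>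

definition end_facets :: "real \<Rightarrow> ('d spacetime set \<times> 'd spacetime set) set"
  where "end_facets \<tau> = {(K, S). K \<in> mesh D n \<and> S facet_of K \<and> fst (outward_normal K S) = \<tau>
    \<and> (\<forall>z\<in>S. fst z = level \<tau>)}"

lemma finite_end_facets: "finite (end_facets \<tau>)"
proof -
  have "end_facets \<tau> \<subseteq> Sigma (mesh D n) (\<lambda>K. {S. S facet_of K})"
    by (auto simp: end_facets_def)
  moreover have "finite (Sigma (mesh D n) (\<lambda>K. {S. S facet_of K}))"
    using finite_mesh solid_polytope.finite_facets[OF mesh_solid] by (intro finite_SigmaI) auto
  ultimately show ?thesis by (rule finite_subset)
qed

lemma level_interior:
  assumes "\<bar>\<tau>\<bar> = 1" "K \<in> mesh D n" "z \<in> interior K"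
  shows "\<tau> * fst z < \<tau> * level \<tau>"
  using mesh_interior[OF assms(2)] assms by (auto simp: level_def slab_def abs_if split: if_splits)

text \<open>The vertical segment from an interior point of the element to its point at the end of the slab stays
  in the interior, so the one-sided limit in time is the value of the polynomial of that element.\<close>

lemma end_trace_eq:
  fixes P v :: "'d field"
  assumes \<tau>: "\<bar>\<tau>\<bar> = 1" and K: "K \<in> mesh D n" and P: "continuous_on UNIV P"
    and eq: "\<And>z. z \<in> interior K \<Longrightarrow> v z = P z"
    and x: "(level \<tau>, x) \<in> K" and t0: "(t0, x) \<in> interior K"
  shows "end_trace \<tau> v x = P (level \<tau>, x)"
proof -
  interpret solid_polytope K by (rule mesh_solid[OF K])
  have seg: "(s, x) \<in> interior K" if "s \<in> open_segment t0 (level \<tau>)" for s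
  proof -
    have *: "t0 \<noteq> level \<tau> \<and> (\<exists>u. 0 < u \<and> u < 1 \<and> s = (1 - u) *\<^sub>R t0 + u *\<^sub>R level \<tau>)"
      using that unfolding in_segment .
    from conjunct2[OF this] obtain u where u: "0 < u \<and> u < 1 \<and> s = (1 - u) *\<^sub>R t0 + u *\<^sub>R level \<tau>" ..
    have "(1 - u) *\<^sub>R x + u *\<^sub>R x = x" by (simp add: algebra_simps)
    then have "(s, x) = (1 - u) *\<^sub>R (t0, x) + u *\<^sub>R (level \<tau>, x)" using u by simp
    then have "(s, x) \<in> open_segment (t0, x) (level \<tau>, x)"
      unfolding in_segment using u * by (intro conjI exI[of _ u]) auto
    then show ?thesis
      using in_interior_closure_convex_segment[OF convex t0, of "(level \<tau>, x)"] x closure_subset by blast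
  qed
  have lt: "\<tau> * t0 < \<tau> * level \<tau>" using level_interior[OF \<tau> K t0] by simp
  have lim: "(\<lambda>s. P (s, x)) \<midarrow>level \<tau>\<rightarrow> P (level \<tau>, x)"
  proof -
    have "continuous_on UNIV (\<lambda>s. P (s, x))"
      by (rule continuous_on_compose2[OF P]) (auto intro!: continuous_intros)
    then show ?thesis by (simp add: continuous_on_eq_continuous_at isCont_def)
  qed
  show ?thesis
  proof (cases "\<tau> > 0")
    case True
    then have t: "t0 < level \<tau>" using lt by simp
    have "((\<lambda>s. v (s, x)) \<longlongrightarrow> P (level \<tau>, x)) (at_left (level \<tau>))"
    proof (rule Lim_transform_eventually)
      show "((\<lambda>s. P (s, x)) \<longlongrightarrow> P (level \<tau>, x)) (at_left (level \<tau>))"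
        using lim by (rule tendsto_within_subset) simp
      show "\<forall>\<^sub>F s in at_left (level \<tau>). P (s, x) = v (s, x)"
        using eventually_at_left[OF t] seg eq t by (auto simp: open_segment_eq_real_ivl intro!: exI[of _ t0])
    qed
    then show ?thesis
      using True by (simp add: end_trace_def trace_below_def tendsto_Lim)
  next
    case False
    then have t: "level \<tau> < t0" using lt \<tau> by (auto simp: mult_less_cancel_left)
    have "((\<lambda>s. v (s, x)) \<longlongrightarrow> P (level \<tau>, x)) (at_right (level \<tau>))"
    proof (rule Lim_transform_eventually)
      show "((\<lambda>s. P (s, x)) \<longlongrightarrow> P (level \<tau>, x)) (at_right (level \<tau>))"
        using lim by (rule tendsto_within_subset) simp
      show "\<forall>\<^sub>F s in at_right (level \<tau>). P (s, x) = v (s, x)"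
        using eventually_at_right[OF t] seg eq t by (auto simp: open_segment_eq_real_ivl intro!: exI[of _ t0])
    qed
    then show ?thesis
      using False by (simp add: end_trace_def trace_above_def tendsto_Lim)
  qed
qed

text \<open>A facet with \<open>n \<noteq> 0\<close> meets a time level in a part of a hyperplane of space, which is a null set.\<close>

lemma AE_off_slanted_facets:
  "AE x in lebesgue. (\<forall>K\<in>mesh D n. x \<notin> frontier (snd ` K)) \<and>
    (\<forall>K\<in>mesh D n. \<forall>S. S facet_of K \<longrightarrow> snd (outward_normal K S) \<noteq> 0 \<longrightarrow> (t, x) \<notin> S)"
proof -
  have null: "AE x in lebesgue. x \<notin> N" if "negligible N" for N :: "(real^'d) set"
    using that AE_not_in negligible_iff_null_sets by blast
  have 1: "AE x in lebesgue. \<forall>K\<in>mesh D n. x \<notin> frontier (snd ` K)"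
  proof (subst AE_finite_all[OF finite_mesh], rule ballI)
    fix K assume "K \<in> mesh D n"
    then have "convex (snd ` K)"
      using solid_polytope.convex[OF mesh_solid] convex_linear_image[OF linear_snd] by blast
    then show "AE x in lebesgue. x \<notin> frontier (snd ` K)"
      using null negligible_convex_frontier by blast
  qed
  have 2: "AE x in lebesgue. \<forall>K\<in>mesh D n. \<forall>S\<in>{S. S facet_of K}. snd (outward_normal K S) \<noteq> 0 \<longrightarrow> (t, x) \<notin> S"
  proof (subst AE_finite_all[OF finite_mesh], rule ballI)
    fix K assume K: "K \<in> mesh D n"
    show "AE x in lebesgue. \<forall>S\<in>{S. S facet_of K}. snd (outward_normal K S) \<noteq> 0 \<longrightarrow> (t, x) \<notin> S"
    proof (subst AE_finite_all[OF solid_polytope.finite_facets[OF mesh_solid[OF K]]], rule ballI)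
      fix S assume "S \<in> {S. S facet_of K}"
      then interpret polytope_facet K S using mesh_facet[OF K] by blast
      show "AE x in lebesgue. snd nu \<noteq> 0 \<longrightarrow> (t, x) \<notin> S"
      proof (cases "snd nu = 0")
        case False
        then have "AE x in lebesgue. x \<notin> {x. snd nu \<bullet> x = offset - fst nu * t}"
          by (intro null negligible_hyperplane) simp
        then show ?thesis
          by eventually_elim (use S_offset in \<open>force simp: inner_prod_def\<close>)
      qed simp
    qed
  qed
  show ?thesis using 1 2 by eventually_elim blast
qed

text \<open>Elements do not reach beyond the end of the slab, so the vertical line through an interior point leaves
  the element at the end. It does so through a facet with \<open>n = 0\<close>, that is, a horizontal one.\<close>

lemma level_facet:
  assumes \<tau>: "\<bar>\<tau>\<bar> = 1" and K: "K \<in> mesh D n" and x: "(level \<tau>, x) \<in> K"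
    and good: "x \<notin> frontier (snd ` K)"
      "\<And>S. S facet_of K \<Longrightarrow> snd (outward_normal K S) \<noteq> 0 \<Longrightarrow> (level \<tau>, x) \<notin> S"
  shows "\<exists>t0. (t0, x) \<in> interior K" and "\<exists>S. (K, S) \<in> end_facets \<tau> \<and> (level \<tau>, x) \<in> S"
proof -
  interpret solid_polytope K by (rule mesh_solid[OF K])
  have "closed (snd ` K)"
    using compact by (intro compact_imp_closed compact_continuous_image continuous_intros)
  moreover have "x \<in> snd ` K" using x by force
  ultimately have "x \<in> interior (snd ` K)" using good(1) not_frontier_imp_interior by blast
  then obtain t0 where t0: "(t0, x) \<in> interior K" using interior_fibre by blast
  then show "\<exists>t0. (t0, x) \<in> interior K" by blast
  have lt: "\<tau> * t0 < \<tau> * level \<tau>" using level_interior[OF \<tau> K t0] by simp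
  have "(level \<tau>, x) \<notin> interior K" using level_interior[OF \<tau> K] by fastforce
  then have "(level \<tau>, x) \<in> K - rel_interior K"
    using x interior_rel_interior_gen[of K] solid rel_interior_nonempty_interior by blast
  then obtain S where S: "S facet_of K" "(level \<tau>, x) \<in> S"
    using rel_boundary_of_polyhedron[OF polytope_imp_polyhedron[OF polytope]] by blast
  interpret S: polytope_facet K S by (rule facetI[OF S(1)])
  have s0: "snd S.nu = 0" using good(2)[OF S(1)] S(2) by blast
  then have a: "\<bar>fst S.nu\<bar> = 1" using S.snd_nu_zero by blast
  have "S.nu \<bullet> (t0, x) < S.nu \<bullet> (level \<tau>, x)" using S.interior_lt[OF t0] S.S_offset[OF S(2)] by simp
  then have "fst S.nu * t0 < fst S.nu * level \<tau>" by (simp add: inner_prod_def s0)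
  then have f: "fst S.nu = \<tau>" using a \<tau> lt by (auto simp: abs_if split: if_splits)
  have "fst z = level \<tau>" if "z \<in> S" for z
  proof -
    have "fst S.nu * fst z = fst S.nu * level \<tau>"
      using S.S_offset[OF that] S.S_offset[OF S(2)] by (simp add: inner_prod_def s0)
    then show ?thesis using a by auto
  qed
  then show "\<exists>S. (K, S) \<in> end_facets \<tau> \<and> (level \<tau>, x) \<in> S"
    using K S f by (intro exI[of _ S]) (simp add: end_facets_def)
qed

lemma Omega_open: "\<bar>\<tau>\<bar> = 1 \<Longrightarrow> open (Omega D (level \<tau>))"
  using disc tm_bounds unfolding st_discretization_def moving_domain_def
  by (auto simp: level_def)

text \<open>Almost all of the spatial domain at an end of the slab is covered by projections of horizontal facets
  at that time level, on which the trace in time is the trace from the element. Horizontal facets inside the slab only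
  increase the right-hand side.\<close>

lemma end_trace_L2:
  assumes \<tau>: "\<bar>\<tau>\<bar> = 1" and v: "v \<in> V_h k D n"
  shows "(\<lambda>x. indicator (Omega D (level \<tau>)) x *\<^sub>R end_trace \<tau> v x) \<in> borel_measurable lebesgue"
    and "set_integrable lebesgue (Omega D (level \<tau>)) (\<lambda>x. (norm (end_trace \<tau> v x))\<^sup>2)"
    and "(LINT x:Omega D (level \<tau>)|lebesgue. (norm (end_trace \<tau> v x))\<^sup>2)
      \<le> (\<Sum>K\<in>mesh D n. \<Sum>S | S facet_of K \<and> fst (outward_normal K S) = \<tau>.
          surf_int S UNIV (\<lambda>z. tr K v z \<bullet> tr K v z))"
proof -
  obtain P where P: "\<And>K. K \<in> mesh D n \<Longrightarrow> poly_field k (P K)"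
    and Pv: "\<And>K z. K \<in> mesh D n \<Longrightarrow> z \<in> interior K \<Longrightarrow> v z = P K z"
    using V_h_fields[OF v] by blast
  let ?Om = "Omega D (level \<tau>)"
  let ?C = "\<lambda>j :: 'd spacetime set \<times> 'd spacetime set. snd ` snd j"
  let ?g = "\<lambda>j :: 'd spacetime set \<times> 'd spacetime set. \<lambda>x. P (fst j) (level \<tau>, x)"
  have facet: "polytope_facet K S" if "(K, S) \<in> end_facets \<tau>" for K S
    using that mesh_facet by (auto simp: end_facets_def)
  have Om: "?Om \<in> sets lebesgue" using Omega_open[OF \<tau>] by simp
  have C: "compact (?C j)" if "j \<in> end_facets \<tau>" for j
    using facet[of "fst j" "snd j"] that polytope_facet.compact_snd_S by auto
  have g: "continuous_on UNIV (?g j)" if "j \<in> end_facets \<tau>" for j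
  proof -
    have "fst j \<in> mesh D n" using that by (auto simp: end_facets_def)
    then have "continuous_on UNIV (P (fst j))" using P continuous_poly_field by blast
    then show ?thesis by (rule continuous_on_compose2) (auto intro!: continuous_intros)
  qed
  have lev: "(level \<tau>, x) \<in> S \<longleftrightarrow> x \<in> snd ` S" if "(K, S) \<in> end_facets \<tau>" for K S x
  proof
    assume "x \<in> snd ` S"
    then obtain z where "z \<in> S" "x = snd z" by blast
    moreover have "fst z = level \<tau>" using calculation that by (auto simp: end_facets_def)
    ultimately show "(level \<tau>, x) \<in> S" by (metis prod.collapse)
  qed force
  have cover: "AE x in lebesgue. x \<in> ?Om \<longrightarrow> (\<exists>j\<in>end_facets \<tau>. x \<in> ?C j)"
    using AE_off_slanted_facets[of "level \<tau>"]
  proof eventually_elim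
    case (elim x)
    show ?case
    proof
      assume "x \<in> ?Om"
      then obtain K where K: "K \<in> mesh D n" "(level \<tau>, x) \<in> K"
        using Omega_covered[of "level \<tau>" x] by (auto simp: level_def split: if_splits)
      obtain S where S: "(K, S) \<in> end_facets \<tau>" "(level \<tau>, x) \<in> S"
        using level_facet(2)[OF \<tau> K] elim K(1) by blast
      then have "x \<in> ?C (K, S)" using lev by auto
      then show "\<exists>j\<in>end_facets \<tau>. x \<in> ?C j" using S(1) by blast
    qed
  qed
  have eq: "AE x in lebesgue. \<forall>j\<in>end_facets \<tau>. x \<in> ?C j \<longrightarrow> end_trace \<tau> v x = ?g j x"
    using AE_off_slanted_facets[of "level \<tau>"]
  proof eventually_elim
    case (elim x)
    have "end_trace \<tau> v x = P K (level \<tau>, x)" if j: "(K, S) \<in> end_facets \<tau>" "x \<in> snd ` S" for K S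
    proof -
      have K: "K \<in> mesh D n" using j by (simp add: end_facets_def)
      have x: "(level \<tau>, x) \<in> K"
        using lev[OF j(1)] j(2) polytope_facet.S_sub[OF facet[OF j(1)]] by blast
      obtain t0 where t0: "(t0, x) \<in> interior K" using level_facet(1)[OF \<tau> K x] elim K by blast
      show ?thesis
        by (rule end_trace_eq[OF \<tau> K continuous_poly_field[OF P[OF K]] Pv[OF K] x t0])
    qed
    from this[of "fst j" "snd j" for j] show ?case by simp
  qed
  note L2 = piecewise_L2[OF Om finite_end_facets C g cover eq]
  show "(\<lambda>x. indicator ?Om x *\<^sub>R end_trace \<tau> v x) \<in> borel_measurable lebesgue"
    and "set_integrable lebesgue ?Om (\<lambda>x. (norm (end_trace \<tau> v x))\<^sup>2)"
    using L2(1,2) by blast+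
  have tr: "tr K v z = P K z" if "K \<in> mesh D n" "z \<in> K" for K z
    by (rule solid_polytope.tr_eq[OF mesh_solid[OF that(1)] Pv[OF that(1)] continuous_poly_field[OF P[OF that(1)]] that(2)])
  have surf: "surf_int S UNIV (\<lambda>z. tr K v z \<bullet> tr K v z) = surf_int S UNIV (\<lambda>z. P K z \<bullet> P K z)"
    if "K \<in> mesh D n" "S facet_of K" for K S
  proof -
    have "S \<subseteq> K" using that(2) by (rule facet_of_imp_subset)
    then have "tr K v (chart S y) = P K (chart S y)" if "y \<in> chart S -` S" for y
      using tr that \<open>K \<in> mesh D n\<close> by blast
    then show ?thesis
      unfolding surf_int_def set_lebesgue_integral_def
      by (intro Bochner_Integration.integral_cong) (auto simp: indicator_def)
  qed
  have nonneg: "0 \<le> surf_int S UNIV (\<lambda>z. tr K v z \<bullet> tr K v z)" for K S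
    unfolding surf_int_def set_lebesgue_integral_def by (intro integral_nonneg_AE AE_I2) simp
  have proj: "(LINT x:?C (K, S)|lebesgue. (norm (?g (K, S) x))\<^sup>2) = surf_int S UNIV (\<lambda>z. tr K v z \<bullet> tr K v z)"
    if j: "(K, S) \<in> end_facets \<tau>" for K S
  proof -
    interpret polytope_facet K S by (rule facet[OF j])
    have K: "K \<in> mesh D n" and n: "fst nu = \<tau>" using j by (auto simp: end_facets_def)
    have nz: "fst nu \<noteq> 0" using n \<tau> by auto
    have c: "continuous_on UNIV (\<lambda>z. P K z \<bullet> P K z)"
      by (intro continuous_intros continuous_poly_field[OF P[OF K]])
    have h: "height x = level \<tau>" if "x \<in> snd ` S" for x
      using height_S[OF nz that] j by (auto simp: end_facets_def)
    have sb: "snd ` S \<in> sets lebesgue" using compact_snd_S by (simp add: borel_compact)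
    have "(LINT x:snd ` S|lebesgue. (norm (P K (level \<tau>, x)))\<^sup>2) = (LINT x:snd ` S|lebesgue. P K (height x, x) \<bullet> P K (height x, x))"
      by (rule set_lebesgue_integral_cong[OF sb]) (simp add: h power2_norm_eq_inner)
    also have "\<dots> = surf_int S UNIV (\<lambda>z. P K z \<bullet> P K z)"
      using projection[OF nz c] n \<tau> by simp
    finally show ?thesis using surf[OF K facet] by simp
  qed
  have "(LINT x:?Om|lebesgue. (norm (end_trace \<tau> v x))\<^sup>2)
      \<le> (\<Sum>j\<in>end_facets \<tau>. LINT x:?C j|lebesgue. (norm (?g j x))\<^sup>2)" using L2(3) by simp
  also have "\<dots> = (\<Sum>(K, S)\<in>end_facets \<tau>. surf_int S UNIV (\<lambda>z. tr K v z \<bullet> tr K v z))"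
    using proj by (intro sum.cong) auto
  also have "\<dots> \<le> (\<Sum>(K, S)\<in>Sigma (mesh D n) (\<lambda>K. {S. S facet_of K \<and> fst (outward_normal K S) = \<tau>}).
      surf_int S UNIV (\<lambda>z. tr K v z \<bullet> tr K v z))"
  proof (rule sum_mono2)
    show "finite (Sigma (mesh D n) (\<lambda>K. {S. S facet_of K \<and> fst (outward_normal K S) = \<tau>}))"
      using finite_mesh solid_polytope.finite_facets[OF mesh_solid] by (intro finite_SigmaI) auto
  qed (use nonneg in \<open>auto simp: end_facets_def\<close>)
  also have "\<dots> = (\<Sum>K\<in>mesh D n. \<Sum>S | S facet_of K \<and> fst (outward_normal K S) = \<tau>.
          surf_int S UNIV (\<lambda>z. tr K v z \<bullet> tr K v z))"
    using finite_mesh solid_polytope.finite_facets[OF mesh_solid] by (intro sum.Sigma[symmetric]) auto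
  finally show "(LINT x:?Om|lebesgue. (norm (end_trace \<tau> v x))\<^sup>2)
      \<le> (\<Sum>K\<in>mesh D n. \<Sum>S | S facet_of K \<and> fst (outward_normal K S) = \<tau>.
          surf_int S UNIV (\<lambda>z. tr K v z \<bullet> tr K v z))" .
qed

end

section \<open>The energy of a discrete velocity\<close>

locale discrete_velocity = space_time_slab D n
  for D :: "('d::finite) setting" and n +
  fixes k :: nat and u ub :: "'d field"
  assumes u: "u \<in> V_h k D n" and ub: "ub \<in> Vbar_h k D n"
begin

lemma element_field:
  assumes K: "K \<in> mesh D n"
  shows "\<exists>P. poly_field k P
    \<and> (\<forall>z\<in>interior K. u z = P z \<and> sgrad u z = sgrad P z \<and> dt u z = dt P z)
    \<and> (\<forall>z\<in>K. tr K u z = P z \<and> tr K (sgrad u) z = sgrad P z)"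
proof -
  interpret solid_polytope K by (rule mesh_solid[OF K])
  obtain Q where Q: "\<And>K. K \<in> mesh D n \<Longrightarrow> poly_field k (Q K)"
      "\<And>K z. K \<in> mesh D n \<Longrightarrow> z \<in> interior K \<Longrightarrow> u z = Q K z"
    using V_h_fields[OF u] by blast
  define P where "P = Q K"
  have P: "poly_field k P" and eq: "\<And>z. z \<in> interior K \<Longrightarrow> u z = P z"
    using Q K unfolding P_def by simp_all
  note loc = derivatives_local[OF eq P]
  have t1: "tr K u z = P z" if "z \<in> K" for z
    by (rule tr_eq[OF eq continuous_poly_field[OF P] that])
  have t2: "tr K (sgrad u) z = sgrad P z" if "z \<in> K" for z
    by (rule tr_eq[OF loc(1) poly_field_sgrad_dt(1)[OF P] that])
  show ?thesis using P eq loc t1 t2 by (intro exI[of _ P]) simp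
qed

lemma facet_continuity:
  assumes K: "K \<in> mesh D n" and S: "S facet_of K"
  shows "facet_continuous S (tr K u)" and "facet_continuous S (tr K (sgrad u))"
    and "S \<in> lateral_facets K \<Longrightarrow> facet_continuous S ub"
proof -
  obtain P where P: "poly_field k P"
    and "\<forall>z\<in>interior K. u z = P z \<and> sgrad u z = sgrad P z \<and> dt u z = dt P z"
    and tr: "\<forall>z\<in>K. tr K u z = P z \<and> tr K (sgrad u) z = sgrad P z"
    using element_field[OF K] by blast
  have sub: "z \<in> K" if "z \<in> rel_interior S" for z
    using that facet_of_imp_subset[OF S] rel_interior_subset by blast
  show "facet_continuous S (tr K u)" "facet_continuous S (tr K (sgrad u))"
    unfolding facet_continuous_def
    by (intro exI[of _ P] exI[of _ "sgrad P"] conjI ballI continuous_poly_field[OF P]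
        poly_field_sgrad_dt(1)[OF P], simp add: tr sub)+
  assume "S \<in> lateral_facets K"
  then have "S \<in> skel D n" using K by (auto simp: skel_def)
  then have "\<forall>i. \<exists>p. p \<in> poly_upto k \<and> (\<forall>z\<in>rel_interior S. ub z $ i = p z)"
    using ub unfolding Vbar_h_def by blast
  from choice[OF this] obtain p where p: "\<forall>i. p i \<in> poly_upto k \<and> (\<forall>z\<in>rel_interior S. ub z $ i = p i z)" ..
  have "continuous_on S (\<lambda>z. \<chi> i. p i z)"
    using p continuous_poly_upto by (intro continuous_on_vec_lambda) blast
  moreover have "\<forall>z\<in>rel_interior S. ub z = (\<chi> i. p i z)" using p by (simp add: vec_eq_iff)
  ultimately show "facet_continuous S ub" unfolding facet_continuous_def by blast
qed

abbreviation normal_t where "normal_t K S \<equiv> fst (outward_normal K S)"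

definition facet_energy :: "'d spacetime set \<Rightarrow> 'd spacetime set \<Rightarrow> real"
  where "facet_energy K S = surf_int S UNIV (\<lambda>z. tr K u z \<bullet> tr K u z)"

text \<open>The Neumann part is left out because there the boundary integrals of the convective form compensate
  the contribution of the facet velocity.\<close>

definition facet_energy_bar :: "'d spacetime set \<Rightarrow> real"
  where "facet_energy_bar S = surf_int S (- neumann_part) (\<lambda>z. ub z \<bullet> ub z)"

definition end_energy :: "real \<Rightarrow> 'd spacetime set \<Rightarrow> real"
  where "end_energy \<tau> K = (\<Sum>S | S facet_of K \<and> normal_t K S = \<tau>. facet_energy K S)"

definition element_volume :: "'d spacetime set \<Rightarrow> real"
  where "element_volume K =
    (LINT z:interior K|lebesgue. u z \<bullet> dt u z + tensor (u z) (u z) \<bullet> sgrad u z)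
    - (LINT z:interior K|lebesgue. 1/2 * (tensor (u z) (u z) \<bullet> sgrad u z + tensor (u z) (u z) \<bullet> sgrad u z))"

text \<open>Skew-symmetrization removes the convective volume terms. What remains is the time derivative of
  the kinetic energy, which the divergence theorem moves to the facets.\<close>

lemma element_volume_eq:
  assumes K: "K \<in> mesh D n"
  shows "element_volume K = 1/2 * (\<Sum>S | S facet_of K. normal_t K S * facet_energy K S)"
proof -
  interpret solid_polytope K by (rule mesh_solid[OF K])
  obtain P where P: "poly_field k P"
    and eq: "\<forall>z\<in>interior K. u z = P z \<and> sgrad u z = sgrad P z \<and> dt u z = dt P z"
    and tr: "\<forall>z\<in>K. tr K u z = P z \<and> tr K (sgrad u) z = sgrad P z"
    using element_field[OF K] by blast
  have Pc: "continuous_on X P" "continuous_on X (sgrad P)" "continuous_on X (dt P)" for X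
    using continuous_poly_field[OF P] poly_field_sgrad_dt[OF P] by blast+
  have tc: "continuous_on X (\<lambda>z. tensor (P z) (P z))" for X
    unfolding tensor_def by (intro continuous_on_vec_lambda continuous_intros Pc)
  note int = integrable_interior[OF compact closure_interior]
  have i1: "set_integrable lebesgue (interior K) (\<lambda>z. P z \<bullet> dt P z)"
    and i2: "set_integrable lebesgue (interior K) (\<lambda>z. tensor (P z) (P z) \<bullet> sgrad P z)"
    by (intro int continuous_intros Pc tc)+
  have "element_volume K = (LINT z:interior K|lebesgue. P z \<bullet> dt P z + tensor (P z) (P z) \<bullet> sgrad P z)
    - (LINT z:interior K|lebesgue. tensor (P z) (P z) \<bullet> sgrad P z)"
    unfolding element_volume_def
    by (intro arg_cong2[of _ _ _ _ minus] set_lebesgue_integral_cong) (auto simp: eq)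
  also have "\<dots> = (LINT z:interior K|lebesgue. P z \<bullet> dt P z)"
    using set_integral_add(2)[OF i1 i2] by simp
  also have "\<dots> = 1/2 * (LINT z:interior K|lebesgue. 2 * (P z \<bullet> dt P z))" by simp
  also have "(LINT z:interior K|lebesgue. 2 * (P z \<bullet> dt P z))
      = (\<Sum>S | S facet_of K. normal_t K S * surf_int S UNIV (\<lambda>z. P z \<bullet> P z))"
  proof (rule time_divergence)
    fix t x
    have "((\<lambda>s. P (s, x)) has_derivative (\<lambda>h. h *\<^sub>R dt P (t, x))) (at t)"
      using poly_field_sgrad_dt(3)[OF P] by (simp add: has_vector_derivative_def)
    from has_derivative_inner[OF this this]
    show "((\<lambda>s. P (s, x) \<bullet> P (s, x)) has_real_derivative 2 * (P (t, x) \<bullet> dt P (t, x))) (at t)"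
      unfolding has_field_derivative_def
      by (rule has_derivative_eq_rhs) (simp add: fun_eq_iff inner_commute)
  qed (intro continuous_intros Pc)+
  also have "\<dots> = (\<Sum>S | S facet_of K. normal_t K S * facet_energy K S)"
  proof (rule sum.cong[OF refl])
    fix S assume "S \<in> {S. S facet_of K}"
    then have S: "S facet_of K" by simp
    interpret S: polytope_facet K S by (rule facetI[OF S])
    have "surf_int S UNIV (\<lambda>z. P z \<bullet> P z) = facet_energy K S"
      unfolding facet_energy_def
    proof (rule S.surf_int_cong(2))
      show "set_integrable lebesgue (chart S -` (S \<inter> UNIV)) (\<lambda>y. tr K u (chart S y) \<bullet> tr K u (chart S y))"
        by (rule S.surf_integrable) (intro facet_cont facet_continuity[OF K S], simp)
    qed (use tr S.S_sub rel_interior_subset in force)+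
    then show "normal_t K S * surf_int S UNIV (\<lambda>z. P z \<bullet> P z) = normal_t K S * facet_energy K S" by simp
  qed
  finally show ?thesis .
qed

lemma facet_sum_split:
  assumes K: "K \<in> mesh D n"
  shows "(\<Sum>S | S facet_of K. normal_t K S * facet_energy K S)
    = (\<Sum>S\<in>lateral_facets K. normal_t K S * facet_energy K S) + end_energy 1 K - end_energy (- 1) K"
proof -
  interpret solid_polytope K by (rule mesh_solid[OF K])
  let ?F = "\<lambda>\<tau>. {S. S facet_of K \<and> normal_t K S = \<tau>}"
  have eq: "{S. S facet_of K} = lateral_facets K \<union> (?F 1 \<union> ?F (- 1))"
    by (auto simp: lateral_facets_def abs_if split: if_splits)
  have fin: "finite (lateral_facets K)" "finite (?F \<tau>)" for \<tau>
    using finite_facets by (auto simp: lateral_facets_def)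
  have "(\<Sum>S | S facet_of K. normal_t K S * facet_energy K S)
    = (\<Sum>S\<in>lateral_facets K. normal_t K S * facet_energy K S) + (\<Sum>S\<in>?F 1 \<union> ?F (- 1). normal_t K S * facet_energy K S)"
    unfolding eq using fin by (intro sum.union_disjoint) (auto simp: lateral_facets_def)
  also have "(\<Sum>S\<in>?F 1 \<union> ?F (- 1). normal_t K S * facet_energy K S)
    = (\<Sum>S\<in>?F 1. normal_t K S * facet_energy K S) + (\<Sum>S\<in>?F (- 1). normal_t K S * facet_energy K S)"
    using fin by (intro sum.union_disjoint) auto
  also have "\<dots> = end_energy 1 K - end_energy (- 1) K"
    by (simp add: end_energy_def sum_negf)
  finally show ?thesis by simp
qed

text \<open>Let \<open>w\<close> be the trace from the element, \<open>b\<close> the facet velocity and \<open>\<beta> = n\<^sub>t + w \<bullet> n\<close>. The two sides of the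
  inequality differ by \<open>\<bar>\<beta>\<bar>/2 \<bar>w - b\<bar>\<^sup>2\<close>, the dissipation due to upwinding. The identity shows that the discontinuous
  upwind indicator leads to a continuous integrand, because it only switches where \<open>\<beta> = 0\<close>.\<close>

lemma upwind_pointwise:
  fixes w b :: "real^'d" and \<eta> :: "'d spacetime"
  shows "(fst \<eta> + w \<bullet> snd \<eta>) * ((w + upwind \<eta> w *\<^sub>R (b - w)) \<bullet> (w - b))
     = (fst \<eta> + w \<bullet> snd \<eta>) * (w \<bullet> (w - b)) - min (fst \<eta> + w \<bullet> snd \<eta>) 0 * ((w - b) \<bullet> (w - b))" (is ?eq)
    and "1/2 * (w \<bullet> snd \<eta>) * (w \<bullet> w - b \<bullet> b) + 1/2 * fst \<eta> * (w \<bullet> w) - 1/2 * fst \<eta> * (b \<bullet> b)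
     \<le> (fst \<eta> + w \<bullet> snd \<eta>) * ((w + upwind \<eta> w *\<^sub>R (b - w)) \<bullet> (w - b))" (is ?le)
proof -
  have "(b - w) \<bullet> (w - b) = - ((w - b) \<bullet> (w - b))" by (simp add: algebra_simps)
  then show eq: ?eq
    by (simp add: upwind_def inner_add_left min_def algebra_simps)
  define \<beta> where "\<beta> = fst \<eta> + w \<bullet> snd \<eta>"
  define q where "q = (w - b) \<bullet> (w - b)"
  have q: "q \<ge> 0" by (simp add: q_def)
  have w: "w \<bullet> (w - b) = 1/2 * q + 1/2 * (w \<bullet> w - b \<bullet> b)"
    by (simp add: q_def algebra_simps inner_commute)
  have "0 \<le> (1/2 * \<beta> - min \<beta> 0) * q" using q by (intro mult_nonneg_nonneg) (auto simp: min_def)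
  then have "1/2 * \<beta> * (w \<bullet> w - b \<bullet> b) \<le> \<beta> * (w \<bullet> (w - b)) - min \<beta> 0 * q"
    unfolding w by (simp add: algebra_simps)
  then show ?le unfolding eq by (simp add: \<beta>_def q_def algebra_simps)
qed

definition convection :: "'d spacetime set \<Rightarrow> 'd spacetime set \<Rightarrow> real"
  where "convection K S = surf_int S UNIV (\<lambda>z. (normal_t K S + tr K u z \<bullet> snd (outward_normal K S)) *
        ((tr K u z + upwind (outward_normal K S) (tr K u z) *\<^sub>R (ub z - tr K u z)) \<bullet> (tr K u z - ub z)))
      - surf_int S UNIV (\<lambda>z. 1/2 * (tr K u z \<bullet> snd (outward_normal K S)) * (tr K u z \<bullet> tr K u z - ub z \<bullet> ub z))"

definition outflow :: "'d spacetime set \<Rightarrow> 'd spacetime set \<Rightarrow> real"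
  where "outflow K S = surf_int S neumann_part (\<lambda>z. max (normal_t K S + ub z \<bullet> snd (outward_normal K S)) 0 * (ub z \<bullet> ub z))
      - surf_int S neumann_part (\<lambda>z. 1/2 * (ub z \<bullet> snd (outward_normal K S)) * (ub z \<bullet> ub z))"

text \<open>Off the Neumann part this is the pointwise upwind inequality. On the Neumann part the outflow terms
  and the remainder \<open>- n\<^sub>t/2 \<bar>b\<bar>\<^sup>2\<close> combine to a nonnegative multiple of \<open>\<bar>b\<bar>\<^sup>2\<close>, because
  \<open>max \<gamma> 0 \<ge> \<gamma>/2\<close> for \<open>\<gamma> = n\<^sub>t + b \<bullet> n\<close>.\<close>

lemma lateral_energy:
  assumes K: "K \<in> mesh D n" and S: "S \<in> lateral_facets K"
  shows "convection K S + outflow K S \<ge> 1/2 * normal_t K S * facet_energy K S - 1/2 * normal_t K S * facet_energy_bar S"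
proof -
  have SK: "S facet_of K" using S by (simp add: lateral_facets_def)
  interpret polytope_facet K S using mesh_facet[OF K SK] .
  note fc[facet_cont] = facet_continuity(1)[OF K SK] facet_continuity(3)[OF K SK S]
  define w where "w = tr K u"
  note fw[facet_cont] = fc(1)[folded w_def]
  have N: "neumann_part \<in> sets borel" by (rule neumann_part_borel)
  let ?A = "\<lambda>z. (fst nu + w z \<bullet> snd nu) * ((w z + upwind nu (w z) *\<^sub>R (ub z - w z)) \<bullet> (w z - ub z))"
  let ?B = "\<lambda>z. 1/2 * (w z \<bullet> snd nu) * (w z \<bullet> w z - ub z \<bullet> ub z)"
  let ?W = "\<lambda>z. 1/2 * fst nu * (w z \<bullet> w z)"
  let ?b = "\<lambda>z. 1/2 * fst nu * (ub z \<bullet> ub z)"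
  have fA: "facet_continuous S ?A"
    unfolding upwind_pointwise(1) by (intro facet_cont)
  have fB: "facet_continuous S ?B" and fW: "facet_continuous S ?W" and fb: "facet_continuous S ?b"
    by (intro facet_cont)+
  have "surf_int S UNIV (\<lambda>z. ?B z + ?W z - ?b z) \<le> surf_int S UNIV ?A"
  proof (rule surf_int_mono[OF facet_continuous_diff[OF facet_continuous_add[OF fB fW] fb] fA])
    show "?B z + ?W z - ?b z \<le> ?A z" for z by (rule upwind_pointwise(2))
  qed simp
  also have "surf_int S UNIV (\<lambda>z. ?B z + ?W z - ?b z) = surf_int S UNIV ?B + surf_int S UNIV ?W - surf_int S UNIV ?b"
    using fB fW fb by (simp add: surf_int_diff surf_int_add facet_continuous_add)
  also have "surf_int S UNIV ?W = 1/2 * fst nu * facet_energy K S"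
    unfolding surf_int_cmult facet_energy_def w_def ..
  finally have conv: "convection K S \<ge> 1/2 * fst nu * facet_energy K S - surf_int S UNIV ?b"
    unfolding convection_def w_def by simp
  have split: "surf_int S UNIV ?b = surf_int S neumann_part ?b + surf_int S (- neumann_part) ?b"
    by (rule surf_int_split[OF fb N])
  have bar: "surf_int S (- neumann_part) ?b = 1/2 * fst nu * facet_energy_bar S"
    unfolding surf_int_cmult facet_energy_bar_def ..
  let ?M = "\<lambda>z. max (fst nu + ub z \<bullet> snd nu) 0 * (ub z \<bullet> ub z)"
  let ?H = "\<lambda>z. 1/2 * (ub z \<bullet> snd nu) * (ub z \<bullet> ub z)"
  have fM: "facet_continuous S ?M" and fH: "facet_continuous S ?H" by (intro facet_cont)+
  have "surf_int S neumann_part (\<lambda>z. ?b z + ?H z) \<le> surf_int S neumann_part ?M"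
  proof (rule surf_int_mono[OF facet_continuous_add[OF fb fH] fM N])
    fix z
    have "1/2 * (fst nu + ub z \<bullet> snd nu) \<le> max (fst nu + ub z \<bullet> snd nu) 0" by (simp add: max_def)
    then have "1/2 * (fst nu + ub z \<bullet> snd nu) * (ub z \<bullet> ub z) \<le> max (fst nu + ub z \<bullet> snd nu) 0 * (ub z \<bullet> ub z)"
      by (rule mult_right_mono) simp
    then show "?b z + ?H z \<le> ?M z" by (simp add: algebra_simps)
  qed
  then have "surf_int S neumann_part ?b \<le> outflow K S"
    unfolding outflow_def using surf_int_add[OF fb fH N] by simp
  then show ?thesis using conv split bar by linarith
qed

definition element_t :: "'d spacetime set \<Rightarrow> real"
  where "element_t K = (\<Sum>S\<in>lateral_facets K. convection K S + outflow K S) - element_volume K + end_energy 1 K"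

lemma t_h_eq: "t_h D n (u, ub) (u, ub) (u, ub) = (\<Sum>K\<in>mesh D n. element_t K)"
  unfolding t_h_def element_t_def convection_def outflow_def element_volume_def end_energy_def
    facet_energy_def lat_int_def top_facets_def neumann_part_def
  by (simp add: sum.distrib sum_subtractf)

text \<open>The facet velocity has a single value on a shared facet, and on an unshared one it vanishes outside the
  Neumann part by the Dirichlet condition.\<close>

lemma bar_energy_cancels: "(\<Sum>K\<in>mesh D n. \<Sum>S\<in>lateral_facets K. normal_t K S * facet_energy_bar S) = 0"
proof (rule normal_sum_cancels)
  fix K S assume K: "K \<in> mesh D n" and S: "S \<in> lateral_facets K"
    and un: "\<And>K'. K' \<in> mesh D n \<Longrightarrow> S facet_of K' \<Longrightarrow> K' = K"
  have "S facet_of K" using S by (simp add: lateral_facets_def)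
  then interpret polytope_facet K S using mesh_facet[OF K] by blast
  show "facet_energy_bar S = 0"
    unfolding facet_energy_bar_def
  proof (rule surf_int_eq_0)
    fix z assume z: "z \<in> rel_interior S" "z \<in> - neumann_part"
    have "z \<in> slab_bdry D n" by (rule unshared_facet_boundary[OF K S z(1) un])
    then have "z \<in> dirichlet D \<inter> slab_bdry D n" using slab_bdry_cases[of z] z(2) by (auto simp: neumann_part_def)
    then have "ub z = 0" using ub unfolding Vbar_h_def by blast
    then show "ub z \<bullet> ub z = 0" by simp
  next
    show "- neumann_part \<in> sets borel" using neumann_part_borel by (rule borel_comp)
  qed
qed

text \<open>Convection does not create energy. The horizontal facets enter the volume term with the factor \<open>-n\<^sub>t/2\<close>; together with
  the integral over the top facet of each element, both kinds are left with the factor \<open>1/2\<close>.\<close>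

theorem t_h_lower_bound:
  "1/2 * (\<Sum>K\<in>mesh D n. end_energy 1 K) + 1/2 * (\<Sum>K\<in>mesh D n. end_energy (- 1) K)
    \<le> t_h D n (u, ub) (u, ub) (u, ub)"
proof -
  have "1/2 * end_energy 1 K + 1/2 * end_energy (- 1) K - 1/2 * (\<Sum>S\<in>lateral_facets K. normal_t K S * facet_energy_bar S)
      \<le> element_t K" if K: "K \<in> mesh D n" for K
  proof -
    have "(\<Sum>S\<in>lateral_facets K. 1/2 * normal_t K S * facet_energy K S - 1/2 * normal_t K S * facet_energy_bar S)
        \<le> (\<Sum>S\<in>lateral_facets K. convection K S + outflow K S)"
      using lateral_energy[OF K] by (rule sum_mono)
    moreover have "(\<Sum>S\<in>lateral_facets K. 1/2 * normal_t K S * facet_energy K S - 1/2 * normal_t K S * facet_energy_bar S)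
       = 1/2 * (\<Sum>S\<in>lateral_facets K. normal_t K S * facet_energy K S)
       - 1/2 * (\<Sum>S\<in>lateral_facets K. normal_t K S * facet_energy_bar S)"
      by (simp add: sum_subtractf sum_distrib_left mult.assoc)
    moreover have "1/2 * x + 1/2 * y - 1/2 * b \<le> c - 1/2 * (l + x - y) + x"
      if "s \<le> c" "s = 1/2 * l - 1/2 * b" for x y b l c s :: real
      using that by (simp add: field_simps)
    ultimately show ?thesis
      unfolding element_t_def element_volume_eq[OF K] facet_sum_split[OF K] by blast
  qed
  then have "(\<Sum>K\<in>mesh D n. 1/2 * end_energy 1 K + 1/2 * end_energy (- 1) K
      - 1/2 * (\<Sum>S\<in>lateral_facets K. normal_t K S * facet_energy_bar S)) \<le> (\<Sum>K\<in>mesh D n. element_t K)"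
    by (rule sum_mono)
  moreover have "(\<Sum>K\<in>mesh D n. 1/2 * end_energy 1 K + 1/2 * end_energy (- 1) K
      - 1/2 * (\<Sum>S\<in>lateral_facets K. normal_t K S * facet_energy_bar S))
    = 1/2 * (\<Sum>K\<in>mesh D n. end_energy 1 K) + 1/2 * (\<Sum>K\<in>mesh D n. end_energy (- 1) K)
      - 1/2 * (\<Sum>K\<in>mesh D n. \<Sum>S\<in>lateral_facets K. normal_t K S * facet_energy_bar S)"
    by (simp only: sum.distrib sum_subtractf sum_distrib_left)
  ultimately show ?thesis unfolding bar_energy_cancels t_h_eq by simp
qed

end

section \<open>Coercivity of the viscous form\<close>

lemma norm_matrix_vector_le: "norm (A *v x) \<le> norm A * norm (x :: real^'n)" for A :: "real^'n^'m"
proof (rule power2_le_imp_le)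
  have "(norm (A *v x))\<^sup>2 = (\<Sum>i\<in>UNIV. (A $ i \<bullet> x)\<^sup>2)"
    unfolding power2_norm_eq_inner by (simp add: inner_vec_def[of "A *v x"] matrix_vector_mul_component power2_eq_square)
  also have "\<dots> \<le> (\<Sum>i\<in>UNIV. (A $ i \<bullet> A $ i) * (x \<bullet> x))"
    by (intro sum_mono Cauchy_Schwarz_ineq)
  also have "\<dots> = (norm A * norm x)\<^sup>2"
    by (simp add: power_mult_distrib power2_norm_eq_inner inner_vec_def[of A] sum_distrib_right)
  finally show "(norm (A *v x))\<^sup>2 \<le> (norm A * norm x)\<^sup>2" .
qed simp

lemma young_ineq:
  fixes a b :: "'a::real_inner"
  assumes "c > 0" shows "2 * (a \<bullet> b) \<le> c * (a \<bullet> a) + (b \<bullet> b) / c"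
proof -
  have "0 \<le> (c *\<^sub>R a - b) \<bullet> (c *\<^sub>R a - b)" by simp
  also have "\<dots> = c * (c * (a \<bullet> a) + (b \<bullet> b) / c - 2 * (a \<bullet> b))"
    using assms by (simp add: algebra_simps inner_commute)
  finally show ?thesis using assms by (simp add: zero_le_mult_iff)
qed

definition inverse_constant :: "nat \<Rightarrow> ('d::finite) spacetime set \<Rightarrow> real"
  where "inverse_constant k K = (SOME C. C \<ge> 0 \<and> (\<forall>P. poly_field k P \<longrightarrow> (\<forall>z\<in>K. (norm (sgrad P z))\<^sup>2
    \<le> C * (LINT z:interior K|lebesgue. (norm (sgrad P z))\<^sup>2))))"

lemma (in solid_polytope) inverse_constant:
  "inverse_constant k K \<ge> 0"
  "poly_field k P \<Longrightarrow> z \<in> K \<Longrightarrow> (norm (sgrad P z))\<^sup>2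
    \<le> inverse_constant k K * (LINT z:interior K|lebesgue. (norm (sgrad P z))\<^sup>2)"
  using someI_ex[OF gradient_inverse_estimate[of k]] unfolding inverse_constant_def[symmetric] by blast+

text \<open>From this value of \<open>\<alpha>\<close> on, what Young's inequality leaves of the consistency terms on the facets is at most
  the viscous volume term of the element.\<close>

definition penalty_threshold :: "nat \<Rightarrow> ('d::finite) setting \<Rightarrow> 'd spacetime set \<Rightarrow> real"
  where "penalty_threshold k D K =
    hsize D K * inverse_constant k K * (\<Sum>S\<in>lateral_facets K. surf_int S UNIV (\<lambda>_. 1))"

context discrete_velocity
begin

text \<open>Young's inequality with weight \<open>\<alpha> / h\<close> splits the consistency terms into the penalty term and a
  gradient on the facet, which the inverse estimate bounds by the gradient in the element.\<close>

lemma viscous_facet: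
  assumes K: "K \<in> mesh D n" and S: "S \<in> lateral_facets K" and \<nu>: "\<nu> > 0" and \<alpha>: "\<alpha> > 0"
    and P: "poly_field k P" and tr: "\<And>z. z \<in> K \<Longrightarrow> tr K (sgrad u) z = sgrad P z"
  shows "surf_int S UNIV (\<lambda>z. \<nu> * ((tr K u z - ub z) \<bullet> (tr K (sgrad u) z *v snd (outward_normal K S))
           + (tr K (sgrad u) z *v snd (outward_normal K S)) \<bullet> (tr K u z - ub z)))
    \<le> surf_int S UNIV (\<lambda>z. \<nu> * \<alpha> / hsize D K * ((tr K u z - ub z) \<bullet> (tr K u z - ub z)))
      + \<nu> * hsize D K / \<alpha> * inverse_constant k K * (LINT z:interior K|lebesgue. (norm (sgrad P z))\<^sup>2)
        * surf_int S UNIV (\<lambda>_. 1)"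
proof -
  have SK: "S facet_of K" using S by (simp add: lateral_facets_def)
  interpret polytope_facet K S using mesh_facet[OF K SK] .
  note fc[facet_cont] = facet_continuity(1)[OF K SK] facet_continuity(3)[OF K SK S]
  have "continuous_on UNIV (\<lambda>G :: real^'d^'d. G *v snd nu)"
    unfolding matrix_vector_mult_def by (intro continuous_on_vec_lambda continuous_intros)
  from facet_continuous_compose[OF facet_continuity(2)[OF K SK] this]
  have fG[facet_cont]: "facet_continuous S (\<lambda>z. tr K (sgrad u) z *v snd nu)" .
  define h where "h = hsize D K"
  have h: "h > 0" using mesh_hsize[OF K] by (simp add: h_def)
  define I where "I = inverse_constant k K * (LINT z:interior K|lebesgue. (norm (sgrad P z))\<^sup>2)"
  let ?e = "\<lambda>z. tr K u z - ub z"
  let ?g = "\<lambda>z. tr K (sgrad u) z *v snd nu"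
  let ?E = "\<lambda>z. \<nu> * \<alpha> / h * (?e z \<bullet> ?e z)"
  have "surf_int S UNIV (\<lambda>z. \<nu> * (?e z \<bullet> ?g z + ?g z \<bullet> ?e z)) \<le> surf_int S UNIV (\<lambda>z. ?E z + \<nu> * h / \<alpha> * I * 1)"
  proof (rule surf_int_mono)
    show "facet_continuous S (\<lambda>z. \<nu> * (?e z \<bullet> ?g z + ?g z \<bullet> ?e z))" by (intro facet_cont)
    show "facet_continuous S (\<lambda>z. ?E z + \<nu> * h / \<alpha> * I * 1)" by (intro facet_cont)
    fix z assume "z \<in> rel_interior S"
    then have z: "z \<in> K" using rel_interior_subset S_sub by blast
    have "norm (?g z) \<le> norm (sgrad P z) * norm (snd nu)"
      unfolding tr[OF z] by (rule norm_matrix_vector_le)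
    also have "\<dots> \<le> norm (sgrad P z)" using norm_snd_nu_le by (simp add: mult_left_le)
    finally have "?g z \<bullet> ?g z \<le> (norm (sgrad P z))\<^sup>2"
      unfolding dot_square_norm by (rule power_mono) simp
    also have "\<dots> \<le> I" unfolding I_def by (rule inverse_constant(2)[OF P z])
    finally have gI: "?g z \<bullet> ?g z \<le> I" .
    have "\<alpha> / h > 0" using \<alpha> h by simp
    from young_ineq[OF this, of "?e z" "?g z"]
    have "2 * (?e z \<bullet> ?g z) \<le> \<alpha> / h * (?e z \<bullet> ?e z) + h / \<alpha> * (?g z \<bullet> ?g z)" by (simp add: mult.commute)
    also have "\<dots> \<le> \<alpha> / h * (?e z \<bullet> ?e z) + h / \<alpha> * I"
      using gI \<alpha> h by (intro add_left_mono mult_left_mono) auto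
    finally have "\<nu> * (2 * (?e z \<bullet> ?g z)) \<le> \<nu> * (\<alpha> / h * (?e z \<bullet> ?e z) + h / \<alpha> * I)"
      using \<nu> by (intro mult_left_mono) auto
    then show "\<nu> * (?e z \<bullet> ?g z + ?g z \<bullet> ?e z) \<le> ?E z + \<nu> * h / \<alpha> * I * 1"
      by (simp add: inner_commute[of "?g z"] algebra_simps)
  qed simp
  also have "surf_int S UNIV (\<lambda>z. ?E z + \<nu> * h / \<alpha> * I * 1)
      = surf_int S UNIV ?E + surf_int S UNIV (\<lambda>z. \<nu> * h / \<alpha> * I * 1)"
    by (rule surf_int_add) (intro facet_cont, intro facet_cont, simp)
  also have "surf_int S UNIV (\<lambda>z. \<nu> * h / \<alpha> * I * 1) = \<nu> * h / \<alpha> * I * surf_int S UNIV (\<lambda>_. 1)"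
    by (rule surf_int_cmult)
  finally show ?thesis by (simp add: I_def h_def mult.assoc)
qed

definition element_a :: "real \<Rightarrow> real \<Rightarrow> 'd spacetime set \<Rightarrow> real"
  where "element_a \<nu> \<alpha> K = (LINT z:interior K|lebesgue. \<nu> * (sgrad u z \<bullet> sgrad u z))
    + (\<Sum>S\<in>lateral_facets K. surf_int S UNIV (\<lambda>z. \<nu> * \<alpha> / hsize D K * ((tr K u z - ub z) \<bullet> (tr K u z - ub z))))
    - (\<Sum>S\<in>lateral_facets K. surf_int S UNIV (\<lambda>z. \<nu> * ((tr K u z - ub z) \<bullet> (tr K (sgrad u) z *v snd (outward_normal K S))
           + (tr K (sgrad u) z *v snd (outward_normal K S)) \<bullet> (tr K u z - ub z))))"

lemma a_h_eq: "a_h D n \<nu> \<alpha> (u, ub) (u, ub) = (\<Sum>K\<in>mesh D n. element_a \<nu> \<alpha> K)"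
  unfolding a_h_def element_a_def lat_int_def by (simp add: sum.distrib sum_subtractf)

lemma element_a_nonneg:
  assumes K: "K \<in> mesh D n" and \<nu>: "\<nu> > 0" and \<alpha>: "\<alpha> > 0" "\<alpha> \<ge> penalty_threshold k D K"
  shows "element_a \<nu> \<alpha> K \<ge> 0"
proof -
  interpret solid_polytope K by (rule mesh_solid[OF K])
  obtain P where P: "poly_field k P"
    and eq: "\<forall>z\<in>interior K. u z = P z \<and> sgrad u z = sgrad P z \<and> dt u z = dt P z"
    and tr: "\<forall>z\<in>K. tr K u z = P z \<and> tr K (sgrad u) z = sgrad P z"
    using element_field[OF K] by blast
  define I where "I = (LINT z:interior K|lebesgue. (norm (sgrad P z))\<^sup>2)"
  have I: "I \<ge> 0" unfolding I_def set_lebesgue_integral_def by (intro integral_nonneg_AE AE_I2) simp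
  have vol: "(LINT z:interior K|lebesgue. \<nu> * (sgrad u z \<bullet> sgrad u z)) = \<nu> * I"
  proof -
    have "(LINT z:interior K|lebesgue. \<nu> * (sgrad u z \<bullet> sgrad u z)) = (LINT z:interior K|lebesgue. \<nu> * (norm (sgrad P z))\<^sup>2)"
      by (rule set_lebesgue_integral_cong) (use eq in \<open>auto simp: dot_square_norm\<close>)
    then show ?thesis by (simp add: I_def)
  qed
  let ?E = "\<lambda>S. surf_int S UNIV (\<lambda>z. \<nu> * \<alpha> / hsize D K * ((tr K u z - ub z) \<bullet> (tr K u z - ub z)))"
  let ?X = "\<lambda>S. surf_int S UNIV (\<lambda>z. \<nu> * ((tr K u z - ub z) \<bullet> (tr K (sgrad u) z *v snd (outward_normal K S))
           + (tr K (sgrad u) z *v snd (outward_normal K S)) \<bullet> (tr K u z - ub z)))"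
  let ?c = "\<nu> * hsize D K / \<alpha> * inverse_constant k K * I"
  have "(\<Sum>S\<in>lateral_facets K. ?X S) \<le> (\<Sum>S\<in>lateral_facets K. ?E S + ?c * surf_int S UNIV (\<lambda>_. 1))"
    unfolding I_def by (intro sum_mono viscous_facet[OF K _ \<nu> \<alpha>(1) P]) (use tr in auto)
  also have "\<dots> = (\<Sum>S\<in>lateral_facets K. ?E S) + ?c * (\<Sum>S\<in>lateral_facets K. surf_int S UNIV (\<lambda>_. 1))"
    by (simp only: sum.distrib sum_distrib_left)
  also have "?c * (\<Sum>S\<in>lateral_facets K. surf_int S UNIV (\<lambda>_. 1)) = \<nu> * I * (penalty_threshold k D K / \<alpha>)"
    by (simp add: penalty_threshold_def)
  also have "\<dots> \<le> \<nu> * I * 1"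
    using \<alpha> \<nu> I by (intro mult_left_mono) (auto simp: divide_le_eq)
  finally show ?thesis unfolding element_a_def vol by simp
qed

lemma a_h_nonneg:
  assumes "\<nu> > 0" "\<alpha> > 0" "\<And>K. K \<in> mesh D n \<Longrightarrow> \<alpha> \<ge> penalty_threshold k D K"
  shows "a_h D n \<nu> \<alpha> (u, ub) (u, ub) \<ge> 0"
  unfolding a_h_eq using assms element_a_nonneg by (intro sum_nonneg) blast

end

section \<open>Energy stability\<close>

lemma set_integral_inner_le:
  fixes f g :: "'a::euclidean_space \<Rightarrow> 'b::euclidean_space"
  assumes f: "(\<lambda>x. indicator A x *\<^sub>R f x) \<in> borel_measurable lebesgue" "set_integrable lebesgue A (\<lambda>x. (norm (f x))\<^sup>2)"
    and g: "(\<lambda>x. indicator A x *\<^sub>R g x) \<in> borel_measurable lebesgue" "set_integrable lebesgue A (\<lambda>x. (norm (g x))\<^sup>2)"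
  shows "(LINT x:A|lebesgue. f x \<bullet> g x)
    \<le> 1/2 * (LINT x:A|lebesgue. (norm (f x))\<^sup>2) + 1/2 * (LINT x:A|lebesgue. (norm (g x))\<^sup>2)"
proof -
  have young: "\<bar>f x \<bullet> g x\<bar> \<le> 1/2 * (norm (f x))\<^sup>2 + 1/2 * (norm (g x))\<^sup>2" for x
  proof -
    have "\<bar>f x \<bullet> g x\<bar> \<le> norm (f x) * norm (g x)" by (rule Cauchy_Schwarz_ineq2)
    moreover have "0 \<le> (norm (f x) - norm (g x))\<^sup>2" by simp
    ultimately show ?thesis by (simp add: power2_diff)
  qed
  have i: "set_integrable lebesgue A (\<lambda>x. 1/2 * (norm (f x))\<^sup>2)" "set_integrable lebesgue A (\<lambda>x. 1/2 * (norm (g x))\<^sup>2)"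
    using f(2) g(2) by auto
  note isum = set_integral_add[OF i]
  have "(\<lambda>x. (indicator A x *\<^sub>R f x) \<bullet> (indicator A x *\<^sub>R g x)) \<in> borel_measurable lebesgue"
    using f(1) g(1) by (rule borel_measurable_inner)
  moreover have "(\<lambda>x. (indicator A x *\<^sub>R f x) \<bullet> (indicator A x *\<^sub>R g x)) = (\<lambda>x. indicator A x *\<^sub>R (f x \<bullet> g x))"
    by (auto simp: indicator_def)
  ultimately have m: "(\<lambda>x. indicator A x *\<^sub>R (f x \<bullet> g x)) \<in> borel_measurable lebesgue" by simp
  have fg: "set_integrable lebesgue A (\<lambda>x. f x \<bullet> g x)"
    unfolding set_integrable_def
  proof (rule Bochner_Integration.integrable_bound[OF isum(1)[unfolded set_integrable_def] m], rule AE_I2)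
    show "norm (indicator A x *\<^sub>R (f x \<bullet> g x))
        \<le> norm (indicator A x *\<^sub>R (1/2 * (norm (f x))\<^sup>2 + 1/2 * (norm (g x))\<^sup>2))" for x
      using young[of x] by (auto simp: indicator_def)
  qed
  have "(LINT x:A|lebesgue. f x \<bullet> g x) \<le> (LINT x:A|lebesgue. 1/2 * (norm (f x))\<^sup>2 + 1/2 * (norm (g x))\<^sup>2)"
    by (rule set_integral_mono[OF fg isum(1)]) (use young abs_le_D1 in blast)
  also have "\<dots> = 1/2 * (LINT x:A|lebesgue. (norm (f x))\<^sup>2) + 1/2 * (LINT x:A|lebesgue. (norm (g x))\<^sup>2)"
    unfolding isum(2) by simp
  finally show ?thesis .
qed

context space_time_slab
begin

lemma L_h_homogeneous:
  assumes f0: "\<forall>z\<in>st_domain D. f z = 0" and g0: "\<forall>z\<in>neumann D. g z = 0"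
  shows "L_h D n f g um (v, vb) = (LINT x:Omega D (tm D n)|lebesgue. um x \<bullet> trace_above v (tm D n) x)"
proof -
  have "(LINT z:interior K|lebesgue. f z \<bullet> v z) = 0" if K: "K \<in> mesh D n" for K
  proof -
    have "f z = 0" if "z \<in> interior K" for z
      using mesh_interior[OF K] that f0 by (auto simp: slab_def)
    then have "(LINT z:interior K|lebesgue. f z \<bullet> v z) = (LINT z:interior K|lebesgue. 0)"
      by (intro set_lebesgue_integral_cong) auto
    then show ?thesis by (simp add: set_lebesgue_integral_def)
  qed
  moreover have "lat_int K (neumann D \<inter> slab_bdry D n) (\<lambda>\<eta> z. g z \<bullet> vb z) = 0" for K
  proof -
    have "(\<lambda>y. indicator (chart S -` (S \<inter> (neumann D \<inter> slab_bdry D n))) y *\<^sub>R (g (chart S y) \<bullet> vb (chart S y)))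
        = (\<lambda>_. 0)" for S
      using g0 by (auto simp: indicator_def)
    then show ?thesis unfolding lat_int_def surf_int_def set_lebesgue_integral_def by (simp only: integral_zero sum.neutral_const)
  qed
  ultimately show ?thesis by (simp add: L_h_def)
qed

text \<open>Test with the solution itself. The pressure terms vanish, the energy of the trace at the bottom is absorbed by the
  lower bound of the convective form, and what remains is the energy at the top.\<close>

lemma slab_energy:
  assumes um: "(\<lambda>x. indicator (Omega D (tm D n)) x *\<^sub>R um x) \<in> borel_measurable lebesgue"
      "set_integrable lebesgue (Omega D (tm D n)) (\<lambda>x. (norm (um x))\<^sup>2)"
    and sol: "slab_solution m k D \<nu> \<alpha> f g n um U P"
    and f0: "\<forall>z\<in>st_domain D. f z = 0" and g0: "\<forall>z\<in>neumann D. g z = 0"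
    and \<nu>: "\<nu> > 0" and \<alpha>: "\<alpha> > 0" "\<And>K. K \<in> mesh D n \<Longrightarrow> \<alpha> \<ge> penalty_threshold k D K"
  shows "(LINT x:Omega D (tm D (Suc n))|lebesgue. (norm (trace_below (fst U) (tm D (Suc n)) x))\<^sup>2)
      \<le> (LINT x:Omega D (tm D n)|lebesgue. (norm (um x))\<^sup>2)"
proof -
  obtain u ub where U: "U = (u, ub)" by (cases U)
  have UX: "U \<in> X_v m k D n" and PX: "P \<in> X_q m k D n"
    and eq: "\<forall>v\<in>X_v m k D n. t_h D n U U v + a_h D n \<nu> \<alpha> U v + b_h D n P v = L_h D n f g um v"
    and div: "\<forall>q\<in>X_q m k D n. b_h D n q U = 0"
    using sol unfolding slab_solution_def by blast+
  have u: "u \<in> V_h k D n" and ub: "ub \<in> Vbar_h k D n"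
    using UX unfolding U X_v_def by (auto split: hdg_variant.splits)
  interpret discrete_velocity D n k u ub using u ub by unfold_locales
  have lm: "level (- 1) = tm D n" and lp: "level 1 = tm D (Suc n)" by (simp_all add: level_def)
  have em: "end_trace (- 1) u = trace_above u (tm D n)" and ep: "end_trace 1 u = trace_below u (tm D (Suc n))"
    by (simp_all add: end_trace_def lm lp fun_eq_iff)
  have ends: "(\<Sum>K\<in>mesh D n. \<Sum>S | S facet_of K \<and> fst (outward_normal K S) = \<tau>.
          surf_int S UNIV (\<lambda>z. tr K u z \<bullet> tr K u z)) = (\<Sum>K\<in>mesh D n. end_energy \<tau> K)" for \<tau>
    by (simp add: end_energy_def facet_energy_def)
  note bottom = end_trace_L2[of "- 1", OF _ u, unfolded ends lm em]
  note top = end_trace_L2(3)[of 1, OF _ u, unfolded ends lp ep]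
  have "t_h D n U U U + a_h D n \<nu> \<alpha> U U + b_h D n P U = L_h D n f g um U" using eq UX by blast
  moreover have "b_h D n P U = 0" using div PX by blast
  moreover have "a_h D n \<nu> \<alpha> U U \<ge> 0" unfolding U by (rule a_h_nonneg[OF \<nu> \<alpha>])
  moreover have "L_h D n f g um U = (LINT x:Omega D (tm D n)|lebesgue. um x \<bullet> trace_above u (tm D n) x)"
    unfolding U by (rule L_h_homogeneous[OF f0 g0])
  moreover have "\<dots> \<le> 1/2 * (LINT x:Omega D (tm D n)|lebesgue. (norm (um x))\<^sup>2)
      + 1/2 * (LINT x:Omega D (tm D n)|lebesgue. (norm (trace_above u (tm D n) x))\<^sup>2)"
    by (rule set_integral_inner_le[OF um bottom(1,2)]) simp_all
  moreover have "(LINT x:Omega D (tm D n)|lebesgue. (norm (trace_above u (tm D n) x))\<^sup>2) \<le> (\<Sum>K\<in>mesh D n. end_energy (- 1) K)"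
    by (rule bottom(3)) simp
  moreover have "(LINT x:Omega D (tm D (Suc n))|lebesgue. (norm (trace_below u (tm D (Suc n)) x))\<^sup>2) \<le> (\<Sum>K\<in>mesh D n. end_energy 1 K)"
    by (rule top) simp
  ultimately show ?thesis using t_h_lower_bound unfolding U by simp
qed

end

text \<open>On the first slab the incoming velocity is a trace at the bottom of that slab, later it is a trace at the
  top of the previous slab.\<close>

lemma incoming_velocity_L2:
  assumes disc: "st_discretization D" and n: "n < slabs D"
    and init: "uinit \<in> init_space m k D"
    and sol: "\<And>j. j < n \<Longrightarrow> fst (U j) \<in> V_h k D j"
  shows "(\<lambda>x. indicator (Omega D (tm D n)) x *\<^sub>R u_minus D uinit U n x) \<in> borel_measurable lebesgue"
    and "set_integrable lebesgue (Omega D (tm D n)) (\<lambda>x. (norm (u_minus D uinit U n x))\<^sup>2)"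
proof -
  have "(\<lambda>x. indicator (Omega D (tm D n)) x *\<^sub>R u_minus D uinit U n x) \<in> borel_measurable lebesgue \<and>
    set_integrable lebesgue (Omega D (tm D n)) (\<lambda>x. (norm (u_minus D uinit U n x))\<^sup>2)"
  proof (cases n)
    case 0
    interpret space_time_slab D 0 using disc n 0 by unfold_locales auto
    have t0: "tm D 0 = 0" using disc unfolding st_discretization_def by blast
    obtain v where v: "v \<in> V_h k D 0" "\<forall>x\<in>Omega D 0. uinit x = trace_above v 0 x"
      using init unfolding init_space_def by blast
    have lm: "level (- 1) = 0" and em: "end_trace (- 1) v = trace_above v 0"
      by (simp_all add: level_def end_trace_def t0 fun_eq_iff)
    note L = end_trace_L2(1,2)[of "- 1", OF _ v(1), unfolded lm em]
    have "(\<lambda>x. indicator (Omega D 0) x *\<^sub>R uinit x) = (\<lambda>x. indicator (Omega D 0) x *\<^sub>R trace_above v 0 x)"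
    proof
      show "indicator (Omega D 0) x *\<^sub>R uinit x = indicator (Omega D 0) x *\<^sub>R trace_above v 0 x" for x
        using v(2) by (cases "x \<in> Omega D 0") simp_all
    qed
    moreover have "set_integrable lebesgue (Omega D 0) (\<lambda>x. (norm (uinit x))\<^sup>2)
        \<longleftrightarrow> set_integrable lebesgue (Omega D 0) (\<lambda>x. (norm (trace_above v 0 x))\<^sup>2)"
      using v(2) by (intro set_integrable_cong refl) auto
    ultimately show ?thesis using L by (simp add: u_minus_def 0 t0)
  next
    case (Suc j)
    interpret space_time_slab D j using disc n Suc by unfold_locales auto
    have v: "fst (U j) \<in> V_h k D j" using sol Suc by simp
    have lp: "level 1 = tm D n" and ep: "end_trace 1 (fst (U j)) = trace_below (fst (U j)) (tm D n)"
      by (simp_all add: level_def end_trace_def Suc fun_eq_iff)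
    show ?thesis
      using end_trace_L2(1,2)[of 1, OF _ v, unfolded lp ep] by (simp add: u_minus_def Suc)
  qed
  then show "(\<lambda>x. indicator (Omega D (tm D n)) x *\<^sub>R u_minus D uinit U n x) \<in> borel_measurable lebesgue"
    and "set_integrable lebesgue (Omega D (tm D n)) (\<lambda>x. (norm (u_minus D uinit U n x))\<^sup>2)" by blast+
qed

theorem proposition2:
  fixes D :: "('d::finite) setting"
    and m :: hdg_variant and k :: nat and \<nu> :: real
    and f g :: "'d field"
  assumes dim: "CARD('d) \<in> {2, 3}"
    and disc: "st_discretization D"
    and k: "k \<ge> 1"
    and visc: "\<nu> > 0"
    and f0: "\<forall>z\<in>st_domain D. f z = 0"
    and g0: "\<forall>z\<in>neumann D. g z = 0"
  shows "\<exists>\<alpha>0>0. \<forall>\<alpha>\<ge>\<alpha>0. \<forall>proj u0 U P n.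
    init_projection m k D proj \<and> div_free (Omega D 0) u0 \<and> n < slabs D \<and>
    (\<forall>j\<le>n. slab_solution m k D \<nu> \<alpha> f g j (u_minus D (proj u0) U j) (U j) (P j)) \<longrightarrow>
      (LINT x:Omega D (tm D (Suc n))|lebesgue. (norm (trace_below (fst (U n)) (tm D (Suc n)) x))\<^sup>2)
      \<le> (LINT x:Omega D (tm D n)|lebesgue. (norm (u_minus D (proj u0) U n x))\<^sup>2)"
proof -
  \<comment> \<open>the elements of all slabs; their finitely many thresholds depend on the mesh and on \<open>k\<close> only\<close>
  define M where "M = (\<Union>n<slabs D. mesh D n)"
  define \<alpha>0 where "\<alpha>0 = 1 + (\<Sum>K\<in>M. \<bar>penalty_threshold k D K\<bar>)"
  have slab: "space_time_slab D n" if "n < slabs D" for n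
    using disc that by unfold_locales
  have "finite M"
    unfolding M_def using space_time_slab.finite_mesh[OF slab] by blast
  then have threshold: "penalty_threshold k D K < \<alpha>0" if "K \<in> M" for K
    using member_le_sum[OF that, of "\<lambda>K. \<bar>penalty_threshold k D K\<bar>"] by (simp add: \<alpha>0_def)
  have pos: "\<alpha>0 > 0" unfolding \<alpha>0_def by (intro add_pos_nonneg sum_nonneg) auto
  show ?thesis
  proof (rule exI[of _ \<alpha>0], rule conjI, rule pos, rule allI, rule impI, (rule allI)+)
    fix \<alpha> proj u0 U P n
    assume \<alpha>: "\<alpha>0 \<le> \<alpha>"
    then have \<alpha>_pos: "\<alpha> > 0" using pos by linarith
    show "init_projection m k D proj \<and> div_free (Omega D 0) u0 \<and> n < slabs D \<and>
      (\<forall>j\<le>n. slab_solution m k D \<nu> \<alpha> f g j (u_minus D (proj u0) U j) (U j) (P j)) \<longrightarrow>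
      (LINT x:Omega D (tm D (Suc n))|lebesgue. (norm (trace_below (fst (U n)) (tm D (Suc n)) x))\<^sup>2)
      \<le> (LINT x:Omega D (tm D n)|lebesgue. (norm (u_minus D (proj u0) U n x))\<^sup>2)"
    proof
      assume *: "init_projection m k D proj \<and> div_free (Omega D 0) u0 \<and> n < slabs D \<and>
        (\<forall>j\<le>n. slab_solution m k D \<nu> \<alpha> f g j (u_minus D (proj u0) U j) (U j) (P j))"
      have n: "n < slabs D" using * by blast
      have sol: "slab_solution m k D \<nu> \<alpha> f g j (u_minus D (proj u0) U j) (U j) (P j)" if "j \<le> n" for j
        using * that by blast
      have init: "proj u0 \<in> init_space m k D"
        using * unfolding init_projection_def by blast
      have V: "fst (U j) \<in> V_h k D j" if "j < n" for j
      proof -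
        have "U j \<in> X_v m k D j" using sol[of j] that unfolding slab_solution_def by simp
        then show ?thesis unfolding X_v_def by auto
      qed
      have L2: "(\<lambda>x. indicator (Omega D (tm D n)) x *\<^sub>R u_minus D (proj u0) U n x) \<in> borel_measurable lebesgue"
        "set_integrable lebesgue (Omega D (tm D n)) (\<lambda>x. (norm (u_minus D (proj u0) U n x))\<^sup>2)"
        using incoming_velocity_L2[where U = U, OF disc n init] V by blast+
      interpret space_time_slab D n by (rule slab[OF n])
      have penalty: "penalty_threshold k D K \<le> \<alpha>" if "K \<in> mesh D n" for K
      proof -
        have "K \<in> M" using that n by (auto simp: M_def)
        then show ?thesis using threshold[of K] \<alpha> by linarith
      qed
      show "(LINT x:Omega D (tm D (Suc n))|lebesgue. (norm (trace_below (fst (U n)) (tm D (Suc n)) x))\<^sup>2)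
        \<le> (LINT x:Omega D (tm D n)|lebesgue. (norm (u_minus D (proj u0) U n x))\<^sup>2)"
        by (rule slab_energy[OF L2 sol[OF order_refl] f0 g0 visc \<alpha>_pos penalty])
    qed
  qed
qed

end
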